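(* Let $K$ be a field, let $p=p(n)\in[0,1]$, and let $I(n,p)\subset K[x_1,\ldots,x_n]$ be the edge ideal of the Erd\H{o}s--R\'enyi random graph $G(n,p)$. Suppose $(n(1-p))^4p^2\to\lambda\in(0,\infty)$ as $n\to\infty$. If $p\to 0$, then $$\lim_{n\to\infty}\Pr\big(I(n,p)\text{ has a linear resolution}\big)=\lim_{n\to\infty}\Pr\big(I(n,p)\text{ has a linear presentation}\big)=e^{-\sqrt{\lambda}/2}\Big(1+\frac{\sqrt{\lambda}}{2}\Big).$$ If $p\to 1$, then $$\lim_{n\to\infty}\Pr\big(I(n,p)\text{ has a linear presentation}\big)=e^{-\lambda/8}\quad\text{and}\quad \lim_{n\to\infty}\Pr\big(I(n,p)\text{ has a linear resolution}\big)=\exp\Big(-\sum_{k\ge 4}\frac{\lambda^{k/4}}{2k}\Big).$$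
   Context: The Erd\H{o}s--R\'enyi random graph $G(n,p)$ has vertex set $[n]=\{1,\ldots,n\}$, and each pair $\{i,j\}$, $i\ne j$, is an edge independently with probability $p$. For a simple graph $G$ on $[n]$, its edge ideal is $I(G)=(x_ix_j : \{i,j\}\in E(G))\subset K[x_1,\ldots,x_n]$, and $I(n,p):=I(G(n,p))$. A homogeneous ideal has a linear presentation if the matrix of the first map of its minimal graded free resolution has only linear or zero entries; it has a linear resolution if all maps in its minimal graded free resolution have linear entries (for an edge ideal, equivalently its Castelnuovo--Mumford regularity equals $2$). *)

theory Defs
  imports
    "HOL-Library.Poly_Mapping"
    "HOL-Algebra.Ideal"
    "HOL-Probability.Product_PMF"
    "Jordan_Normal_Form.Matrix"
begin

(* The notation of HOL-Analysis for its vectors clashes with that of Jordan_Normal_Form. *)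
no_notation Finite_Cartesian_Product.vec_nth (infixl "$" 90)
no_notation Inner_Product.real_inner_class.inner (infix "\<bullet>" 70)

section \<open>The polynomial ring\<close>

text \<open>
  A monomial is its exponent vector, and a polynomial maps monomials to coefficients. The type
  has the variables \<open>x\<^sub>0, x\<^sub>1, \<dots>\<close>; the ring \<open>K[x\<^sub>1,\<dots>,x\<^sub>n]\<close> is the subring of the polynomials in
  which only \<open>x\<^sub>1,\<dots>,x\<^sub>n\<close> occur.
\<close>

type_synonym monomial = "nat \<Rightarrow>\<^sub>0 nat"
type_synonym 'k mpoly = "monomial \<Rightarrow>\<^sub>0 'k"

definition indet :: "nat \<Rightarrow> 'k::field mpoly" where
  "indet i = Poly_Mapping.single (Poly_Mapping.single i 1) 1"

definition mdeg :: "monomial \<Rightarrow> nat" where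
  "mdeg m = (\<Sum>i\<in>Poly_Mapping.keys m. Poly_Mapping.lookup m i)"

definition polys :: "nat \<Rightarrow> 'k::field mpoly set" where
  "polys n = {f. \<forall>m\<in>Poly_Mapping.keys f. Poly_Mapping.keys m \<subseteq> {1..n}}"

definition poly_ring :: "nat \<Rightarrow> 'k::field mpoly ring" where
  "poly_ring n = \<lparr>carrier = polys n, monoid.mult = (*), one = 1, zero = 0, add = (+)\<rparr>"

text \<open>The zero polynomial is homogeneous of every degree, so a linear entry may be zero.\<close>

definition homogeneous :: "int \<Rightarrow> 'k::field mpoly \<Rightarrow> bool" where
  "homogeneous d f \<longleftrightarrow> (\<forall>m\<in>Poly_Mapping.keys f. int (mdeg m) = d)"

abbreviation linear_form :: "'k::field mpoly \<Rightarrow> bool" where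
  "linear_form f \<equiv> homogeneous 1 f"

definition irrelevant_ideal :: "nat \<Rightarrow> 'k::field mpoly set" where
  "irrelevant_ideal n = {f \<in> polys n. Poly_Mapping.lookup f 0 = 0}"

section \<open>Minimal graded free resolutions\<close>

definition free_module :: "nat \<Rightarrow> nat \<Rightarrow> 'k::field mpoly Matrix.vec set" where
  "free_module n r = {v \<in> carrier_vec r. \<forall>j<r. v $ j \<in> polys n}"

text \<open>
  Let \<open>S = K[x\<^sub>1,\<dots>,x\<^sub>n]\<close>. The data \<open>b, d, g, A\<close> describe a complex
  \<open>\<dots> \<rightarrow> F\<^sub>2 \<rightarrow> F\<^sub>1 \<rightarrow> F\<^sub>0 \<rightarrow> I \<rightarrow> 0\<close>
  where \<open>F\<^sub>i\<close> is the free module of rank \<open>b i\<close> whose \<open>j\<close>-th basis element has degree \<open>d i j\<close>,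
  that is, the direct sum of the modules \<open>S(-d i j)\<close> for \<open>j < b i\<close>. The row \<open>g\<close> lists the images of
  the basis of \<open>F\<^sub>0\<close> in \<open>I\<close>, and the matrix \<open>A i\<close> is the map from \<open>F\<^sub>i\<^sub>+\<^sub>1\<close> to \<open>F\<^sub>i\<close>. So the
  ideal \<open>I\<close> itself is resolved, not \<open>S/I\<close>, and the first map is \<open>A 0\<close>. Modules
  of rank 0 are allowed, so that finite resolutions are included.

  The maps have to be homogeneous of degree 0, exact, and minimal, which means that the image
  of \<open>F\<^sub>i\<^sub>+\<^sub>1\<close> lies in the product of the irrelevant ideal with \<open>F\<^sub>i\<close>.
\<close>

definition minimal_graded_free_resolution ::
    "nat \<Rightarrow> 'k::field mpoly set \<Rightarrow> (nat \<Rightarrow> nat) \<Rightarrow> (nat \<Rightarrow> nat \<Rightarrow> int) \<Rightarrow>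
     'k mpoly Matrix.vec \<Rightarrow> (nat \<Rightarrow> 'k mpoly Matrix.mat) \<Rightarrow> bool" where
  "minimal_graded_free_resolution n I b d g A \<longleftrightarrow>
     g \<in> free_module n (b 0) \<and>
     (\<forall>j < b 0. homogeneous (d 0 j) (g $ j)) \<and>
     (\<forall>i. A i \<in> carrier_mat (b i) (b (Suc i))) \<and>
     (\<forall>i. \<forall>r < b i. \<forall>c < b (Suc i).
        A i $$ (r, c) \<in> irrelevant_ideal n \<and>
        homogeneous (d (Suc i) c - d i r) (A i $$ (r, c))) \<and>
     (\<lambda>v. g \<bullet> v) ` free_module n (b 0) = I \<and>
     {v \<in> free_module n (b 0). g \<bullet> v = 0} = (\<lambda>w. A 0 *\<^sub>v w) ` free_module n (b 1) \<and>
     (\<forall>i. {v \<in> free_module n (b (Suc i)). A i *\<^sub>v v = 0\<^sub>v (b i)} =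
          (\<lambda>w. A (Suc i) *\<^sub>v w) ` free_module n (b (Suc (Suc i))))"

text \<open>
  A minimal graded free resolution is unique up to isomorphism of graded complexes, and such an
  isomorphism preserves linearity of the entries. It therefore does not matter which one is used.
\<close>

definition has_linear_presentation :: "nat \<Rightarrow> 'k::field mpoly set \<Rightarrow> bool" where
  "has_linear_presentation n I \<longleftrightarrow>
     (\<exists>b d g A. minimal_graded_free_resolution n I b d g A \<and>
        (\<forall>r < b 0. \<forall>c < b 1. linear_form (A 0 $$ (r, c))))"

definition has_linear_resolution :: "nat \<Rightarrow> 'k::field mpoly set \<Rightarrow> bool" where
  "has_linear_resolution n I \<longleftrightarrow>
     (\<exists>b d g A. minimal_graded_free_resolution n I b d g A \<and>
        (\<forall>i. \<forall>r < b i. \<forall>c < b (Suc i). linear_form (A i $$ (r, c))))"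

section \<open>Random graphs and edge ideals\<close>

text \<open>A simple graph on \<open>{1..n}\<close> is given by its set of edges, a subset of \<open>vertex_pairs n\<close>.\<close>

definition vertex_pairs :: "nat \<Rightarrow> nat set set" where
  "vertex_pairs n = {e. e \<subseteq> {1..n} \<and> card e = 2}"

definition erdos_renyi :: "nat \<Rightarrow> real \<Rightarrow> nat set set pmf" where
  "erdos_renyi n p =
     map_pmf (\<lambda>present. {e \<in> vertex_pairs n. present e})
       (Pi_pmf (vertex_pairs n) False (\<lambda>_. bernoulli_pmf p))"

definition edge_ideal :: "nat \<Rightarrow> nat set set \<Rightarrow> 'k::field mpoly set" where
  "edge_ideal n G = Idl\<^bsub>poly_ring n\<^esub> {indet i * indet j |i j. {i, j} \<in> G}"

section \<open>The exponential of a possibly infinite sum\<close>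

text \<open>The function \<open>exp (- x)\<close> for \<open>x\<close> in \<open>[0, \<infinity>]\<close>, with the convention \<open>exp (- \<infinity>) = 0\<close>.\<close>

definition exp_neg :: "ennreal \<Rightarrow> real" where
  "exp_neg x = (if x = \<infinity> then 0 else exp (- enn2real x))"

end

theory Submission
  imports Defs
begin

text \<open>
  Let \<open>H\<close> be the complement of the graph, so its edges have probability \<open>q = 1 - p\<close>.

  If the first \<open>k - 3\<close> maps of a minimal resolution of \<open>I\<close> are linear, then \<open>H\<close> has no induced
  \<open>k\<close>-cycle: chasing an element through the double complex of the resolution and the Koszul complex
  of the variables shows that the Koszul homology of \<open>I\<close> vanishes in the relevant degree, whereas
  an induced cycle gives a nonzero class there. Conversely, if \<open>H\<close> has no induced 4-cycle, then the
  pairwise syzygies of the edge monomials reduce to linear ones; and if \<open>v\<close> is a simplicial vertex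
  of \<open>H\<close>, then \<open>I = J + x\<^sub>v Q\<close> with \<open>J\<close> the ideal of the graph without \<open>v\<close> and
  \<open>Q\<close> the ideal of the neighbours of \<open>v\<close> in the graph, and the mapping cone of a lift of
  \<open>J \<subseteq> Q\<close> is a linear resolution of \<open>I\<close>. A graph \<open>H\<close> without cycles of length at least 4 always
  has a simplicial vertex, at the end of a longest path.

  For \<open>p \<rightarrow> 0\<close> the edges are pairwise disjoint with high probability, and then both properties mean that there is
  at most one edge. For \<open>p \<rightarrow> 1\<close> we have \<open>n q \<rightarrow> \<lambda>\<^sup>1\<^sup>/\<^sup>4\<close>; the numbers of short cycles are
  asymptotically Poisson, because distinct overlapping cycles span more edges than vertices and are
  therefore negligible, and for the same reason short cycles are induced. Long cycles are negligible
  if \<open>\<lambda> < 1\<close>, and for \<open>\<lambda> \<ge> 1\<close> the short cycles alone force the limit 0.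
\<close>

text \<open>Linearity is defined by the existence of one good resolution. Refuting it means handling
  an arbitrary resolution, which the Koszul chase does using exactness and the linearity of the maps
  that it passes through. Proving a linear presentation means exhibiting a complete minimal
  resolution, although only its first matrix is of interest; Dickson's lemma and minimal homogeneous
  generators serve to continue it. For linear resolutions the mapping cone already is the complete
  resolution, and linear entries make it minimal.

  The random estimates rest on one count: if \<open>n * q\<close> is bounded, a pattern with
  \<open>v\<close> vertices and at least \<open>v + 1\<close> edges of the complement is expected of
  order \<open>n ^ v * q ^ (v + 1)\<close> times, which tends to 0. The constants
  \<open>1 / (2 * k)\<close> come from the \<open>2 * k\<close> ways to write a cycle of length
  \<open>k\<close> as a list, and 8 is \<open>2 * 4\<close>. For \<open>p\<close> tending to 0 the
  hypothesis says that \<open>n ^ 2 * p\<close> tends to \<open>sqrt lam\<close>, so the number of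
  edges is asymptotically Poisson with mean \<open>sqrt lam / 2\<close>, and the limit is the
  probability of the values 0 and 1.\<close>

abbreviation keys :: "('a \<Rightarrow>\<^sub>0 'b::zero) \<Rightarrow> 'a set" where "keys \<equiv> Poly_Mapping.keys"
abbreviation lookup :: "('a \<Rightarrow>\<^sub>0 'b::zero) \<Rightarrow> 'a \<Rightarrow> 'b" where "lookup \<equiv> Poly_Mapping.lookup"

section \<open>Polynomials and monomial ideals\<close>

lemma mdeg_eq_sum:
  assumes "finite A" "keys m \<subseteq> A"
  shows "mdeg m = (\<Sum>i\<in>A. lookup m i)"
  unfolding mdeg_def
  by (rule sum.mono_neutral_left) (use assms in \<open>auto simp: in_keys_iff\<close>)

lemma mdeg_add [simp]: "mdeg (a + b) = mdeg a + mdeg b"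
proof -
  have "keys (a + b) \<subseteq> keys a \<union> keys b" by (rule Poly_Mapping.keys_add)
  then have "mdeg (a + b) = (\<Sum>i\<in>keys a \<union> keys b. lookup (a + b) i)"
    by (intro mdeg_eq_sum) auto
  moreover have "mdeg a = (\<Sum>i\<in>keys a \<union> keys b. lookup a i)"
    by (intro mdeg_eq_sum) auto
  moreover have "mdeg b = (\<Sum>i\<in>keys a \<union> keys b. lookup b i)"
    by (intro mdeg_eq_sum) auto
  ultimately show ?thesis by (simp add: lookup_add sum.distrib)
qed

lemma mdeg_zero [simp]: "mdeg 0 = 0" by (simp add: mdeg_def)

lemma mdeg_single [simp]: "mdeg (Poly_Mapping.single i k) = k"
  by (simp add: mdeg_def)

lemma mdeg_eq_0_iff [simp]: "mdeg m = 0 \<longleftrightarrow> m = 0"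
proof
  assume "mdeg m = 0"
  then have "lookup m i = 0" for i by (cases "i \<in> keys m") (auto simp: mdeg_def in_keys_iff)
  then show "m = 0" by (intro poly_mapping_eqI) simp
qed simp

lemma mdeg_eq_1: 
  assumes "mdeg m = 1" obtains v where "m = Poly_Mapping.single v 1"
proof -
  have "\<exists>v. v \<in> keys m" using assms by (intro ex_in_conv[THEN iffD2] notI) (simp add: mdeg_def)
  then obtain v where v: "v \<in> keys m" by auto
  have m: "m = Poly_Mapping.single v 1 + (m - Poly_Mapping.single v 1)"
    using v by (intro poly_mapping_eqI) (auto simp: lookup_add lookup_minus lookup_single in_keys_iff when_def)
  have "mdeg m = 1 + mdeg (m - Poly_Mapping.single v 1)"
    by (subst m, subst mdeg_add, subst mdeg_single) simp
  then have "m - Poly_Mapping.single v 1 = 0" using assms by simp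
  then show thesis using that m by simp
qed

lemma lookup_single_mult:
  fixes f :: "'k::field mpoly"
  shows "lookup (Poly_Mapping.single a c * f) (a + m) = c * lookup f m"
  by (simp add: lookup_mult lookup_single when_mult mult_when)

lemma lookup_single_mult_not:
  fixes f :: "'k::field mpoly"
  assumes "\<And>m. k \<noteq> a + m"
  shows "lookup (Poly_Mapping.single a c * f) k = 0"
  by (simp add: lookup_mult lookup_single when_mult mult_when assms)

lemma polys_zero [simp]: "0 \<in> polys n" by (simp add: polys_def)
lemma polys_one [simp]: "1 \<in> polys n" by (simp add: polys_def)

lemma keys_add_monomial: "keys (a + b :: monomial) = keys a \<union> keys b"
  by (auto simp: in_keys_iff lookup_add)

lemma polys_add [simp]: "f \<in> polys n \<Longrightarrow> g \<in> polys n \<Longrightarrow> f + g \<in> polys n"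
  unfolding polys_def using Poly_Mapping.keys_add[of f g] by blast

lemma polys_uminus [simp]: "f \<in> polys n \<Longrightarrow> - f \<in> polys n"
  by (simp add: polys_def in_keys_iff)

lemma polys_diff [simp]: "f \<in> polys n \<Longrightarrow> g \<in> polys n \<Longrightarrow> f - g \<in> polys n"
  using polys_add[of f n "- g"] by simp

lemma polys_mult [simp]: "f \<in> polys n \<Longrightarrow> g \<in> polys n \<Longrightarrow> f * g \<in> polys n"
  unfolding polys_def using keys_mult[of f g] by (fastforce simp: keys_add_monomial)

lemma polys_sum [simp]: "(\<And>x. x \<in> X \<Longrightarrow> f x \<in> polys n) \<Longrightarrow> sum f X \<in> polys n"
  by (induction X rule: infinite_finite_induct) auto

lemma polys_single: "keys m \<subseteq> {1..n} \<Longrightarrow> Poly_Mapping.single m c \<in> polys n"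
  by (simp add: polys_def)

lemma polys_single0 [simp]: "Poly_Mapping.single 0 c \<in> polys n"
  by (simp add: polys_def)

lemma homogeneous_single0 [simp]: "homogeneous 0 (Poly_Mapping.single 0 c)"
  by (simp add: homogeneous_def)

lemma polys_indet [simp]: "v \<in> {1..n} \<Longrightarrow> indet v \<in> polys n"
  by (simp add: indet_def polys_single)

lemma homogeneous_zero [simp]: "homogeneous d 0" by (simp add: homogeneous_def)

lemma homogeneous_add: "homogeneous d f \<Longrightarrow> homogeneous d g \<Longrightarrow> homogeneous d (f + g)"
  unfolding homogeneous_def using Poly_Mapping.keys_add[of f g] by blast

lemma homogeneous_uminus: "homogeneous d f \<Longrightarrow> homogeneous d (- f)"
  by (simp add: homogeneous_def in_keys_iff)

lemma homogeneous_diff: "homogeneous d f \<Longrightarrow> homogeneous d g \<Longrightarrow> homogeneous d (f - g)"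
  using homogeneous_add[of d f "- g"] homogeneous_uminus[of d g] by simp

lemma homogeneous_mult: "homogeneous d f \<Longrightarrow> homogeneous e g \<Longrightarrow> homogeneous (d + e) (f * g)"
  unfolding homogeneous_def using keys_mult[of f g] by fastforce

lemma homogeneous_sum: "(\<And>x. x \<in> X \<Longrightarrow> homogeneous d (f x)) \<Longrightarrow> homogeneous d (sum f X)"
  by (induction X rule: infinite_finite_induct) (auto intro: homogeneous_add)

lemma homogeneous_single: "int (mdeg m) = d \<Longrightarrow> homogeneous d (Poly_Mapping.single m c)"
  by (simp add: homogeneous_def)

lemma homogeneous_indet: "homogeneous 1 (indet v)"
  by (simp add: indet_def homogeneous_single)

lemma homogeneous_one [simp]: "homogeneous 0 1"
  by (simp add: homogeneous_def)

lemma homogeneous_0_const: "homogeneous 0 f \<Longrightarrow> f = Poly_Mapping.single 0 (lookup f 0)"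
  by (intro poly_mapping_eqI) (auto simp: homogeneous_def lookup_single when_def in_keys_iff)

lemma irrelevant_homogeneous:
  "f \<in> polys n \<Longrightarrow> homogeneous d f \<Longrightarrow> d \<noteq> 0 \<Longrightarrow> f \<in> irrelevant_ideal n"
  by (auto simp: irrelevant_ideal_def homogeneous_def in_keys_iff)

section \<open>Homogeneous components\<close>

definition hcomp :: "int \<Rightarrow> 'k::field mpoly \<Rightarrow> 'k mpoly" where
  "hcomp e f = Poly_Mapping.mapp (\<lambda>m c. if int (mdeg m) = e then c else 0) f"

lemma lookup_hcomp: "lookup (hcomp e f) m = (if int (mdeg m) = e then lookup f m else 0)"
  by (simp add: hcomp_def lookup_mapp when_def in_keys_iff)

lemma keys_hcomp: "keys (hcomp e f) = {m \<in> keys f. int (mdeg m) = e}"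
  by (auto simp: in_keys_iff lookup_hcomp split: if_splits)

lemma homogeneous_hcomp [simp]: "homogeneous e (hcomp e f)"
  by (simp add: homogeneous_def keys_hcomp)

lemma hcomp_polys [simp]: "f \<in> polys n \<Longrightarrow> hcomp e f \<in> polys n"
  by (simp add: polys_def keys_hcomp)

lemma hcomp_add: "hcomp e (f + g) = hcomp e f + hcomp e g"
  by (intro poly_mapping_eqI) (simp add: lookup_hcomp lookup_add)

lemma hcomp_zero [simp]: "hcomp e 0 = 0"
  by (intro poly_mapping_eqI) (simp add: lookup_hcomp)

lemma hcomp_sum: "hcomp e (sum f X) = (\<Sum>x\<in>X. hcomp e (f x))"
  by (induction X rule: infinite_finite_induct) (auto simp: hcomp_add)

lemma hcomp_homogeneous: "homogeneous e f \<Longrightarrow> hcomp e f = f"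
  by (intro poly_mapping_eqI) (auto simp: lookup_hcomp homogeneous_def in_keys_iff)

lemma hcomp_mult:
  assumes "homogeneous a f"
  shows "hcomp (a + e) (f * u) = f * hcomp e u"
proof -
  have "hcomp (a + e) (f * (u - hcomp e u)) = 0"
  proof (rule poly_mapping_eqI, rule ccontr)
    fix m assume *: "lookup (hcomp (a + e) (f * (u - hcomp e u))) m \<noteq> lookup 0 m"
    then have m: "int (mdeg m) = a + e" "m \<in> keys (f * (u - hcomp e u))"
      by (auto simp: lookup_hcomp in_keys_iff split: if_splits)
    then obtain s t where "s \<in> keys f" "t \<in> keys (u - hcomp e u)" "m = s + t"
      using keys_mult by blast
    then have "int (mdeg s) = a" "int (mdeg t) \<noteq> e"
      using assms by (auto simp: homogeneous_def in_keys_iff lookup_minus lookup_hcomp)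
    then show False using m \<open>m = s + t\<close> by simp
  qed
  moreover have "hcomp (a + e) (f * hcomp e u) = f * hcomp e u"
    by (intro hcomp_homogeneous homogeneous_mult assms) simp
  ultimately show ?thesis
    by (metis add.right_neutral add_diff_cancel_left' diff_add_cancel distrib_left hcomp_add)
qed

lemma hcomp_mult': "homogeneous a f \<Longrightarrow> hcomp e (f * u) = f * hcomp (e - a) u"
  using hcomp_mult[of a f "e - a" u] by simp

text \<open>Taking the component of degree \<open>e - dr r\<close> in each equation extracts the
  part of degree \<open>e - dc c\<close> of each unknown. Exactness supplies solutions without any
  degree information; this is how they are turned into constants or linear forms.\<close>

lemma homogeneous_solution:
  assumes "\<And>r. r < R \<Longrightarrow> f r = (\<Sum>c<C. A r c * u c)"
    and "\<And>r. r < R \<Longrightarrow> homogeneous (e - dr r) (f r)"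
    and "\<And>r c. r < R \<Longrightarrow> c < C \<Longrightarrow> homogeneous (dc c - dr r) (A r c)"
    and "r < R"
  shows "f r = (\<Sum>c<C. A r c * hcomp (e - dc c) (u c))"
proof -
  have "f r = hcomp (e - dr r) (f r)" using assms by (simp add: hcomp_homogeneous)
  also have "\<dots> = (\<Sum>c<C. hcomp (e - dr r) (A r c * u c))"
    using assms by (simp add: hcomp_sum)
  also have "\<dots> = (\<Sum>c<C. A r c * hcomp (e - dc c) (u c))"
  proof (rule sum.cong)
    fix c assume "c \<in> {..<C}"
    then show "hcomp (e - dr r) (A r c * u c) = A r c * hcomp (e - dc c) (u c)"
      using hcomp_mult'[OF assms(3)[OF assms(4)], of c "e - dr r" "u c"] by simp
  qed simp
  finally show ?thesis .
qed

section \<open>Monomial ideals\<close>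

definition mon_ideal :: "nat \<Rightarrow> monomial set \<Rightarrow> 'k::field mpoly set" where
  "mon_ideal n U = {f \<in> polys n. keys f \<subseteq> U}"

definition up_closed :: "monomial set \<Rightarrow> bool" where
  "up_closed U \<longleftrightarrow> (\<forall>m\<in>U. \<forall>k. m + k \<in> U)"

lemma mon_ideal_zero [simp]: "0 \<in> mon_ideal n U" by (simp add: mon_ideal_def)

lemma mon_ideal_add: "f \<in> mon_ideal n U \<Longrightarrow> g \<in> mon_ideal n U \<Longrightarrow> f + g \<in> mon_ideal n U"
  unfolding mon_ideal_def using Poly_Mapping.keys_add[of f g] by fastforce

lemma mon_ideal_mult:
  "up_closed U \<Longrightarrow> f \<in> polys n \<Longrightarrow> g \<in> mon_ideal n U \<Longrightarrow> f * g \<in> mon_ideal n U"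
  unfolding mon_ideal_def up_closed_def using keys_mult[of f g] by (fastforce simp: add.commute)

lemma mon_ideal_sum:
  "(\<And>x. x \<in> X \<Longrightarrow> f x \<in> mon_ideal n U) \<Longrightarrow> sum f X \<in> mon_ideal n U"
  by (induction X rule: infinite_finite_induct) (auto intro: mon_ideal_add)

lemma mpoly_sum_singles: "f = (\<Sum>m\<in>keys f. Poly_Mapping.single m (lookup f m))"
  by (intro poly_mapping_eqI) (auto simp: lookup_sum lookup_single when_def in_keys_iff)

definition graph_monomials :: "nat set set \<Rightarrow> monomial set" where
  "graph_monomials G = {m. \<exists>i j. {i, j} \<in> G \<and> i \<noteq> j \<and> lookup m i \<ge> 1 \<and> lookup m j \<ge> 1}"

lemma up_closed_graph_monomials: "up_closed (graph_monomials G)"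
  unfolding up_closed_def graph_monomials_def by (fastforce simp: lookup_add)

lemma indet_mult: "indet i * indet j = Poly_Mapping.single (Poly_Mapping.single i 1 + Poly_Mapping.single j 1) 1"
  by (simp add: indet_def mult_single)

lemma vertex_pairs_mem: "{i, j} \<in> vertex_pairs n \<longleftrightarrow> i \<noteq> j \<and> i \<in> {1..n} \<and> j \<in> {1..n}"
  by (auto simp: vertex_pairs_def card_insert_if)

lemma monomial_split2:
  assumes "i \<noteq> j" "lookup m i \<ge> 1" "lookup m j \<ge> 1"
  shows "m = (m - Poly_Mapping.single i 1 - Poly_Mapping.single j 1)
    + (Poly_Mapping.single i 1 + Poly_Mapping.single j (1::nat))"
  using assms by (intro poly_mapping_eqI) (auto simp: lookup_add lookup_minus lookup_single when_def)

lemma keys_minus_subset: "keys (m - k :: monomial) \<subseteq> keys m"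
  by (auto simp: in_keys_iff lookup_minus)

text \<open>A polynomial lies in a monomial ideal exactly if all its monomials do. This replaces the
  ideal generated in the ring record by a condition on keys, which later arguments can inspect term
  by term.\<close>

lemma edge_ideal_eq:
  assumes G: "G \<subseteq> vertex_pairs n"
  shows "(edge_ideal n G :: 'k::field mpoly set) = mon_ideal n (graph_monomials G)"
proof
  let ?R = "poly_ring n :: 'k mpoly ring"
  let ?gens = "{indet i * indet j |i j. {i, j} \<in> G} :: 'k mpoly set"
  let ?M = "mon_ideal n (graph_monomials G) :: 'k mpoly set"
  have car: "carrier ?R = polys n" "monoid.mult ?R = (*)" "add ?R = (+)" "zero ?R = 0" "one ?R = 1"
    by (auto simp: poly_ring_def)
  have ring: "ring ?R"
    by (rule ringI[OF abelian_groupI monoidI])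
       (auto simp: car algebra_simps intro: bexI[of _ "- x" for x])
  interpret ring ?R by (rule ring)
  have gens: "?gens \<subseteq> ?M"
  proof
    fix f :: "'k mpoly" assume "f \<in> ?gens"
    then obtain i j where ij: "f = indet i * indet j" "{i, j} \<in> G" by blast
    then have "i \<noteq> j" "i \<in> {1..n}" "j \<in> {1..n}" using G vertex_pairs_mem by blast+
    then show "f \<in> ?M" using ij(2) unfolding ij(1)
      by (auto simp: mon_ideal_def indet_mult graph_monomials_def lookup_add lookup_single when_def
          keys_add_monomial intro!: polys_single)
  qed
  have "ideal ?M ?R"
  proof (rule idealI[OF ring])
    show "subgroup ?M (add_monoid ?R)"
    proof (rule group.subgroupI)
      show "Group.group (add_monoid ?R)" using abelian_group.a_group is_abelian_group by blast
      show "?M \<subseteq> carrier (add_monoid ?R)" by (auto simp: mon_ideal_def car)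
      show "?M \<noteq> {}" using mon_ideal_zero by blast
    next
      fix a assume a: "a \<in> ?M"
      have "\<ominus>\<^bsub>?R\<^esub> a = - a"
        using a by (intro minus_equality) (auto simp: car mon_ideal_def)
      moreover have "- a \<in> ?M" using a by (auto simp: mon_ideal_def in_keys_iff subset_iff)
      ultimately show "inv\<^bsub>add_monoid ?R\<^esub> a \<in> ?M" by (simp add: a_inv_def)
    qed (auto simp: car mon_ideal_add)
  next
    fix a x assume "a \<in> ?M" "x \<in> carrier ?R"
    then have "x * a \<in> ?M" using mon_ideal_mult[OF up_closed_graph_monomials] by (simp add: car)
    then show "x \<otimes>\<^bsub>?R\<^esub> a \<in> ?M" "a \<otimes>\<^bsub>?R\<^esub> x \<in> ?M" by (simp_all add: car mult.commute)
  qed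
  then show "edge_ideal n G \<subseteq> ?M"
    unfolding edge_ideal_def using gens by (rule genideal_minimal)
  have gsub: "?gens \<subseteq> carrier ?R" using gens by (auto simp: mon_ideal_def car)
  interpret I: ideal "edge_ideal n G" ?R
    unfolding edge_ideal_def by (rule genideal_ideal[OF gsub])
  have self: "?gens \<subseteq> edge_ideal n G" unfolding edge_ideal_def by (rule genideal_self[OF gsub])
  show "?M \<subseteq> edge_ideal n G"
  proof
    fix f :: "'k mpoly" assume f: "f \<in> ?M"
    have monomial_in: "Poly_Mapping.single m (lookup f m) \<in> edge_ideal n G" if m: "m \<in> keys f" for m
    proof -
      obtain i j where ij: "{i, j} \<in> G" "i \<noteq> j" "lookup m i \<ge> 1" "lookup m j \<ge> 1"
        using f m by (auto simp: mon_ideal_def graph_monomials_def)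
      let ?k = "m - Poly_Mapping.single i 1 - Poly_Mapping.single j 1"
      have "Poly_Mapping.single m (lookup f m) = Poly_Mapping.single ?k (lookup f m) * (indet i * indet j)"
        by (simp only: indet_mult mult_single monomial_split2[OF ij(2-4), symmetric] mult_1_right)
      moreover have "Poly_Mapping.single ?k (lookup f m) \<in> polys n"
      proof (intro polys_single)
        have "keys m \<subseteq> {1..n}" using f m by (auto simp: mon_ideal_def polys_def)
        then show "keys ?k \<subseteq> {1..n}" using keys_minus_subset by blast
      qed
      moreover have "(indet i * indet j :: 'k mpoly) \<in> edge_ideal n G" by (rule subsetD[OF self], rule CollectI, intro exI conjI, rule refl, rule ij(1))
      ultimately show ?thesis
        using I.I_l_closed[of "indet i * indet j" "Poly_Mapping.single ?k (lookup f m)"] by (simp add: car)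
    qed
    have "(\<Sum>m\<in>X. Poly_Mapping.single m (lookup f m)) \<in> edge_ideal n G"
      if "finite X" "X \<subseteq> keys f" for X
      using that
    proof (induction X rule: finite_induct)
      case empty
      then show ?case using I.zero_closed by (simp add: car)
    next
      case (insert x F)
      then have "Poly_Mapping.single x (lookup f x) \<oplus>\<^bsub>?R\<^esub> (\<Sum>m\<in>F. Poly_Mapping.single m (lookup f m)) \<in> edge_ideal n G"
        using monomial_in by (intro I.a_closed) auto
      then show ?case using insert by (simp add: car)
    qed
    from this[of "keys f"] show "f \<in> edge_ideal n G" by (simp add: mpoly_sum_singles[symmetric])
  qed
qed

section \<open>Resolutions in terms of coefficient functions\<close>

text \<open>The exactness part of a resolution, without degrees and minimality. Vectors and matrices
  become functions whose values beyond the ranks are left free, so that blocks and single columns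
  can be formed without bookkeeping of dimensions.\<close>

definition fresolution ::
    "nat \<Rightarrow> 'k::field mpoly set \<Rightarrow> (nat \<Rightarrow> nat) \<Rightarrow> (nat \<Rightarrow> 'k mpoly) \<Rightarrow>
     (nat \<Rightarrow> nat \<Rightarrow> nat \<Rightarrow> 'k mpoly) \<Rightarrow> bool" where
  "fresolution n I b g A \<longleftrightarrow>
     (\<forall>j<b 0. g j \<in> polys n) \<and>
     (\<forall>i. \<forall>r<b i. \<forall>c<b (Suc i). A i r c \<in> polys n) \<and>
     (\<forall>f. f \<in> I \<longleftrightarrow> (\<exists>v. (\<forall>j<b 0. v j \<in> polys n) \<and> f = (\<Sum>j<b 0. g j * v j))) \<and>
     (\<forall>v. (\<forall>j<b 0. v j \<in> polys n) \<longrightarrow>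
        ((\<Sum>j<b 0. g j * v j) = 0 \<longleftrightarrow>
         (\<exists>w. (\<forall>c<b 1. w c \<in> polys n) \<and> (\<forall>j<b 0. v j = (\<Sum>c<b 1. A 0 j c * w c))))) \<and>
     (\<forall>i v. (\<forall>j<b (Suc i). v j \<in> polys n) \<longrightarrow>
        ((\<forall>r<b i. (\<Sum>c<b (Suc i). A i r c * v c) = 0) \<longleftrightarrow>
         (\<exists>w. (\<forall>c<b (Suc (Suc i)). w c \<in> polys n) \<and>
              (\<forall>r<b (Suc i). v r = (\<Sum>c<b (Suc (Suc i)). A (Suc i) r c * w c)))))"

lemma vec_free_module: "(\<And>j. j < r \<Longrightarrow> v j \<in> polys n) \<Longrightarrow> vec r v \<in> free_module n r"
  by (simp add: free_module_def)

lemma free_moduleD: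
  assumes "v \<in> free_module n r"
  shows "vec r (\<lambda>j. v $ j) = v" "\<forall>j<r. v $ j \<in> polys n"
  using assms by (auto simp: free_module_def)

lemma free_module_image:
  "P \<in> f ` free_module n r \<longleftrightarrow> (\<exists>v. (\<forall>j<r. v j \<in> polys n) \<and> P = f (vec r v))"
proof
  assume "P \<in> f ` free_module n r"
  then obtain v where v: "v \<in> free_module n r" "P = f v" by blast
  then show "\<exists>v. (\<forall>j<r. v j \<in> polys n) \<and> P = f (vec r v)"
    using free_moduleD[OF v(1)] by (intro exI[of _ "\<lambda>j. v $ j"]) simp
qed (auto intro: vec_free_module)

lemma scalar_prod_sum: "dim_vec v = r \<Longrightarrow> g \<bullet> v = (\<Sum>j<r. g $ j * v $ j)"
  by (simp add: scalar_prod_def lessThan_atLeast0)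

lemma mult_mat_vec_index:
  "A \<in> carrier_mat r c \<Longrightarrow> v \<in> carrier_vec c \<Longrightarrow> i < r \<Longrightarrow> (A *\<^sub>v v) $ i = (\<Sum>j<c. A $$ (i, j) * v $ j)"
  by (auto simp: scalar_prod_def lessThan_atLeast0)

lemma eq_mult_mat_vec:
  assumes "A \<in> carrier_mat r c"
  shows "vec r v = A *\<^sub>v vec c w \<longleftrightarrow> (\<forall>i<r. v i = (\<Sum>j<c. A $$ (i, j) * w j))"
proof -
  have "(A *\<^sub>v vec c w) $ i = (\<Sum>j<c. A $$ (i, j) * w j)" if "i < r" for i
    using mult_mat_vec_index[OF assms, of "vec c w" i] that by simp
  moreover have "dim_vec (A *\<^sub>v vec c w) = r" using assms by simp
  ultimately show ?thesis by (auto simp: vec_eq_iff)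
qed

lemma mult_mat_vec_eq_zero:
  assumes "A \<in> carrier_mat r c"
  shows "A *\<^sub>v vec c w = 0\<^sub>v r \<longleftrightarrow> (\<forall>i<r. (\<Sum>j<c. A $$ (i, j) * w j) = 0)"
  using eq_mult_mat_vec[OF assms, of "\<lambda>_. 0" w] by (auto simp: zero_vec_def)

lemma free_module_set_eq:
  fixes f :: "'k::field mpoly Matrix.vec \<Rightarrow> bool"
  assumes im: "\<And>w. (\<And>j. j < e \<Longrightarrow> w j \<in> polys n) \<Longrightarrow> h (vec e w) \<in> free_module n r"
  shows "{v \<in> free_module n r. f v} = h ` free_module n e \<longleftrightarrow>
    (\<forall>v. (\<forall>j<r. v j \<in> polys n) \<longrightarrow>
      (f (vec r v) \<longleftrightarrow> (\<exists>w. (\<forall>j<e. w j \<in> polys n) \<and> vec r v = h (vec e w))))"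
    (is "?L = ?R \<longleftrightarrow> ?P")
proof
  assume eq: "?L = ?R"
  show ?P
  proof (intro allI impI)
    fix v :: "nat \<Rightarrow> 'k mpoly" assume "\<forall>j<r. v j \<in> polys n"
    then have "vec r v \<in> free_module n r" by (simp add: vec_free_module)
    then have "f (vec r v) \<longleftrightarrow> vec r v \<in> ?R" using eq by blast
    then show "f (vec r v) \<longleftrightarrow> (\<exists>w. (\<forall>j<e. w j \<in> polys n) \<and> vec r v = h (vec e w))"
      by (simp add: free_module_image)
  qed
next
  assume P: ?P
  have main: "v \<in> ?L \<longleftrightarrow> v \<in> ?R" if v: "v \<in> free_module n r" for v :: "'k mpoly Matrix.vec"
  proof -
    have e: "vec r (\<lambda>j. v $ j) = v" and p: "\<forall>j<r. v $ j \<in> polys n"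
      using free_moduleD[OF v] by auto
    have "f v \<longleftrightarrow> (\<exists>w. (\<forall>j<e. w j \<in> polys n) \<and> v = h (vec e w))"
      using P[rule_format, of "\<lambda>j. v $ j"] p unfolding e by blast
    then show ?thesis using v by (simp add: free_module_image)
  qed
  moreover have "v \<in> free_module n r" if "v \<in> ?R" for v
    using that im unfolding free_module_image by blast
  ultimately show "?L = ?R" by blast
qed

lemma mult_mat_vec_free_module:
  assumes "A \<in> carrier_mat r c" "\<And>i j. i < r \<Longrightarrow> j < c \<Longrightarrow> A $$ (i, j) \<in> polys n"
    "\<And>j. j < c \<Longrightarrow> w j \<in> polys n"
  shows "A *\<^sub>v vec c w \<in> free_module n r"
proof -
  have "(\<Sum>j<c. A $$ (i, j) * w j) \<in> polys n" if "i < r" for i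
    using that assms by (intro polys_sum polys_mult) auto
  then have "(A *\<^sub>v vec c w) $ i \<in> polys n" if "i < r" for i
    using mult_mat_vec_index[OF assms(1), of "vec c w" i] that assms by (simp add: polys_sum)
  then show ?thesis using assms(1) by (simp add: free_module_def)
qed

text \<open>If a shape or an entry is wrong, both sides fail; otherwise the clauses on images and
  kernels translate one by one through \<open>free_module_image\<close> and
  \<open>free_module_set_eq\<close>.\<close>

lemma minimal_graded_free_resolution_iff:
  "minimal_graded_free_resolution n I b d g A \<longleftrightarrow>
     g \<in> carrier_vec (b 0) \<and> (\<forall>i. A i \<in> carrier_mat (b i) (b (Suc i))) \<and>
     (\<forall>j<b 0. homogeneous (d 0 j) (g $ j)) \<and>
     (\<forall>i. \<forall>r<b i. \<forall>c<b (Suc i). A i $$ (r, c) \<in> irrelevant_ideal n \<and>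
        homogeneous (d (Suc i) c - d i r) (A i $$ (r, c))) \<and>
     fresolution n I b (\<lambda>j. g $ j) (\<lambda>i r c. A i $$ (r, c))"
proof (cases "g \<in> carrier_vec (b 0) \<and> (\<forall>j<b 0. g $ j \<in> polys n) \<and> (\<forall>i. A i \<in> carrier_mat (b i) (b (Suc i))) \<and>
    (\<forall>i. \<forall>r<b i. \<forall>c<b (Suc i). A i $$ (r, c) \<in> polys n)")
  case True
  then have A: "A i \<in> carrier_mat (b i) (b (Suc i))" and g: "g \<in> free_module n (b 0)"
    and Ap: "r < b i \<Longrightarrow> c < b (Suc i) \<Longrightarrow> A i $$ (r, c) \<in> polys n" for i r c
    by (auto simp: free_module_def)
  have A0: "A 0 \<in> carrier_mat (b 0) (b 1)" using A[of 0] by simp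
  have sp: "g \<bullet> vec (b 0) v = (\<Sum>j<b 0. g $ j * v j)" for v
    by (subst scalar_prod_sum[of _ "b 0"]) auto
  have im: "(\<lambda>v. g \<bullet> v) ` free_module n (b 0) = I \<longleftrightarrow>
      (\<forall>f. f \<in> I \<longleftrightarrow> (\<exists>v. (\<forall>j<b 0. v j \<in> polys n) \<and> f = (\<Sum>j<b 0. g $ j * v j)))"
    unfolding set_eq_iff free_module_image sp by blast
  have k0: "{v \<in> free_module n (b 0). g \<bullet> v = 0} = (\<lambda>w. A 0 *\<^sub>v w) ` free_module n (b 1) \<longleftrightarrow>
      (\<forall>v. (\<forall>j<b 0. v j \<in> polys n) \<longrightarrow>
        ((\<Sum>j<b 0. g $ j * v j) = 0 \<longleftrightarrow>
         (\<exists>w. (\<forall>c<b 1. w c \<in> polys n) \<and> (\<forall>j<b 0. v j = (\<Sum>c<b 1. A 0 $$ (j, c) * w c)))))"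
  proof (subst free_module_set_eq)
    show "A 0 *\<^sub>v vec (b 1) w \<in> free_module n (b 0)" if "\<And>j. j < b 1 \<Longrightarrow> w j \<in> polys n" for w
      using that Ap[of _ 0] by (intro mult_mat_vec_free_module[OF A0]) auto
  qed (simp only: sp eq_mult_mat_vec[OF A0])
  have ki: "{v \<in> free_module n (b (Suc i)). A i *\<^sub>v v = 0\<^sub>v (b i)} =
          (\<lambda>w. A (Suc i) *\<^sub>v w) ` free_module n (b (Suc (Suc i))) \<longleftrightarrow>
    (\<forall>v. (\<forall>j<b (Suc i). v j \<in> polys n) \<longrightarrow>
        ((\<forall>r<b i. (\<Sum>c<b (Suc i). A i $$ (r, c) * v c) = 0) \<longleftrightarrow>
         (\<exists>w. (\<forall>c<b (Suc (Suc i)). w c \<in> polys n) \<and>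
              (\<forall>r<b (Suc i). v r = (\<Sum>c<b (Suc (Suc i)). A (Suc i) $$ (r, c) * w c)))))" for i
  proof (subst free_module_set_eq)
    show "A (Suc i) *\<^sub>v vec (b (Suc (Suc i))) w \<in> free_module n (b (Suc i))"
      if "\<And>j. j < b (Suc (Suc i)) \<Longrightarrow> w j \<in> polys n" for w
      using that Ap[of _ "Suc i"] by (intro mult_mat_vec_free_module[OF A]) auto
  qed (simp only: mult_mat_vec_eq_zero[OF A] eq_mult_mat_vec[OF A])
  have p: "\<forall>j<b 0. g $ j \<in> polys n" "\<forall>i. \<forall>r<b i. \<forall>c<b (Suc i). A i $$ (r, c) \<in> polys n"
    "g \<in> carrier_vec (b 0)" "\<forall>i. A i \<in> carrier_mat (b i) (b (Suc i))"
    using True by simp_all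
  show ?thesis (is "?L \<longleftrightarrow> ?R")
  proof
    assume ?L
    then show ?R
      unfolding minimal_graded_free_resolution_def fresolution_def im k0 ki
      by (elim conjE) (intro conjI p; assumption)
  next
    assume ?R
    then show ?L
      unfolding minimal_graded_free_resolution_def fresolution_def im k0 ki
      by (elim conjE) (intro conjI p g; assumption)
  qed
next
  case False
  have "\<not> minimal_graded_free_resolution n I b d g A"
  proof
    assume M: "minimal_graded_free_resolution n I b d g A"
    have "g \<in> free_module n (b 0)" "\<forall>i. A i \<in> carrier_mat (b i) (b (Suc i))"
      "\<forall>i. \<forall>r<b i. \<forall>c<b (Suc i). A i $$ (r, c) \<in> irrelevant_ideal n \<and>
        homogeneous (d (Suc i) c - d i r) (A i $$ (r, c))"
      using M unfolding minimal_graded_free_resolution_def by - ((elim conjE, assumption)+)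
    then show False using False by (simp add: free_module_def irrelevant_ideal_def)
  qed
  moreover have False if "g \<in> carrier_vec (b 0)" "\<forall>i. A i \<in> carrier_mat (b i) (b (Suc i))"
    "fresolution n I b (\<lambda>j. g $ j) (\<lambda>i r c. A i $$ (r, c))"
  proof -
    have "\<forall>j<b 0. g $ j \<in> polys n" "\<forall>i. \<forall>r<b i. \<forall>c<b (Suc i). A i $$ (r, c) \<in> polys n"
      using that(3) unfolding fresolution_def by - ((elim conjE, assumption)+)
    then show False using False that by blast
  qed
  ultimately show ?thesis by blast
qed

lemma minimal_graded_free_resolutionI:
  assumes "fresolution n I b g A"
    and "\<And>j. j < b 0 \<Longrightarrow> homogeneous (d 0 j) (g j)"
    and "\<And>i r c. r < b i \<Longrightarrow> c < b (Suc i) \<Longrightarrow> A i r c \<in> irrelevant_ideal n"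
    and "\<And>i r c. r < b i \<Longrightarrow> c < b (Suc i) \<Longrightarrow> homogeneous (d (Suc i) c - d i r) (A i r c)"
  shows "minimal_graded_free_resolution n I b d (vec (b 0) g) (\<lambda>i. mat (b i) (b (Suc i)) (\<lambda>(r, c). A i r c))"
proof -
  have "fresolution n I b (\<lambda>j. vec (b 0) g $ j) (\<lambda>i r c. mat (b i) (b (Suc i)) (\<lambda>(r, c). A i r c) $$ (r, c))"
    using assms(1) unfolding fresolution_def by simp
  then show ?thesis unfolding minimal_graded_free_resolution_iff using assms(2-) by simp
qed

lemma fresolutionD:
  assumes "fresolution n I b g A"
  shows fresolution_gens: "\<And>j. j < b 0 \<Longrightarrow> g j \<in> polys n"
    and fresolution_entries: "\<And>i r c. r < b i \<Longrightarrow> c < b (Suc i) \<Longrightarrow> A i r c \<in> polys n"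
    and fresolution_ideal: "\<And>f. f \<in> I \<longleftrightarrow> (\<exists>v. (\<forall>j<b 0. v j \<in> polys n) \<and> f = (\<Sum>j<b 0. g j * v j))"
    and fresolution_exact0: "\<And>v. (\<And>j. j < b 0 \<Longrightarrow> v j \<in> polys n) \<Longrightarrow> (\<Sum>j<b 0. g j * v j) = 0 \<longleftrightarrow>
         (\<exists>w. (\<forall>c<b 1. w c \<in> polys n) \<and> (\<forall>j<b 0. v j = (\<Sum>c<b 1. A 0 j c * w c)))"
    and fresolution_exact: "\<And>i v. (\<And>j. j < b (Suc i) \<Longrightarrow> v j \<in> polys n) \<Longrightarrow>
        (\<forall>r<b i. (\<Sum>c<b (Suc i). A i r c * v c) = 0) \<longleftrightarrow>
         (\<exists>w. (\<forall>c<b (Suc (Suc i)). w c \<in> polys n) \<and>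
              (\<forall>r<b (Suc i). v r = (\<Sum>c<b (Suc (Suc i)). A (Suc i) r c * w c)))"
proof -
  note D = assms[unfolded fresolution_def]
  show "\<And>j. j < b 0 \<Longrightarrow> g j \<in> polys n"
    using D[THEN conjunct1] by simp
  show "\<And>i r c. r < b i \<Longrightarrow> c < b (Suc i) \<Longrightarrow> A i r c \<in> polys n"
    using D[THEN conjunct2, THEN conjunct1] by simp
  show "\<And>f. f \<in> I \<longleftrightarrow> (\<exists>v. (\<forall>j<b 0. v j \<in> polys n) \<and> f = (\<Sum>j<b 0. g j * v j))"
    by (rule D[THEN conjunct2, THEN conjunct2, THEN conjunct1, rule_format])
  show "\<And>v. (\<And>j. j < b 0 \<Longrightarrow> v j \<in> polys n) \<Longrightarrow> (\<Sum>j<b 0. g j * v j) = 0 \<longleftrightarrow>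
         (\<exists>w. (\<forall>c<b 1. w c \<in> polys n) \<and> (\<forall>j<b 0. v j = (\<Sum>c<b 1. A 0 j c * w c)))"
    by (rule D[THEN conjunct2, THEN conjunct2, THEN conjunct2, THEN conjunct1, THEN spec, THEN mp]) simp
  show "\<And>i v. (\<And>j. j < b (Suc i) \<Longrightarrow> v j \<in> polys n) \<Longrightarrow>
        (\<forall>r<b i. (\<Sum>c<b (Suc i). A i r c * v c) = 0) \<longleftrightarrow>
         (\<exists>w. (\<forall>c<b (Suc (Suc i)). w c \<in> polys n) \<and>
              (\<forall>r<b (Suc i). v r = (\<Sum>c<b (Suc (Suc i)). A (Suc i) r c * w c)))"
    by (rule D[THEN conjunct2, THEN conjunct2, THEN conjunct2, THEN conjunct2, THEN spec, THEN spec, THEN mp]) simp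
qed

lemma fresolution_comp_zero:
  assumes F: "fresolution n I b g A" and w: "\<And>e. e < b (Suc (Suc l)) \<Longrightarrow> w e \<in> polys n" and "r < b l"
  shows "(\<Sum>c<b (Suc l). A l r c * (\<Sum>e<b (Suc (Suc l)). A (Suc l) c e * w e)) = 0"
proof -
  have "(\<Sum>e<b (Suc (Suc l)). A (Suc l) c e * w e) \<in> polys n" if "c < b (Suc l)" for c
    using w that by (intro polys_sum polys_mult fresolution_entries[OF F]) auto
  then show ?thesis using fresolution_exact[OF F, of l "\<lambda>c. \<Sum>e<b (Suc (Suc l)). A (Suc l) c e * w e"]
    assms(3) w by blast
qed

lemma fresolution_comp_zero0:
  assumes F: "fresolution n I b g A" and w: "\<And>e. e < b 1 \<Longrightarrow> w e \<in> polys n"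
  shows "(\<Sum>c<b 0. g c * (\<Sum>e<b 1. A 0 c e * w e)) = 0"
proof -
  have "(\<Sum>e<b 1. A 0 c e * w e) \<in> polys n" if "c < b 0" for c
    using w that by (intro polys_sum polys_mult fresolution_entries[OF F]) auto
  then show ?thesis using fresolution_exact0[OF F, of "\<lambda>c. \<Sum>e<b 1. A 0 c e * w e"] w by blast
qed

section \<open>Induced cycles in the complement obstruct linearity\<close>

text \<open>Peeling off one element at a time cancels each pair directly. Exchanging the two sums
  would only show that the sum equals its own negative, which says nothing in characteristic
  2.\<close>

lemma sum_antisym_pairs:
  fixes f :: "'a \<Rightarrow> 'a \<Rightarrow> 'b::ab_group_add"
  assumes "finite V" "\<And>v w. v \<in> V \<Longrightarrow> w \<in> V \<Longrightarrow> v \<noteq> w \<Longrightarrow> f v w = - f w v"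
  shows "(\<Sum>v\<in>V. \<Sum>w\<in>V - {v}. f v w) = 0"
  using assms
proof (induction V rule: finite_induct)
  case (insert x V)
  have "(\<Sum>w\<in>insert x V - {v}. f v w) = f v x + (\<Sum>w\<in>V - {v}. f v w)" if "v \<in> V" for v
  proof -
    have "insert x V - {v} = insert x (V - {v})" using insert.hyps that by auto
    then show ?thesis using insert.hyps by simp
  qed
  moreover have "insert x V - {x} = V" using insert.hyps by auto
  moreover have "(\<Sum>v\<in>V. f x v) + (\<Sum>v\<in>V. f v x) = 0"
  proof -
    have "(\<Sum>v\<in>V. f x v) = (\<Sum>v\<in>V. - f v x)"
    proof (rule sum.cong)
      fix v assume "v \<in> V"
      then show "f x v = - f v x" using insert.hyps(2) by (intro insert.prems) auto
    qed simp
    then show ?thesis by (simp add: sum_negf)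
  qed
  moreover have "(\<Sum>v\<in>V. \<Sum>w\<in>V - {v}. f v w) = 0"
    by (rule insert.IH, rule insert.prems) simp_all
  ultimately show ?case using insert.hyps by (simp add: sum.distrib)
qed simp

section \<open>The Koszul complex of the variables\<close>

definition mvar :: "nat \<Rightarrow> monomial" where "mvar v = Poly_Mapping.single v 1"

lemma lookup_mvar: "lookup (mvar v) u = (if u = v then 1 else 0)"
  by (simp add: mvar_def lookup_single when_def)

lemma mdeg_mvar [simp]: "mdeg (mvar v) = 1" by (simp add: mvar_def)

lemma keys_mvar [simp]: "keys (mvar v) = {v}" by (simp add: mvar_def)

lemma mvar_eq_iff [simp]: "mvar v = mvar w \<longleftrightarrow> v = w"
  by (metis lookup_mvar zero_neq_one)

text \<open>The sign of moving the basis vector of \<open>v\<close> into its place in the exterior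
  monomial of \<open>insert v T\<close>, with the vertices in increasing order.\<close>

definition sg :: "nat \<Rightarrow> nat set \<Rightarrow> 'k::field" where
  "sg v T = (-1) ^ card {u \<in> T. u < v}"

text \<open>The factor by which the sign \<open>sg b\<close> changes when \<open>a\<close> joins the
  set. The value 1 on the diagonal allows one formula for the sign of a vertex with respect to a set
  that contains it.\<close>

definition osg :: "nat \<Rightarrow> nat \<Rightarrow> 'k::field" where
  "osg a b = (if a < b then -1 else 1)"

lemma sg_insert:
  assumes "finite T" "x \<notin> T"
  shows "sg v (insert x T) = sg v T * osg x v"
proof (cases "x < v")
  case True
  then have "{u \<in> insert x T. u < v} = insert x {u \<in> T. u < v}" by auto
  then show ?thesis using assms True by (simp add: sg_def osg_def)
next
  case False
  then have "{u \<in> insert x T. u < v} = {u \<in> T. u < v}" by auto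
  then show ?thesis using False by (simp add: sg_def osg_def)
qed

lemma sg_square [simp]: "sg v T * sg v T = 1" "sg v T * (sg v T * x) = x"
  by (simp_all add: sg_def power_mult_distrib[symmetric] mult.assoc[symmetric])

lemma osg_swap: "v \<noteq> w \<Longrightarrow> osg v w = - osg w v"
  by (auto simp: osg_def)

lemma osg_refl [simp]: "osg v v = 1" by (simp add: osg_def)

text \<open>An element of the Koszul complex is given by the coefficients \<open>z T\<close> of the exterior monomials \<open>e\<^sub>T\<close>.\<close>

definition koszul :: "nat \<Rightarrow> (nat set \<Rightarrow> 'k::field mpoly) \<Rightarrow> nat set \<Rightarrow> 'k mpoly" where
  "koszul n z T = (\<Sum>v\<in>{1..n} - T. Poly_Mapping.single (mvar v) (sg v T) * z (insert v T))"

lemma koszul_cong: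
  assumes "\<And>v. v \<in> {1..n} - T \<Longrightarrow> z (insert v T) = z' (insert v T)"
  shows "koszul n z T = koszul n z' T"
  unfolding koszul_def using assms by simp

lemma koszul_sum_mult: "koszul n (\<lambda>T. \<Sum>c\<in>X. a c * z c T) T = (\<Sum>c\<in>X. a c * koszul n (z c) T)"
  unfolding koszul_def by (simp add: sum_distrib_left sum.swap[of _ X] mult.left_commute)

lemma koszul_diff: "koszul n (\<lambda>T. z T - z' T) T = koszul n z T - koszul n z' T"
  unfolding koszul_def by (simp add: right_diff_distrib sum_subtractf)

lemma koszul_koszul:
  assumes "finite T"
  shows "koszul n (koszul n z) T = 0"
proof -
  let ?V = "{1..n} - T"
  let ?f = "\<lambda>v w. Poly_Mapping.single (mvar v) (sg v T) *
      (Poly_Mapping.single (mvar w) (sg w (insert v T)) * z (insert w (insert v T)))"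
  have "koszul n (koszul n z) T = (\<Sum>v\<in>?V. \<Sum>w\<in>?V - {v}. ?f v w)"
  proof -
    have "{1..n} - insert v T = ?V - {v}" for v by auto
    then show ?thesis unfolding koszul_def by (simp add: sum_distrib_left)
  qed
  also have "\<dots> = 0"
  proof (rule sum_antisym_pairs)
    fix v w assume vw: "v \<in> ?V" "w \<in> ?V" "v \<noteq> w"
    have "sg v T * sg w (insert v T) = - (sg w T * sg v (insert w T) :: 'a)"
      using vw assms by (simp add: sg_insert osg_swap[of v w] mult.commute mult.left_commute)
    then have "Poly_Mapping.single (mvar v + mvar w) (sg v T * sg w (insert v T)) =
        - Poly_Mapping.single (mvar w + mvar v) (sg w T * sg v (insert w T) :: 'a)"
      by (simp add: add.commute single_uminus)
    then show "?f v w = - ?f w v"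
      by (simp add: mult.assoc[symmetric] mult_single insert_commute)
  qed simp
  finally show ?thesis .
qed

lemma koszul_polys:
  assumes "\<And>v. v \<in> {1..n} - T \<Longrightarrow> z (insert v T) \<in> polys n"
  shows "koszul n z T \<in> polys n"
  unfolding koszul_def by (intro polys_sum polys_mult polys_single assms) auto

lemma koszul_homogeneous:
  assumes "\<And>v. v \<in> {1..n} - T \<Longrightarrow> homogeneous d (z (insert v T))"
  shows "homogeneous (1 + d) (koszul n z T)"
  unfolding koszul_def by (intro homogeneous_sum homogeneous_mult homogeneous_single assms) auto

lemma lookup_mvar_mult:
  fixes f :: "'k::field mpoly"
  shows "lookup (Poly_Mapping.single (mvar u) s * f) M = (if lookup M u \<ge> 1 then s * lookup f (M - mvar u) else 0)"
proof (cases "lookup M u \<ge> 1")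
  case True
  then have "M = mvar u + (M - mvar u)"
    by (intro poly_mapping_eqI) (auto simp: lookup_add lookup_minus lookup_mvar)
  then show ?thesis using lookup_single_mult[of "mvar u" s f "M - mvar u"] True by simp
next
  case False
  then have "M \<noteq> mvar u + m" for m by (auto simp: lookup_add lookup_mvar)
  then show ?thesis using lookup_single_mult_not[of M "mvar u" s f] False by simp
qed

lemma lookup_koszul:
  "lookup (koszul n z R) M =
    (\<Sum>u\<in>{u \<in> {1..n} - R. lookup M u \<ge> 1}. sg u R * lookup (z (insert u R)) (M - mvar u))"
  unfolding koszul_def lookup_sum lookup_mvar_mult
  by (subst sum.inter_filter[symmetric]) auto

lemma lookup_koszul2:
  assumes "v \<in> {1..n} - R" "w \<in> {1..n} - R" "v \<noteq> w"
  shows "lookup (koszul n z R) (mvar v + mvar w) =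
    sg v R * lookup (z (insert v R)) (mvar w) + sg w R * lookup (z (insert w R)) (mvar v)"
proof -
  have "{u \<in> {1..n} - R. lookup (mvar v + mvar w) u \<ge> 1} = {v, w}"
    using assms by (auto simp: lookup_add lookup_mvar)
  moreover have "mvar v + mvar w - mvar v = mvar w" "mvar v + mvar w - mvar w = mvar v" by simp_all
  ultimately show ?thesis using assms unfolding lookup_koszul by simp
qed

lemma lookup_koszul_double:
  assumes "v \<in> {1..n} - R"
  shows "lookup (koszul n z R) (mvar v + mvar v) = sg v R * lookup (z (insert v R)) (mvar v)"
proof -
  have "{u \<in> {1..n} - R. lookup (mvar v + mvar v) u \<ge> 1} = {v}"
    using assms by (auto simp: lookup_add lookup_mvar)
  then show ?thesis unfolding lookup_koszul by simp
qed

lemma linear_form_expansion: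
  assumes "f \<in> polys n" "linear_form f"
  shows "f = (\<Sum>v\<in>{1..n}. Poly_Mapping.single (mvar v) (lookup f (mvar v)))"
proof (rule poly_mapping_eqI)
  fix m
  show "lookup f m = lookup (\<Sum>v\<in>{1..n}. Poly_Mapping.single (mvar v) (lookup f (mvar v))) m"
  proof (cases "m \<in> keys f")
    case True
    then have "mdeg m = 1" "keys m \<subseteq> {1..n}" using assms by (auto simp: homogeneous_def polys_def)
    then obtain v where v: "m = mvar v" by (metis mdeg_eq_1 mvar_def)
    then have "v \<in> {1..n}" using \<open>keys m \<subseteq> {1..n}\<close> by simp
    then show ?thesis unfolding v by (simp add: lookup_sum lookup_single when_def)
  next
    case False
    then show ?thesis by (auto simp: lookup_sum lookup_single when_def in_keys_iff intro!: sum.neutral)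
  qed
qed

text \<open>Compare coefficients in the cycle condition. The square of \<open>x_v\<close> shows that
  \<open>z T\<close> contains no variable of \<open>T\<close>, and \<open>x_v x_w\<close> shows that
  the signed coefficient of \<open>x_v\<close> in \<open>z (U - {v})\<close> is the same for all
  \<open>v\<close> in \<open>U\<close>. This common value is the constant \<open>y U\<close>. For
  \<open>m = 0\<close> the cycle condition is empty and the claim is the expansion of a linear form
  in the variables.\<close>

lemma koszul_linear_exact:
  assumes z: "\<And>T. T \<subseteq> {1..n} \<Longrightarrow> card T = m \<Longrightarrow> z T \<in> polys n \<and> linear_form (z T)"
    and cyc: "\<And>R. R \<subseteq> {1..n} \<Longrightarrow> Suc (card R) = m \<Longrightarrow> koszul n z R = 0"
  obtains y where "\<And>U. \<exists>k. y U = Poly_Mapping.single 0 k"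
    "\<And>T. T \<subseteq> {1..n} \<Longrightarrow> card T = m \<Longrightarrow> z T = koszul n y T"
proof
  let ?c = "\<lambda>T v. lookup (z T) (mvar v)"
  let ?h = "\<lambda>U v. sg v (U - {v}) * ?c (U - {v}) v"
  \<comment> \<open>By \<open>indep\<close> below, every element of \<open>U\<close> gives the same
    value; the minimum merely fixes a choice.\<close>
  define y where "y U = Poly_Mapping.single (0::monomial) (?h U (Min U))" for U
  show "\<exists>k. y U = Poly_Mapping.single 0 k" for U by (auto simp: y_def)
  have indep: "?h U v = ?h U w" if U: "U \<subseteq> {1..n}" "card U = Suc m" "v \<in> U" "w \<in> U" for U v w
  proof (cases "v = w")
    case False
    define R where "R = U - {v, w}"
    have fin: "finite U" using U finite_subset by blast
    have UR: "U - {v} = insert w R" "U - {w} = insert v R" "R \<subseteq> {1..n}" "v \<notin> R" "w \<notin> R" "finite R"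
      using U False fin by (auto simp: R_def)
    have vn: "v \<in> {1..n} - R" "w \<in> {1..n} - R" using U(1,3,4) UR(4,5) by auto
    have cR: "Suc (card R) = m"
    proof -
      have "card U = Suc (card (insert w R))" using U fin by (metis UR(1) card_Suc_Diff1)
      then show ?thesis using U UR by simp
    qed
    have "lookup (koszul n z R) (mvar v + mvar w) = 0" using cyc[OF UR(3) cR] by simp
    then have rel: "sg v R * ?c (insert v R) w = - (sg w R * ?c (insert w R) v)"
      using lookup_koszul2[OF vn False, of z] by (simp add: eq_neg_iff_add_eq_0)
    have e: "?c (insert w R) v = - (sg w R * sg v R * ?c (insert v R) w)"
    proof -
      have "sg w R * (sg w R * ?c (insert w R) v) = - (sg w R * (sg v R * ?c (insert v R) w))"
        using rel by simp
      then show ?thesis by (simp add: mult.assoc)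
    qed
    have "sg v (insert w R) * ?c (insert w R) v = osg w v * sg v R * - (sg w R * sg v R * ?c (insert v R) w)"
      using UR unfolding e by (simp add: sg_insert mult.commute)
    also have "osg w v * sg v R * - (sg w R * sg v R * ?c (insert v R) w) =
        - osg w v * sg w R * ?c (insert v R) w * (sg v R * sg v R)"
      by (simp only: mult_minus_left mult_minus_right mult.assoc mult.commute mult.left_commute)
    also have "\<dots> = sg w (insert v R) * ?c (insert v R) w"
      using False UR by (simp add: sg_insert osg_swap[of w v] mult.commute)
    finally show ?thesis unfolding UR .
  qed simp
  fix T assume T: "T \<subseteq> {1..n}" "card T = m"
  have fin: "finite T" using T finite_subset by blast
  have zero: "?c T v = 0" if "v \<in> T" for v
  proof -
    have "insert v (T - {v}) = T" "T - {v} \<subseteq> {1..n}" "v \<in> {1..n} - (T - {v})"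
      "Suc (card (T - {v})) = m"
      using that T card_Suc_Diff1[OF fin that] by auto
    then show ?thesis using lookup_koszul_double[of v n "T - {v}" z] cyc[of "T - {v}"]
      by (auto simp: sg_def)
  qed
  have "koszul n y T = (\<Sum>v\<in>{1..n} - T. Poly_Mapping.single (mvar v) (?c T v))"
    unfolding koszul_def
  proof (rule sum.cong)
    fix v assume v: "v \<in> {1..n} - T"
    have "Min (insert v T) \<in> insert v T" using fin by (intro Min_in) auto
    then have "?h (insert v T) (Min (insert v T)) = ?h (insert v T) v"
      using v T fin by (intro indep) auto
    also have "insert v T - {v} = T" using v by auto
    finally show "Poly_Mapping.single (mvar v) (sg v T) * y (insert v T) = Poly_Mapping.single (mvar v) (?c T v)"
      by (simp add: y_def mult_single)
  qed simp
  also have "\<dots> = (\<Sum>v\<in>{1..n}. Poly_Mapping.single (mvar v) (?c T v))"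
    using zero T by (intro sum.mono_neutral_left) auto
  also have "\<dots> = z T" by (rule linear_form_expansion[symmetric]) (use z[OF T] in auto)
  finally show "z T = koszul n y T" ..
qed

lemma koszul_linear_exact_ex:
  assumes "\<And>T. T \<subseteq> {1..n} \<Longrightarrow> card T = m \<Longrightarrow> z T \<in> polys n \<and> linear_form (z T)"
    and "\<And>R. R \<subseteq> {1..n} \<Longrightarrow> Suc (card R) = m \<Longrightarrow> koszul n z R = 0"
  shows "\<exists>y. (\<forall>U. \<exists>k. y U = Poly_Mapping.single 0 k) \<and>
    (\<forall>T. T \<subseteq> {1..n} \<longrightarrow> card T = m \<longrightarrow> z T = koszul n y T)"
  by (rule koszul_linear_exact[OF assms]) blast+

text \<open>A chase through the double complex of the resolution and the Koszul complex. The
  boundary of \<open>z\<close> lifts along \<open>A l\<close> to a \<open>z'\<close> on the next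
  free module, and \<open>z'\<close> satisfies the hypotheses with \<open>m\<close> lowered by one,
  because \<open>A l\<close> sends its boundary to a boundary of a boundary. The induction
  hypothesis corrects \<open>z'\<close> by constants to a Koszul cycle \<open>u\<close>; linear
  exactness makes \<open>u\<close> the boundary of a constant \<open>y\<close>; and
  \<open>z - A l y\<close> is then a cycle, since the correction of \<open>z'\<close> dies under
  \<open>A l\<close>. For \<open>m = 0\<close> no matrix is assumed to be linear, so only the
  correction 0 keeps \<open>u\<close> linear; this is the purpose of the middle clause.\<close>

lemma koszul_lift:
  fixes z :: "nat \<Rightarrow> nat set \<Rightarrow> 'k::field mpoly"
  assumes F: "fresolution n I b g A"
    and lin: "\<And>i r c. l \<le> i \<Longrightarrow> i < l + m \<Longrightarrow> r < b i \<Longrightarrow> c < b (Suc i) \<Longrightarrow> linear_form (A i r c)"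
    and z: "\<And>j T. j < b l \<Longrightarrow> T \<subseteq> {1..n} \<Longrightarrow> card T = m \<Longrightarrow> z j T \<in> polys n \<and> linear_form (z j T)"
    and im: "\<And>R. R \<subseteq> {1..n} \<Longrightarrow> Suc (card R) = m \<Longrightarrow>
      \<exists>w. (\<forall>c<b (Suc l). w c \<in> polys n) \<and> (\<forall>j<b l. koszul n (z j) R = (\<Sum>c<b (Suc l). A l j c * w c))"
  shows "\<exists>y. (\<forall>c T. \<exists>k. y c T = Poly_Mapping.single 0 k) \<and> (m = 0 \<longrightarrow> (\<forall>c T. y c T = 0)) \<and>
    (\<forall>j<b l. \<forall>R. R \<subseteq> {1..n} \<longrightarrow> Suc (card R) = m \<longrightarrow>
      koszul n (\<lambda>T. z j T - (\<Sum>c<b (Suc l). A l j c * y c T)) R = 0)"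
  using lin z im
proof (induction m arbitrary: l z)
  case 0
  show ?case
  proof (intro exI[of _ "\<lambda>_ _. 0"] conjI allI impI)
    show "\<exists>k. 0 = Poly_Mapping.single (0::monomial) (k::'k)" by (rule exI, rule single_zero[symmetric])
  qed simp_all
next
  case (Suc m)
  have Alin: "linear_form (A l r c)" if "r < b l" "c < b (Suc l)" for r c
    using Suc.prems(1)[of l] that by simp
  have "\<forall>R. \<exists>w. R \<subseteq> {1..n} \<longrightarrow> card R = m \<longrightarrow> (\<forall>c<b (Suc l). w c \<in> polys n) \<and>
      (\<forall>j<b l. koszul n (z j) R = (\<Sum>c<b (Suc l). A l j c * w c))"
    using Suc.prems(3) by blast
  from choice[OF this] obtain w where w: "(\<forall>c<b (Suc l). w R c \<in> polys n) \<and>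
      (\<forall>j<b l. koszul n (z j) R = (\<Sum>c<b (Suc l). A l j c * w R c))"
    if "R \<subseteq> {1..n}" "card R = m" for R by blast
  \<comment> \<open>The boundary has degree 2 and \<open>A l\<close> has degree 1, so the linear
    part of the lift is again a lift.\<close>
  define z' where "z' c R = hcomp 1 (w R c)" for c R
  have z'p: "z' c R \<in> polys n \<and> linear_form (z' c R)"
    if "c < b (Suc l)" "R \<subseteq> {1..n}" "card R = m" for c R
    using w[of R] that by (simp add: z'_def)
  have kz: "koszul n (z j) R = (\<Sum>c<b (Suc l). A l j c * z' c R)"
    if "j < b l" and R: "R \<subseteq> {1..n}" "card R = m" for j R
  proof -
    have fin: "finite R" using R finite_subset by blast
    have "homogeneous (1 + 1) (koszul n (z j) R)" if "j < b l" for j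
      by (rule koszul_homogeneous) (use Suc.prems(2)[OF that] R fin in auto)
    then have "koszul n (z j) R = (\<Sum>c<b (Suc l). A l j c * hcomp (2 - 1) (w R c))"
      by (intro homogeneous_solution[of "b l" "\<lambda>j. koszul n (z j) R" "A l" "w R" "b (Suc l)" 2 "\<lambda>_. 0" "\<lambda>_. 1" j])
        (use w[OF R] Alin that(1) in \<open>simp_all only: one_add_one diff_zero\<close>)
    then show ?thesis by (simp only: z'_def) simp
  qed
  have z'im: "\<exists>w. (\<forall>c<b (Suc (Suc l)). w c \<in> polys n) \<and>
      (\<forall>j<b (Suc l). koszul n (z' j) R = (\<Sum>c<b (Suc (Suc l)). A (Suc l) j c * w c))"
    if R: "R \<subseteq> {1..n}" "Suc (card R) = m" for R
  proof -
    have fin: "finite R" using R finite_subset by blast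
    have "(\<Sum>c<b (Suc l). A l r c * koszul n (z' c) R) = 0" if "r < b l" for r
    proof -
      have "(\<Sum>c<b (Suc l). A l r c * koszul n (z' c) R) = koszul n (\<lambda>T. \<Sum>c<b (Suc l). A l r c * z' c T) R"
        by (rule koszul_sum_mult[symmetric])
      also have "\<dots> = koszul n (koszul n (z r)) R"
        by (rule koszul_cong) (use kz[OF that] R fin in auto)
      also have "\<dots> = 0" by (rule koszul_koszul[OF fin])
      finally show ?thesis .
    qed
    moreover have "koszul n (z' c) R \<in> polys n" if "c < b (Suc l)" for c
      by (rule koszul_polys) (use z'p[OF that] R fin in auto)
    ultimately show ?thesis
      by (intro fresolution_exact[OF F, of l "\<lambda>c. koszul n (z' c) R", THEN iffD1]) blast+
  qed
  have "\<exists>y. (\<forall>c T. \<exists>k. y c T = Poly_Mapping.single 0 k) \<and> (m = 0 \<longrightarrow> (\<forall>c T. y c T = 0)) \<and>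
    (\<forall>j<b (Suc l). \<forall>R. R \<subseteq> {1..n} \<longrightarrow> Suc (card R) = m \<longrightarrow>
      koszul n (\<lambda>T. z' j T - (\<Sum>c<b (Suc (Suc l)). A (Suc l) j c * y c T)) R = 0)"
  proof (rule Suc.IH)
    show "linear_form (A i r c)" if "Suc l \<le> i" "i < Suc l + m" "r < b i" "c < b (Suc i)" for i r c
      by (rule Suc.prems(1)) (use that in simp_all)
  qed (rule z'p z'im; assumption)+
  then obtain y' where Y: "(\<forall>c T. \<exists>k. y' c T = Poly_Mapping.single 0 k) \<and> (m = 0 \<longrightarrow> (\<forall>c T. y' c T = 0)) \<and>
    (\<forall>j<b (Suc l). \<forall>R. R \<subseteq> {1..n} \<longrightarrow> Suc (card R) = m \<longrightarrow>
      koszul n (\<lambda>T. z' j T - (\<Sum>c<b (Suc (Suc l)). A (Suc l) j c * y' c T)) R = 0)"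
    by (rule exE)
  have y'c: "\<exists>k. y' c T = Poly_Mapping.single 0 k" for c T using Y[THEN conjunct1] by blast
  have y'0: "y' c T = 0" if "m = 0" for c T using Y[THEN conjunct2, THEN conjunct1] that by blast
  have y': "koszul n (\<lambda>T. z' j T - (\<Sum>c<b (Suc (Suc l)). A (Suc l) j c * y' c T)) R = 0"
    if "j < b (Suc l)" "R \<subseteq> {1..n}" "Suc (card R) = m" for j R
    using Y[THEN conjunct2, THEN conjunct2] that by blast
  have y'p: "y' c T \<in> polys n" "homogeneous 0 (y' c T)" for c T
    using y'c[of c T] by auto
  define u where "u j T = z' j T - (\<Sum>c<b (Suc (Suc l)). A (Suc l) j c * y' c T)" for j T
  have u: "u j T \<in> polys n \<and> linear_form (u j T)" if "j < b (Suc l)" "T \<subseteq> {1..n}" "card T = m" for j T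
  proof (cases "m = 0")
    case True
    then show ?thesis using z'p[OF that] y'0 by (simp add: u_def)
  next
    case False
    have "linear_form (\<Sum>c<b (Suc (Suc l)). A (Suc l) j c * y' c T)"
    proof (intro homogeneous_sum)
      fix c assume "c \<in> {..<b (Suc (Suc l))}"
      then have "linear_form (A (Suc l) j c)" using Suc.prems(1)[of "Suc l"] False that by simp
      from homogeneous_mult[OF this y'p(2)] show "linear_form (A (Suc l) j c * y' c T)" by simp
    qed
    moreover have "(\<Sum>c<b (Suc (Suc l)). A (Suc l) j c * y' c T) \<in> polys n"
      using fresolution_entries[OF F] that y'p by (intro polys_sum polys_mult) auto
    ultimately show ?thesis using z'p[OF that] by (simp add: u_def homogeneous_diff)
  qed
  have "\<forall>j. \<exists>y. j < b (Suc l) \<longrightarrow> (\<forall>U. \<exists>k. y U = Poly_Mapping.single 0 k) \<and>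
      (\<forall>T. T \<subseteq> {1..n} \<longrightarrow> card T = m \<longrightarrow> u j T = koszul n y T)"
  proof
    fix j show "\<exists>y. j < b (Suc l) \<longrightarrow> (\<forall>U. \<exists>k. y U = Poly_Mapping.single 0 k) \<and>
      (\<forall>T. T \<subseteq> {1..n} \<longrightarrow> card T = m \<longrightarrow> u j T = koszul n y T)"
    proof (cases "j < b (Suc l)")
      case True
      have "koszul n (u j) R = 0" if "R \<subseteq> {1..n}" "Suc (card R) = m" for R
        using y'[OF True that] by (simp add: u_def[abs_def])
      with u[OF True] obtain y where "\<And>U. \<exists>k. y U = Poly_Mapping.single 0 k"
        "\<And>T. T \<subseteq> {1..n} \<Longrightarrow> card T = m \<Longrightarrow> u j T = koszul n y T"
        using koszul_linear_exact[of n m "u j"] by blast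
      then show ?thesis by blast
    qed simp
  qed
  then obtain y0 where y0: "\<And>j. j < b (Suc l) \<Longrightarrow> (\<forall>U. \<exists>k. y0 j U = Poly_Mapping.single 0 k) \<and>
      (\<forall>T. T \<subseteq> {1..n} \<longrightarrow> card T = m \<longrightarrow> u j T = koszul n (y0 j) T)"
    by metis
  define y where "y j U = (if j < b (Suc l) then y0 j U else 0)" for j U
  have "\<exists>k. y c T = Poly_Mapping.single 0 k" for c T
    using y0[of c] by (auto simp: y_def intro: exI[of _ 0])
  moreover have "koszul n (\<lambda>T. z j T - (\<Sum>c<b (Suc l). A l j c * y c T)) R = 0"
    if j: "j < b l" and R: "R \<subseteq> {1..n}" "Suc (card R) = Suc m" for j R
  proof -
    have "koszul n (y c) R = u c R" if "c < b (Suc l)" for c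
      using y0[OF that] R that by (simp add: y_def[abs_def])
    then have "koszul n (\<lambda>T. \<Sum>c<b (Suc l). A l j c * y c T) R = (\<Sum>c<b (Suc l). A l j c * u c R)"
      unfolding koszul_sum_mult by (intro sum.cong) simp_all
    also have "\<dots> = (\<Sum>c<b (Suc l). A l j c * z' c R) -
        (\<Sum>c<b (Suc l). A l j c * (\<Sum>e<b (Suc (Suc l)). A (Suc l) c e * y' e R))"
      by (simp add: u_def right_diff_distrib sum_subtractf)
    also have "\<dots> = koszul n (z j) R"
      using kz[OF j] R fresolution_comp_zero[OF F y'p(1) j] by simp
    finally show ?thesis by (simp add: koszul_diff)
  qed
  ultimately show ?case by (intro exI[of _ y] conjI allI impI) simp_all
qed

text \<open>The graph under consideration is the complement of \<open>G\<close>: its edges are the pairs that are not in \<open>G\<close>.\<close>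

definition induced_cycle :: "nat \<Rightarrow> nat set set \<Rightarrow> nat list \<Rightarrow> bool" where
  "induced_cycle n G vs \<longleftrightarrow> distinct vs \<and> set vs \<subseteq> {1..n} \<and>
     (\<forall>i j. i < j \<longrightarrow> j < length vs \<longrightarrow>
        ({vs ! i, vs ! j} \<notin> G \<longleftrightarrow> j = Suc i \<or> (i = 0 \<and> Suc j = length vs)))"

lemma mvar_pair_graph_monomials:
  assumes "{i, j} \<in> G" "i \<noteq> j"
  shows "mvar i + mvar j \<in> graph_monomials G"
  unfolding graph_monomials_def
  by (rule CollectI, rule exI[of _ i], rule exI[of _ j]) (simp add: assms lookup_add lookup_mvar)

text \<open>In degree 2 a generator of higher degree cannot occur, and a generator of degree below 2
  is zero, because every monomial of the edge ideal has degree at least 2. The generators that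
  remain have degree 2 and hence constant coefficients.\<close>

lemma linear_combination_of_edge:
  assumes G: "G \<subseteq> vertex_pairs n"
    and F: "fresolution n (edge_ideal n G) b g A"
    and hom: "\<And>j. j < b 0 \<Longrightarrow> homogeneous (d j) (g j)"
    and ij: "{i, j} \<in> G"
  obtains u where "\<And>c. \<exists>k. u c = Poly_Mapping.single 0 k"
    "Poly_Mapping.single (mvar i + mvar j) (1::'k::field) = (\<Sum>c<b 0. g c * u c)"
proof -
  let ?f = "Poly_Mapping.single (mvar i + mvar j) (1::'k)"
  have ij': "i \<noteq> j" "i \<in> {1..n}" "j \<in> {1..n}" using ij G vertex_pairs_mem by blast+
  have "?f \<in> edge_ideal n G"
    using mvar_pair_graph_monomials[OF ij ij'(1)] ij' unfolding edge_ideal_eq[OF G] mon_ideal_def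
    by (simp add: polys_single keys_add_monomial)
  then obtain v where v: "\<And>c. c < b 0 \<Longrightarrow> v c \<in> polys n" "?f = (\<Sum>c<b 0. g c * v c)"
    using fresolution_ideal[OF F] by blast
  have hf: "homogeneous 2 ?f" by (simp add: homogeneous_single)
  have f2: "?f = (\<Sum>c<b 0. g c * hcomp (2 - d c) (v c))"
    by (rule homogeneous_solution[of "Suc 0" "\<lambda>_. ?f" "\<lambda>_. g" v "b 0" 2 "\<lambda>_. 0" d 0])
       (simp_all add: v(2)[symmetric] hf hom)
  define u where "u c = (if d c = 2 then hcomp 0 (v c) else 0)" for c
  have "g c * hcomp (2 - d c) (v c) = g c * u c" if c: "c < b 0" for c
  proof (cases "d c = 2")
    case False
    show ?thesis
    proof (cases "d c > 2")
      case True
      then have "hcomp (2 - d c) (v c) = 0"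
        by (intro poly_mapping_eqI) (auto simp: lookup_hcomp)
      then show ?thesis using False by (simp add: u_def)
    next
      case False
      then have "d c < 2" using \<open>d c \<noteq> 2\<close> by simp
      have "(\<Sum>j<b 0. g j * (if j = c then 1 else 0)) = (\<Sum>j<b 0. if j = c then g j else 0)"
        by (rule sum.cong) auto
      then have "g c = (\<Sum>j<b 0. g j * (if j = c then 1 else 0))" using c by simp
      then have "g c \<in> edge_ideal n G" unfolding fresolution_ideal[OF F]
        by (intro exI[of _ "\<lambda>j. if j = c then 1 else 0"] conjI) simp_all
      then have keys: "keys (g c) \<subseteq> graph_monomials G"
        by (simp add: edge_ideal_eq[OF G] mon_ideal_def)
      have "keys (g c) = {}"
      proof (rule ccontr)
        assume "keys (g c) \<noteq> {}"
        then obtain m where m: "m \<in> keys (g c)" by blast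
        then obtain x y where xy: "x \<noteq> y" "lookup m x \<ge> 1" "lookup m y \<ge> 1"
          using keys by (auto simp: graph_monomials_def)
        have "mdeg m \<ge> 2"
          by (subst monomial_split2[OF xy]) simp
        then show False using hom[OF c] m \<open>d c < 2\<close> by (auto simp: homogeneous_def)
      qed
      then show ?thesis by simp
    qed
  qed (simp add: u_def)
  then have "(\<Sum>c<b 0. g c * hcomp (2 - d c) (v c)) = (\<Sum>c<b 0. g c * u c)"
    by (intro sum.cong) simp_all
  then have "?f = (\<Sum>c<b 0. g c * u c)" by (rule trans[OF f2])
  moreover have "\<exists>k. u c = Poly_Mapping.single 0 k" for c
  proof (cases "d c = 2")
    case True
    then show ?thesis using homogeneous_0_const[OF homogeneous_hcomp[of 0 "v c"]] by (auto simp: u_def)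
  next
    case False
    then show ?thesis by (intro exI[of _ 0]) (simp add: u_def)
  qed
  ultimately show thesis using that by blast
qed

text \<open>
  The Koszul boundary of \<open>x\<^sub>a x\<^sub>b e\<^sub>T\<close> with \<open>{a, b} \<union> T\<close> the vertex set of an induced cycle of the
  complement and \<open>{a, b}\<close> one of its edges is a Koszul cycle with coefficients in the edge ideal.
  Linearity would make it the boundary of an element with coefficients in the edge ideal; the
  difference of the two preimages is a simplicial 1-cocycle on the cycle, whose values around the
  cycle do not add up to zero.
\<close>

theorem linear_imp_no_induced_cycle:
  assumes G: "G \<subseteq> vertex_pairs n"
    and F: "fresolution n (edge_ideal n G :: 'k::field mpoly set) b g A"
    and hom: "\<And>j. j < b 0 \<Longrightarrow> homogeneous (d j) (g j)"
    and k: "length vs \<ge> 4"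
    and lin: "\<And>i r c. i < length vs - 3 \<Longrightarrow> r < b i \<Longrightarrow> c < b (Suc i) \<Longrightarrow> linear_form (A i r c)"
    and cyc: "induced_cycle n G vs"
  shows False
proof -
  define C where "C = set vs"
  define m where "m = length vs - 3"
  define v0 where "v0 = vs ! 0"
  define v1 where "v1 = vs ! 1"
  have dist: "distinct vs" and Cn: "C \<subseteq> {1..n}" using cyc by (auto simp: induced_cycle_def C_def)
  have adj: "{vs ! i, vs ! j} \<notin> G \<longleftrightarrow> j = Suc i \<or> (i = 0 \<and> Suc j = length vs)"
    if "i < j" "j < length vs" for i j
    using cyc that by (auto simp: induced_cycle_def)
  have finC: "finite C" and cardC: "card C = m + 3"
    using k dist by (auto simp: C_def m_def distinct_card)
  have l01: "0 < length vs" "1 < length vs" using k by auto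
  have v01: "v0 \<in> C" "v1 \<in> C" "v0 \<noteq> v1"
    using l01 nth_eq_iff_index_eq[OF dist l01] by (simp_all add: v0_def v1_def C_def)
  \<comment> \<open>The two ends of an edge of a cycle of length at least 4 have no common neighbour
    on that cycle. A triangle would fail here.\<close>
  have third: "{v0, w} \<in> G \<or> {v1, w} \<in> G" if "w \<in> C" "w \<noteq> v0" "w \<noteq> v1" for w
  proof -
    obtain i where i: "i < length vs" "w = vs ! i" using \<open>w \<in> C\<close> by (metis C_def in_set_conv_nth)
    have "i \<noteq> 0" using that(2) i(2) unfolding v0_def by metis
    moreover have "i \<noteq> 1" using that(3) i(2) unfolding v1_def by metis
    ultimately have "i \<ge> 2" by simp
    then show ?thesis using adj[of 0 i] adj[of 1 i] i k by (auto simp: v0_def v1_def)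
  qed
  \<comment> \<open>The exterior monomial of the other \<open>m + 1\<close> vertices with
    coefficient \<open>x_v0 x_v1\<close>. This coefficient is not in the edge ideal, but by
    \<open>third\<close> each term \<open>x_v x_v0 x_v1\<close> of the boundary is a variable times
    an edge.\<close>
  define E where "E U = (if U = C - {v0, v1} then Poly_Mapping.single (mvar v0 + mvar v1) 1 else (0 :: 'k mpoly))" for U
  have "\<forall>T. \<exists>w. (\<forall>c<b 0. w c \<in> polys n \<and> linear_form (w c)) \<and> koszul n E T = (\<Sum>c<b 0. g c * w c)"
  proof
    fix T
    have "\<exists>w. (\<forall>c<b 0. w c \<in> polys n \<and> linear_form (w c)) \<and>
        Poly_Mapping.single (mvar v) (sg v T) * E (insert v T) = (\<Sum>c<b 0. g c * w c)"
      if v: "v \<in> {1..n} - T" for v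
    proof (cases "insert v T = C - {v0, v1}")
      case False
      then show ?thesis by (intro exI[of _ "\<lambda>_. 0"]) (simp add: E_def)
    next
      case True
      then have "v \<in> C" "v \<noteq> v0" "v \<noteq> v1" by auto
      then obtain x y z where xyz: "{x, y} \<in> G" "z \<in> C" "mvar v + (mvar v0 + mvar v1) = mvar z + (mvar x + mvar y)"
        using third[of v] v01 by (metis add.commute add.left_commute)
      obtain u where u: "\<And>c. \<exists>k. u c = Poly_Mapping.single 0 k"
        "Poly_Mapping.single (mvar x + mvar y) (1::'k) = (\<Sum>c<b 0. g c * u c)"
        using linear_combination_of_edge[OF G F hom xyz(1)] by blast
      let ?w = "\<lambda>c. Poly_Mapping.single (mvar z) (sg v T) * u c"
      have "Poly_Mapping.single (mvar v) (sg v T) * E (insert v T) =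
          Poly_Mapping.single (mvar z) (sg v T) * Poly_Mapping.single (mvar x + mvar y) (1::'k)"
        using True xyz(3) by (simp add: E_def mult_single)
      also have "\<dots> = (\<Sum>c<b 0. g c * ?w c)"
        unfolding u(2) by (simp add: sum_distrib_left mult.left_commute)
      finally have 1: "Poly_Mapping.single (mvar v) (sg v T) * E (insert v T) = (\<Sum>c<b 0. g c * ?w c)" .
      have 2: "?w c \<in> polys n \<and> linear_form (?w c)" for c
      proof -
        obtain k where k: "u c = Poly_Mapping.single 0 k" using u(1) by blast
        have "z \<in> {1..n}" using xyz(2) Cn by blast
        then show ?thesis unfolding k mult_single by (auto intro!: polys_single homogeneous_single)
      qed
      show ?thesis
      proof (intro exI[of _ ?w] conjI allI impI)
        show "?w c \<in> polys n" "linear_form (?w c)" for c using 2[of c] by blast+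
      qed (rule 1)
    qed
    then have "\<forall>v. \<exists>w. v \<in> {1..n} - T \<longrightarrow> (\<forall>c<b 0. w c \<in> polys n \<and> linear_form (w c)) \<and>
        Poly_Mapping.single (mvar v) (sg v T) * E (insert v T) = (\<Sum>c<b 0. g c * w c)" by blast
    from choice[OF this] obtain w where
      w: "\<And>v. v \<in> {1..n} - T \<Longrightarrow> (\<forall>c<b 0. w v c \<in> polys n \<and> linear_form (w v c)) \<and>
        Poly_Mapping.single (mvar v) (sg v T) * E (insert v T) = (\<Sum>c<b 0. g c * w v c)" by blast
    have "koszul n E T = (\<Sum>v\<in>{1..n} - T. \<Sum>c<b 0. g c * w v c)"
      unfolding koszul_def using w by (intro sum.cong) auto
    also have "\<dots> = (\<Sum>c<b 0. g c * (\<Sum>v\<in>{1..n} - T. w v c))"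
      by (subst sum.swap) (simp add: sum_distrib_left)
    finally have eq: "koszul n E T = (\<Sum>c<b 0. g c * (\<Sum>v\<in>{1..n} - T. w v c))" .
    show "\<exists>w. (\<forall>c<b 0. w c \<in> polys n \<and> linear_form (w c)) \<and> koszul n E T = (\<Sum>c<b 0. g c * w c)"
    proof (intro exI[of _ "\<lambda>c. \<Sum>v\<in>{1..n} - T. w v c"] conjI allI impI)
      fix c assume c: "c < b 0"
      show "(\<Sum>v\<in>{1..n} - T. w v c) \<in> polys n" using w c by (intro polys_sum) blast
      show "linear_form (\<Sum>v\<in>{1..n} - T. w v c)" using w c by (intro homogeneous_sum) blast
    qed (rule eq)
  qed
  from choice[OF this] obtain z where z: "\<And>T c. c < b 0 \<Longrightarrow> z T c \<in> polys n \<and> linear_form (z T c)"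
    "\<And>T. koszul n E T = (\<Sum>c<b 0. g c * z T c)" by blast
  have "\<exists>y. (\<forall>c T. \<exists>k. y c T = Poly_Mapping.single 0 k) \<and> (m = 0 \<longrightarrow> (\<forall>c T. y c T = 0)) \<and>
    (\<forall>j<b 0. \<forall>R. R \<subseteq> {1..n} \<longrightarrow> Suc (card R) = m \<longrightarrow>
      koszul n (\<lambda>T. z T j - (\<Sum>c<b (Suc 0). A 0 j c * y c T)) R = 0)"
  proof (rule koszul_lift[OF F, of 0 m "\<lambda>j T. z T j"])
    fix R assume R: "R \<subseteq> {1..n}" "Suc (card R) = m"
    then have fin: "finite R" using finite_subset by blast
    have "(\<Sum>j<b 0. g j * koszul n (\<lambda>T. z T j) R) = koszul n (koszul n E) R"
      unfolding koszul_sum_mult[symmetric] by (rule koszul_cong) (simp add: z(2))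
    then have S: "(\<Sum>j<b 0. g j * koszul n (\<lambda>T. z T j) R) = 0"
      using koszul_koszul[OF fin] by simp
    have P: "koszul n (\<lambda>T. z T j) R \<in> polys n" if "j < b 0" for j
      by (rule koszul_polys) (use z that in auto)
    have "\<exists>w. (\<forall>c<b 1. w c \<in> polys n) \<and>
        (\<forall>j<b 0. koszul n (\<lambda>T. z T j) R = (\<Sum>c<b 1. A 0 j c * w c))"
      by (rule fresolution_exact0[OF F, THEN iffD1]) (rule P, assumption, rule S)
    then show "\<exists>w. (\<forall>c<b (Suc 0). w c \<in> polys n) \<and>
        (\<forall>j<b 0. koszul n (\<lambda>T. z T j) R = (\<Sum>c<b (Suc 0). A 0 j c * w c))"
      by (simp only: One_nat_def)
  next
    show "linear_form (A i r c)" if "0 \<le> i" "i < 0 + m" "r < b i" "c < b (Suc i)" for i r c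
      by (rule lin) (use that in \<open>simp_all add: m_def\<close>)
    show "z T j \<in> polys n \<and> linear_form (z T j)" if "j < b 0" for j T
      by (rule z(1)[OF that])
  qed
  then obtain y where Y: "(\<forall>c T. \<exists>k. y c T = Poly_Mapping.single 0 k) \<and> (m = 0 \<longrightarrow> (\<forall>c T. y c T = 0)) \<and>
    (\<forall>j<b 0. \<forall>R. R \<subseteq> {1..n} \<longrightarrow> Suc (card R) = m \<longrightarrow>
      koszul n (\<lambda>T. z T j - (\<Sum>c<b (Suc 0). A 0 j c * y c T)) R = 0)"
    by (rule exE)
  have yc: "\<exists>k. y c T = Poly_Mapping.single 0 k" for c T using Y[THEN conjunct1] by blast
  have yp: "y c T \<in> polys n" "homogeneous 0 (y c T)" for c T using yc[of c T] by auto
  define u where "u j T = z T j - (\<Sum>c<b (Suc 0). A 0 j c * y c T)" for j T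
  have ku: "koszul n (u j) R = 0" if "j < b 0" "R \<subseteq> {1..n}" "Suc (card R) = m" for j R
    using Y[THEN conjunct2, THEN conjunct2] that unfolding u_def[abs_def] by blast
  have up: "u j T \<in> polys n \<and> linear_form (u j T)" if "j < b 0" for j T
  proof -
    have "linear_form (A 0 j c * y c T)" if "c < b (Suc 0)" for c
      using homogeneous_mult[OF lin[of 0 j c] yp(2)] that \<open>j < b 0\<close> k by simp
    then have "linear_form (\<Sum>c<b (Suc 0). A 0 j c * y c T)" by (intro homogeneous_sum) auto
    moreover have "(\<Sum>c<b (Suc 0). A 0 j c * y c T) \<in> polys n"
      using fresolution_entries[OF F] that yp by (intro polys_sum polys_mult) auto
    ultimately show ?thesis using z(1)[OF that] by (simp add: u_def homogeneous_diff)
  qed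
  have "\<forall>j. \<exists>y0. j < b 0 \<longrightarrow> (\<forall>U. \<exists>k. y0 U = Poly_Mapping.single 0 k) \<and>
      (\<forall>T. T \<subseteq> {1..n} \<longrightarrow> card T = m \<longrightarrow> u j T = koszul n y0 T)"
  proof
    fix j show "\<exists>y0. j < b 0 \<longrightarrow> (\<forall>U. \<exists>k. y0 U = Poly_Mapping.single 0 k) \<and>
      (\<forall>T. T \<subseteq> {1..n} \<longrightarrow> card T = m \<longrightarrow> u j T = koszul n y0 T)"
    proof (cases "j < b 0")
      case True
      have "\<exists>y. (\<forall>U. \<exists>k. y U = Poly_Mapping.single 0 k) \<and>
        (\<forall>T. T \<subseteq> {1..n} \<longrightarrow> card T = m \<longrightarrow> u j T = koszul n y T)"
        by (rule koszul_linear_exact_ex) (use up[OF True] ku[OF True] in blast)+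
      then show ?thesis by blast
    qed simp
  qed
  from choice[OF this] obtain y0 where y0: "\<And>j. j < b 0 \<Longrightarrow> (\<forall>U. \<exists>k. y0 j U = Poly_Mapping.single 0 k) \<and>
      (\<forall>T. T \<subseteq> {1..n} \<longrightarrow> card T = m \<longrightarrow> u j T = koszul n (y0 j) T)" by blast
  \<comment> \<open>A second preimage of the boundary of \<open>E\<close>, now with coefficients in
    the edge ideal.\<close>
  define Y where "Y U = (\<Sum>j<b 0. g j * y0 j U)" for U
  have YI: "Y U \<in> edge_ideal n G" for U
  proof -
    have "y0 j U \<in> polys n" if j: "j < b 0" for j
    proof -
      obtain k where "y0 j U = Poly_Mapping.single 0 k" using y0[OF j] by blast
      then show ?thesis by simp
    qed
    then show ?thesis unfolding fresolution_ideal[OF F] Y_def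
      by (intro exI[of _ "\<lambda>j. y0 j U"] conjI) simp_all
  qed
  have KE: "koszul n E T = koszul n Y T" if T: "T \<subseteq> {1..n}" "card T = m" for T
  proof -
    have "koszul n Y T = (\<Sum>j<b 0. g j * u j T)"
      unfolding Y_def[abs_def] koszul_sum_mult using y0 T by (intro sum.cong) auto
    also have "\<dots> = koszul n E T - (\<Sum>j<b 0. g j * (\<Sum>c<b (Suc 0). A 0 j c * y c T))"
      by (simp add: u_def right_diff_distrib sum_subtractf z(2))
    also have "(\<Sum>j<b 0. g j * (\<Sum>c<b (Suc 0). A 0 j c * y c T)) = 0"
      using fresolution_comp_zero0[OF F, of "\<lambda>c. y c T"] yp by simp
    finally show ?thesis by simp
  qed
  define D where "D U = E U - Y U" for U
  have KD: "koszul n D T = 0" if "T \<subseteq> {1..n}" "card T = m" for T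
    using KE[OF that] by (simp add: D_def[abs_def] koszul_diff)
  \<comment> \<open>The part of \<open>D\<close> of squarefree multidegree \<open>C\<close>: one
    scalar for each pair of vertices of the cycle.\<close>
  define al where "al a c = lookup (D (C - {a, c})) (mvar a + mvar c)" for a c
  have al_sym: "al a c = al c a" for a c by (simp add: al_def add.commute insert_commute)
  \<comment> \<open>The signs turn the symmetric \<open>al\<close> into an antisymmetric function,
    for which the vanishing of the boundary of \<open>D\<close> at \<open>C - {a, c, e}\<close>
    becomes the cocycle identity on the triangle \<open>a\<close>, \<open>c\<close>,
    \<open>e\<close>.\<close>
  define be where "be a c = sg a C * sg c C * osg a c * al a c" for a c
  have cocycle: "be a c + be c e + be e a = 0"
    if ace: "a \<in> C" "c \<in> C" "e \<in> C" "a \<noteq> c" "c \<noteq> e" "a \<noteq> e" for a c e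
  proof -
    define R where "R = C - {a, c, e}"
    have finR: "finite R" using finC by (simp add: R_def)
    have Cins: "C = insert a (insert c (insert e R))" using ace by (auto simp: R_def)
    have nin: "a \<notin> R" "c \<notin> R" "e \<notin> R" by (auto simp: R_def)
    have cardR: "card R = m" using cardC ace nin finR unfolding Cins by simp
    have Rn: "R \<subseteq> {1..n}" using Cn by (auto simp: R_def)
    have set_eq: "{u \<in> {1..n} - R. lookup (mvar a + mvar c + mvar e) u \<ge> 1} = {a, c, e}"
      using ace Cn nin by (auto simp: lookup_add lookup_mvar)
    have ins: "insert a R = C - {c, e}" "insert c R = C - {a, e}" "insert e R = C - {a, c}"
      using ace by (auto simp: R_def)
    have mm: "mvar a + mvar c + mvar e - mvar a = mvar c + mvar e"
      "mvar a + mvar c + mvar e - mvar c = mvar a + mvar e"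
      "mvar a + mvar c + mvar e - mvar e = mvar a + mvar c"
      by (rule poly_mapping_eqI, simp add: lookup_add lookup_minus)+
    have "0 = lookup (koszul n D R) (mvar a + mvar c + mvar e)" using KD[OF Rn cardR] by simp
    also have "\<dots> = sg a R * al c e + (sg c R * al a e + sg e R * al a c)"
      unfolding lookup_koszul set_eq using ace by (simp add: ins mm al_def)
    finally have rel: "sg a R * al c e + (sg c R * al a e + sg e R * al a c) = 0" by simp
    have sgC: "sg v C = sg v R * osg a v * osg c v * osg e v" for v
      using ace nin finR unfolding Cins by (simp add: sg_insert mult.commute mult.left_commute)
    have "be a c + be c e + be e a = (sg a R * sg c R * sg e R * osg a c * osg c e * osg e a) *
        (sg a R * al c e + (sg c R * al a e + sg e R * al a c))"
    proof -
      have s: "sg a R \<in> {1, -1 :: 'k}" "sg c R \<in> {1, -1 :: 'k}" "sg e R \<in> {1, -1 :: 'k}"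
        by (simp_all add: sg_def minus_one_power_iff)
      have o: "osg a c = (1::'k) \<and> osg c a = (-1::'k) \<or> osg a c = (-1::'k) \<and> osg c a = (1::'k)"
        "osg c e = (1::'k) \<and> osg e c = (-1::'k) \<or> osg c e = (-1::'k) \<and> osg e c = (1::'k)"
        "osg e a = (1::'k) \<and> osg a e = (-1::'k) \<or> osg e a = (-1::'k) \<and> osg a e = (1::'k)"
        using ace by (auto simp: osg_def)
      show ?thesis unfolding be_def sgC al_sym[of e a] using s o
        by (elim insertE emptyE disjE conjE; simp add: algebra_simps)
    qed
    then show ?thesis using rel by simp
  qed
  have vC: "vs ! i \<in> C" if "i < length vs" for i using that by (simp add: C_def)
  have neq: "vs ! i \<noteq> vs ! j" if "i < j" "j < length vs" for i j
    using that dist by (simp add: nth_eq_iff_index_eq)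
  have Y0: "lookup (Y U) (mvar a + mvar c) = 0" if "{a, c} \<notin> G" "a \<noteq> c" for U a c
  proof -
    have "mvar a + mvar c \<notin> graph_monomials G"
    proof
      assume "mvar a + mvar c \<in> graph_monomials G"
      then obtain i j where ij: "{i, j} \<in> G" "i \<noteq> j" "lookup (mvar a + mvar c) i \<ge> 1" "lookup (mvar a + mvar c) j \<ge> 1"
        by (auto simp: graph_monomials_def)
      then have "i \<in> {a, c}" "j \<in> {a, c}" by (auto simp: lookup_add lookup_mvar split: if_splits)
      then have "{i, j} = {a, c}" using \<open>i \<noteq> j\<close> by auto
      then show False using ij that by simp
    qed
    then show ?thesis using YI[of U] unfolding edge_ideal_eq[OF G] mon_ideal_def
      by (auto simp: in_keys_iff)
  qed
  have be01: "be v0 v1 \<noteq> 0"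
  proof -
    have "{v0, v1} \<notin> G" using adj[of 0 1] k by (simp add: v0_def v1_def)
    then have "al v0 v1 = 1" using Y0[of v0 v1] v01 by (simp add: al_def D_def E_def lookup_minus)
    then show ?thesis by (simp add: be_def sg_def osg_def)
  qed
  \<comment> \<open>On the cycle edges other than the first, neither \<open>E\<close> nor the edge
    ideal contributes. Since \<open>i < j\<close>, the condition \<open>j \<noteq> 1\<close>
    excludes exactly the pair of \<open>v0\<close> and \<open>v1\<close>.\<close>
  have be_cyc: "be (vs ! i) (vs ! j) = 0"
    if "i < j" "j < length vs" "{vs ! i, vs ! j} \<notin> G" "j \<noteq> 1" for i j
  proof -
    have "C - {vs ! i, vs ! j} \<noteq> C - {v0, v1}"
    proof
      assume "C - {vs ! i, vs ! j} = C - {v0, v1}"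
      then have "vs ! j \<in> {v0, v1}" using vC[of j] that by auto
      then have "j = 0 \<or> j = 1"
        using nth_eq_iff_index_eq[OF dist that(2) l01(1)] nth_eq_iff_index_eq[OF dist that(2) l01(2)]
        by (auto simp: v0_def v1_def)
      then show False using that by simp
    qed
    then have "al (vs ! i) (vs ! j) = 0"
      using Y0[of "vs ! i" "vs ! j"] that neq by (simp add: al_def D_def E_def lookup_minus)
    then show ?thesis by (simp add: be_def)
  qed
  have be_swap: "be a c = - be c a" if "a \<noteq> c" for a c
    using osg_swap[OF that, where 'a = 'k] by (simp add: be_def al_sym[of a c] mult.commute)
  \<comment> \<open>A fan of triangles with apex \<open>v0\<close>: as \<open>be\<close> vanishes on
    the outer edges, its value on the spoke does not change from one vertex to the next. The last
    spoke is itself a cycle edge with value 0, while the first has a nonzero value.\<close>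
  have "be v0 (vs ! Suc j) = be v0 v1" if "Suc j < length vs" for j
    using that
  proof (induction j)
    case 0
    then show ?case by (simp add: v1_def)
  next
    case (Suc j)
    let ?a = "vs ! Suc j" and ?c = "vs ! Suc (Suc j)"
    have "be v0 ?a + be ?a ?c + be ?c v0 = 0"
      using vC[OF l01(1)] vC[of "Suc j"] vC[of "Suc (Suc j)"] neq[of 0 "Suc j"] neq[of 0 "Suc (Suc j)"]
        neq[of "Suc j" "Suc (Suc j)"] Suc.prems by (intro cocycle) (auto simp: v0_def)
    moreover have "be ?a ?c = 0"
      using be_cyc[of "Suc j" "Suc (Suc j)"] adj[of "Suc j" "Suc (Suc j)"] Suc.prems by simp
    moreover have "be ?c v0 = - be v0 ?c"
      using neq[of 0 "Suc (Suc j)"] Suc.prems by (intro be_swap) (auto simp: v0_def)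
    ultimately show ?case using Suc by (simp add: eq_neg_iff_add_eq_0[symmetric])
  qed
  from this[of "length vs - 2"] have "be v0 (vs ! (length vs - 1)) = be v0 v1"
    using k by (simp add: numeral_eq_Suc Suc_diff_Suc)
  moreover have "be v0 (vs ! (length vs - 1)) = 0"
    using be_cyc[of 0 "length vs - 1"] adj[of 0 "length vs - 1"] k by (simp add: v0_def)
  ultimately show False using be01 by simp
qed

section \<open>Mapping cones of linear resolutions\<close>

text \<open>The row of generators is passed as \<open>\<lambda>_. g\<close> and read at row 0, which
  gives the exactness statements at all places a common form.\<close>

definition ap :: "nat \<Rightarrow> (nat \<Rightarrow> nat \<Rightarrow> 'a::comm_ring_1) \<Rightarrow> (nat \<Rightarrow> 'a) \<Rightarrow> nat \<Rightarrow> 'a" where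
  "ap m A v r = (\<Sum>k<m. A r k * v k)"

lemma ap_cong: "(\<And>k. k < m \<Longrightarrow> u k = w k) \<Longrightarrow> ap m A u r = ap m A w r"
  unfolding ap_def by (intro sum.cong) auto

lemma ap_add: "ap m A (\<lambda>k. u k + w k) r = ap m A u r + ap m A w r"
  by (simp add: ap_def distrib_left sum.distrib)

lemma ap_diff: "ap m A (\<lambda>k. u k - w k) r = ap m A u r - ap m A w r"
  by (simp add: ap_def right_diff_distrib sum_subtractf)

lemma ap_uminus: "ap m A (\<lambda>k. - u k) r = - ap m A u r"
  by (simp add: ap_def sum_negf)

lemma ap_mult: "ap m A (\<lambda>k. x * u k) r = x * ap m A u r"
  by (simp add: ap_def sum_distrib_left mult.left_commute)

lemma ap_zero [simp]: "ap m A (\<lambda>k. 0) r = 0"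
  by (simp add: ap_def)

lemma ap_ap: "ap m A (ap l B u) r = ap l (\<lambda>r k. ap m A (\<lambda>e. B e k) r) u r"
  unfolding ap_def by (simp add: sum_distrib_left sum_distrib_right mult.assoc sum.swap[of _ "{..<l}"])

lemma ap_polys:
  "(\<And>k. k < m \<Longrightarrow> A r k \<in> polys n) \<Longrightarrow> (\<And>k. k < m \<Longrightarrow> v k \<in> polys n) \<Longrightarrow> ap m A v r \<in> polys n"
  unfolding ap_def by (intro polys_sum polys_mult) auto

lemma ap_comp_eq:
  assumes "\<And>c. c < l \<Longrightarrow> ap m A (\<lambda>e. B e c) r = ap m' A' (\<lambda>e. B' e c) r'"
  shows "ap m A (ap l B u) r = ap m' A' (ap l B' u) r'"
  unfolding ap_ap by (unfold ap_def[of l]) (intro sum.cong refl, simp add: assms)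

text \<open>All generators share one degree \<open>d\<close>. This is the invariant that the cone
  construction propagates: a second ideal of degree one less enters at each step.\<close>

definition linres :: "nat \<Rightarrow> int \<Rightarrow> 'k::field mpoly set \<Rightarrow> bool" where
  "linres n d I \<longleftrightarrow> (\<exists>b g A. fresolution n I b g A \<and> (\<forall>j<b 0. homogeneous d (g j)) \<and>
     (\<forall>i. \<forall>r<b i. \<forall>c<b (Suc i). linear_form (A i r c)))"

text \<open>The basis elements of the \<open>i\<close>-th module get degree
  \<open>d + int i\<close>, and a linear form has no constant term, so the resolution is
  automatically minimal.\<close>

lemma linres_imp_has_linear_resolution:
  assumes "linres n d I"
  shows "has_linear_resolution n I"
proof -
  obtain b g A where F: "fresolution n I b g A" and g: "\<forall>j<b 0. homogeneous d (g j)"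
    and A: "\<forall>i. \<forall>r<b i. \<forall>c<b (Suc i). linear_form (A i r c)"
    using assms unfolding linres_def by (elim exE conjE)
  let ?A = "\<lambda>i. mat (b i) (b (Suc i)) (\<lambda>(r, c). A i r c)"
  have M: "minimal_graded_free_resolution n I b (\<lambda>i j. d + int i) (vec (b 0) g) ?A"
  proof (rule minimal_graded_free_resolutionI[OF F])
    fix i r c assume rc: "r < b i" "c < b (Suc i)"
    then have l: "linear_form (A i r c)" using A by blast
    show "A i r c \<in> irrelevant_ideal n"
      by (rule irrelevant_homogeneous[OF fresolution_entries[OF F rc] l]) simp
    show "homogeneous (d + int (Suc i) - (d + int i)) (A i r c)" using l by simp
  qed (use g in simp)
  have "linear_form (?A i $$ (r, c))" if "r < b i" "c < b (Suc i)" for i r c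
    using A that by simp
  with M show ?thesis unfolding has_linear_resolution_def by blast
qed

lemma fresolution_exact_ap:
  assumes "fresolution n I b g A" "\<And>j. j < b (Suc i) \<Longrightarrow> v j \<in> polys n"
  shows "(\<forall>r<b i. ap (b (Suc i)) (A i) v r = 0) \<longleftrightarrow>
    (\<exists>w. (\<forall>c<b (Suc (Suc i)). w c \<in> polys n) \<and>
         (\<forall>r<b (Suc i). v r = ap (b (Suc (Suc i))) (A (Suc i)) w r))"
  unfolding ap_def by (rule fresolution_exact[OF assms])

lemma fresolution_exact0_ap:
  assumes "fresolution n I b g A" "\<And>j. j < b 0 \<Longrightarrow> v j \<in> polys n"
  shows "ap (b 0) (\<lambda>_. g) v 0 = 0 \<longleftrightarrow>
    (\<exists>w. (\<forall>c<b (Suc 0). w c \<in> polys n) \<and> (\<forall>r<b 0. v r = ap (b (Suc 0)) (A 0) w r))"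
  unfolding ap_def using fresolution_exact0[OF assms] by (simp only: One_nat_def)

lemma fresolution_ideal_ap:
  "fresolution n I b g A \<Longrightarrow> f \<in> I \<longleftrightarrow> (\<exists>v. (\<forall>j<b 0. v j \<in> polys n) \<and> f = ap (b 0) (\<lambda>_. g) v 0)"
  unfolding ap_def by (rule fresolution_ideal)

lemma fresolution_ap_zero:
  assumes F: "fresolution n I b g A" and w: "\<And>e. e < b (Suc (Suc i)) \<Longrightarrow> w e \<in> polys n" and r: "r < b i"
  shows "ap (b (Suc i)) (A i) (ap (b (Suc (Suc i))) (A (Suc i)) w) r = 0"
  unfolding ap_def by (rule fresolution_comp_zero[OF F w r])

lemma fresolution_ap_zero0:
  assumes F: "fresolution n I b g A" and w: "\<And>e. e < b (Suc 0) \<Longrightarrow> w e \<in> polys n"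
  shows "ap (b 0) (\<lambda>_. g) (ap (b (Suc 0)) (A 0) w) 0 = 0"
  unfolding ap_def using fresolution_comp_zero0[OF F, of w] w by (simp only: One_nat_def)

lemma fresolutionI_ap:
  assumes "\<And>j. j < b 0 \<Longrightarrow> g j \<in> polys n"
    and "\<And>i r c. r < b i \<Longrightarrow> c < b (Suc i) \<Longrightarrow> A i r c \<in> polys n"
    and "\<And>f. f \<in> I \<longleftrightarrow> (\<exists>v. (\<forall>j<b 0. v j \<in> polys n) \<and> f = ap (b 0) (\<lambda>_. g) v 0)"
    and "\<And>v. (\<And>j. j < b 0 \<Longrightarrow> v j \<in> polys n) \<Longrightarrow> ap (b 0) (\<lambda>_. g) v 0 = 0 \<longleftrightarrow>
      (\<exists>w. (\<forall>c<b (Suc 0). w c \<in> polys n) \<and> (\<forall>r<b 0. v r = ap (b (Suc 0)) (A 0) w r))"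
    and "\<And>i v. (\<And>j. j < b (Suc i) \<Longrightarrow> v j \<in> polys n) \<Longrightarrow>
      (\<forall>r<b i. ap (b (Suc i)) (A i) v r = 0) \<longleftrightarrow>
      (\<exists>w. (\<forall>c<b (Suc (Suc i)). w c \<in> polys n) \<and>
         (\<forall>r<b (Suc i). v r = ap (b (Suc (Suc i))) (A (Suc i)) w r))"
  shows "fresolution n I b g A"
  using assms unfolding fresolution_def ap_def One_nat_def by (intro conjI allI impI) simp_all

text \<open>Comparison of resolutions along the inclusion of \<open>J\<close> in \<open>Q\<close>.
  The generators of \<open>J\<close> have degree one more than those of \<open>Q\<close>, so taking
  homogeneous parts makes every component of the lift linear.\<close>

lemma chain_map_exists:
  assumes FJ: "fresolution n J bJ gJ AJ" and FQ: "fresolution n Q bQ gQ AQ"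
    and sub: "J \<subseteq> Q"
    and gJ: "\<And>j. j < bJ 0 \<Longrightarrow> homogeneous (d + 1) (gJ j)"
    and gQ: "\<And>j. j < bQ 0 \<Longrightarrow> homogeneous d (gQ j)"
    and AJ: "\<And>i r c. r < bJ i \<Longrightarrow> c < bJ (Suc i) \<Longrightarrow> linear_form (AJ i r c)"
    and AQ: "\<And>i r c. r < bQ i \<Longrightarrow> c < bQ (Suc i) \<Longrightarrow> linear_form (AQ i r c)"
  obtains phi where
    "\<And>i r c. r < bQ i \<Longrightarrow> c < bJ i \<Longrightarrow> phi i r c \<in> polys n \<and> linear_form (phi i r c)"
    "\<And>c. c < bJ 0 \<Longrightarrow> gJ c = ap (bQ 0) (\<lambda>_. gQ) (\<lambda>r. phi 0 r c) 0"
    "\<And>i r c. r < bQ i \<Longrightarrow> c < bJ (Suc i) \<Longrightarrow>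
      ap (bJ i) (phi i) (\<lambda>k. AJ i k c) r = ap (bQ (Suc i)) (AQ i) (\<lambda>k. phi (Suc i) k c) r"
proof -
  define ent where "ent i phi \<longleftrightarrow> (\<forall>r<bQ i. \<forall>c<bJ i. phi r c \<in> polys n \<and> linear_form (phi r c))"
    for i and phi :: "nat \<Rightarrow> nat \<Rightarrow> 'a mpoly"
  \<comment> \<open>The last conjunct says that the next component exists; with it in the invariant,
    dependent choice can build the maps one after another.\<close>
  define P where "P i phi \<longleftrightarrow> ent i phi \<and> (i = 0 \<longrightarrow> (\<forall>c<bJ 0. gJ c = ap (bQ 0) (\<lambda>_. gQ) (\<lambda>r. phi r c) 0)) \<and>
     (\<forall>c<bJ (Suc i). \<exists>w. (\<forall>e<bQ (Suc i). w e \<in> polys n) \<and>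
        (\<forall>r<bQ i. ap (bJ i) phi (\<lambda>k. AJ i k c) r = ap (bQ (Suc i)) (AQ i) w r))"
    for i and phi :: "nat \<Rightarrow> nat \<Rightarrow> 'a mpoly"
  define R where "R i phi phi' \<longleftrightarrow> (\<forall>r<bQ i. \<forall>c<bJ (Suc i).
      ap (bJ i) phi (\<lambda>k. AJ i k c) r = ap (bQ (Suc i)) (AQ i) (\<lambda>k. phi' k c) r)"
    for i and phi phi' :: "nat \<Rightarrow> nat \<Rightarrow> 'a mpoly"
  have AJp: "r < bJ i \<Longrightarrow> c < bJ (Suc i) \<Longrightarrow> AJ i r c \<in> polys n" for i r c
    by (rule fresolution_entries[OF FJ])
  have colJ: "ap (bJ (Suc i)) (AJ i) (\<lambda>k. AJ (Suc i) k c) r = 0" if "r < bJ i" "c < bJ (Suc (Suc i))" for i r c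
    using fresolution_exact_ap[OF FJ, of i "\<lambda>k. AJ (Suc i) k c", THEN iffD2] AJp that
    by (intro fresolution_exact_ap[OF FJ, of i "\<lambda>k. AJ (Suc i) k c", THEN iffD2, rule_format])
      (auto simp: ap_def if_distrib cong: if_cong intro!: exI[of _ "\<lambda>e. if e = c then 1 else 0"])
  have colJ0: "ap (bJ 0) (\<lambda>_. gJ) (\<lambda>k. AJ 0 k c) 0 = 0" if "c < bJ (Suc 0)" for c
    using AJp that
    by (intro fresolution_exact0_ap[OF FJ, of "\<lambda>k. AJ 0 k c", THEN iffD2])
      (auto simp: ap_def if_distrib cong: if_cong intro!: exI[of _ "\<lambda>e. if e = c then 1 else 0"])
  have base: "\<exists>phi. P 0 phi"
  proof -
    have "\<forall>c. \<exists>u. c < bJ 0 \<longrightarrow> (\<forall>r<bQ 0. u r \<in> polys n) \<and> gJ c = ap (bQ 0) (\<lambda>_. gQ) u 0"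
    proof (intro allI)
      fix c
      show "\<exists>u. c < bJ 0 \<longrightarrow> (\<forall>r<bQ 0. u r \<in> polys n) \<and> gJ c = ap (bQ 0) (\<lambda>_. gQ) u 0"
      proof (cases "c < bJ 0")
        case True
        then have "gJ c \<in> J" unfolding fresolution_ideal_ap[OF FJ]
          by (intro exI[of _ "\<lambda>e. if e = c then 1 else 0"]) (auto simp: ap_def if_distrib cong: if_cong)
        then have "gJ c \<in> Q" using sub by blast
        then show ?thesis unfolding fresolution_ideal_ap[OF FQ] by blast
      qed simp
    qed
    from choice[OF this] obtain u where u: "\<And>c. c < bJ 0 \<Longrightarrow> (\<forall>r<bQ 0. u c r \<in> polys n) \<and>
      gJ c = ap (bQ 0) (\<lambda>_. gQ) (u c) 0" by blast
    define phi where "phi r c = hcomp 1 (u c r)" for r c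
    have e: "ent 0 phi" using u by (simp add: ent_def phi_def)
    have g: "gJ c = ap (bQ 0) (\<lambda>_. gQ) (\<lambda>r. phi r c) 0" if c: "c < bJ 0" for c
    proof -
      have "gJ c = (\<Sum>k<bQ 0. gQ k * hcomp (1 + d - d) (u c k))"
        by (rule homogeneous_solution[of "1::nat" "\<lambda>_. gJ c" "\<lambda>_. gQ" "u c" "bQ 0" "1 + d" "\<lambda>_. 0" "\<lambda>_. d" 0])
          (use u[OF c] gJ[OF c] gQ in \<open>simp_all add: ap_def add.commute\<close>)
      then show ?thesis by (simp add: ap_def phi_def)
    qed
    have "\<exists>w. (\<forall>e<bQ (Suc 0). w e \<in> polys n) \<and>
        (\<forall>r<bQ 0. ap (bJ 0) phi (\<lambda>k. AJ 0 k c) r = ap (bQ (Suc 0)) (AQ 0) w r)" if c: "c < bJ (Suc 0)" for c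
    proof (rule fresolution_exact0_ap[OF FQ, THEN iffD1])
      show "ap (bJ 0) phi (\<lambda>k. AJ 0 k c) r \<in> polys n" if "r < bQ 0" for r
        using e that AJp c by (intro ap_polys) (auto simp: ent_def)
      have "ap (bQ 0) (\<lambda>_. gQ) (ap (bJ 0) phi (\<lambda>k. AJ 0 k c)) 0 = ap (bJ 0) (\<lambda>_. gJ) (\<lambda>k. AJ 0 k c) 0"
        unfolding ap_ap by (unfold ap_def[of "bJ 0"], rule sum.cong) (use g in simp_all)
      then show "ap (bQ 0) (\<lambda>_. gQ) (ap (bJ 0) phi (\<lambda>k. AJ 0 k c)) 0 = 0" using colJ0[OF c] by simp
    qed
    then have "P 0 phi" using e g unfolding P_def by blast
    then show ?thesis by blast
  qed
  have step: "\<exists>phi'. P (Suc i) phi' \<and> R i phi phi'" if Pi: "P i phi" for i phi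
  proof -
    have e: "ent i phi" using Pi by (simp add: P_def)
    have "\<forall>c. \<exists>w. c < bJ (Suc i) \<longrightarrow> (\<forall>e<bQ (Suc i). w e \<in> polys n) \<and>
        (\<forall>r<bQ i. ap (bJ i) phi (\<lambda>k. AJ i k c) r = ap (bQ (Suc i)) (AQ i) w r)"
      using Pi unfolding P_def by blast
    from choice[OF this] obtain w where w: "\<And>c. c < bJ (Suc i) \<Longrightarrow> (\<forall>e<bQ (Suc i). w c e \<in> polys n) \<and>
        (\<forall>r<bQ i. ap (bJ i) phi (\<lambda>k. AJ i k c) r = ap (bQ (Suc i)) (AQ i) (w c) r)" by blast
    define phi' where "phi' r c = hcomp 1 (w c r)" for r c
    have e': "ent (Suc i) phi'" using w by (simp add: ent_def phi'_def)
    have rel: "ap (bJ i) phi (\<lambda>k. AJ i k c) r = ap (bQ (Suc i)) (AQ i) (\<lambda>k. phi' k c) r"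
      if r: "r < bQ i" and c: "c < bJ (Suc i)" for r c
    proof -
      have h: "homogeneous 2 (ap (bJ i) phi (\<lambda>k. AJ i k c) r)" if "r < bQ i" for r
        unfolding ap_def
      proof (rule homogeneous_sum)
        fix k assume "k \<in> {..<bJ i}"
        then have "linear_form (phi r k)" "linear_form (AJ i k c)" using e that AJ c by (auto simp: ent_def)
        from homogeneous_mult[OF this] show "homogeneous 2 (phi r k * AJ i k c)" by simp
      qed
      have "ap (bJ i) phi (\<lambda>k. AJ i k c) r = (\<Sum>k<bQ (Suc i). AQ i r k * hcomp (2 - 1) (w c k))"
        by (rule homogeneous_solution[of "bQ i" "ap (bJ i) phi (\<lambda>k. AJ i k c)" "AQ i" "w c" "bQ (Suc i)" 2 "\<lambda>_. 0" "\<lambda>_. 1" r])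
          (use w[OF c] h AQ r in \<open>simp_all add: ap_def[of "bQ (Suc i)"]\<close>)
      then show ?thesis by (simp add: ap_def[of "bQ (Suc i)"] phi'_def)
    qed
    have "\<exists>w. (\<forall>e<bQ (Suc (Suc i)). w e \<in> polys n) \<and>
        (\<forall>r<bQ (Suc i). ap (bJ (Suc i)) phi' (\<lambda>k. AJ (Suc i) k c) r = ap (bQ (Suc (Suc i))) (AQ (Suc i)) w r)"
      if c: "c < bJ (Suc (Suc i))" for c
    proof (rule fresolution_exact_ap[OF FQ, THEN iffD1])
      show "ap (bJ (Suc i)) phi' (\<lambda>k. AJ (Suc i) k c) r \<in> polys n" if "r < bQ (Suc i)" for r
        using e' that AJp c by (intro ap_polys) (auto simp: ent_def)
      have "ap (bQ (Suc i)) (AQ i) (ap (bJ (Suc i)) phi' (\<lambda>k. AJ (Suc i) k c)) r = 0" if r: "r < bQ i" for r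
      proof -
        have "ap (bQ (Suc i)) (AQ i) (ap (bJ (Suc i)) phi' (\<lambda>k. AJ (Suc i) k c)) r =
            ap (bJ i) phi (ap (bJ (Suc i)) (AJ i) (\<lambda>k. AJ (Suc i) k c)) r"
          by (rule ap_comp_eq) (simp add: rel[OF r])
        also have "\<dots> = ap (bJ i) phi (\<lambda>k. 0) r"
          by (rule ap_cong) (simp add: colJ c)
        finally show ?thesis by simp
      qed
      then show "\<forall>r<bQ i. ap (bQ (Suc i)) (AQ i) (ap (bJ (Suc i)) phi' (\<lambda>k. AJ (Suc i) k c)) r = 0" by blast
    qed
    then have "P (Suc i) phi'" using e' unfolding P_def by blast
    moreover have "R i phi phi'" using rel unfolding R_def by blast
    ultimately show ?thesis by blast
  qed
  obtain phi where phi: "\<And>i. P i (phi i) \<and> R i (phi i) (phi (Suc i))"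
    using dependent_nat_choice[of P R, OF base step] by blast
  show thesis
  proof (rule that[of phi])
    show "phi i r c \<in> polys n \<and> linear_form (phi i r c)" if "r < bQ i" "c < bJ i" for i r c
      using phi[of i] that unfolding P_def ent_def by blast
    show "gJ c = ap (bQ 0) (\<lambda>_. gQ) (\<lambda>r. phi 0 r c) 0" if "c < bJ 0" for c
      using phi[of 0] that unfolding P_def by blast
    show "ap (bJ i) (phi i) (\<lambda>k. AJ i k c) r = ap (bQ (Suc i)) (AQ i) (\<lambda>k. phi (Suc i) k c) r"
      if "r < bQ i" "c < bJ (Suc i)" for i r c
      using phi[of i] that unfolding R_def by blast
  qed
qed

lemma sum_three:
  fixes F :: "nat \<Rightarrow> 'a::comm_monoid_add"
  shows "(\<Sum>j<p + q + s. F j) = (\<Sum>j<p. F j) + (\<Sum>j<q. F (p + j)) + (\<Sum>j<s. F (p + q + j))"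
proof -
  have two: "(\<Sum>j<a + b. f j) = (\<Sum>j<a. f j) + (\<Sum>j<b. f (a + j))" for a b :: nat and f :: "nat \<Rightarrow> 'a"
    by (induction b) (simp_all add: add.assoc)
  show ?thesis by (simp add: two)
qed

lemma all_less_three:
  fixes p q s :: nat
  shows "(\<forall>r<p + q + s. P r) \<longleftrightarrow> (\<forall>r<p. P r) \<and> (\<forall>r<q. P (p + r)) \<and> (\<forall>r<s. P (p + q + r))"
proof (intro iffI conjI allI impI)
  fix r assume *: "(\<forall>r<p. P r) \<and> (\<forall>r<q. P (p + r)) \<and> (\<forall>r<s. P (p + q + r))" and r: "r < p + q + s"
  consider "r < p" | "r = p + (r - p)" "r - p < q" | "r = p + q + (r - p - q)" "r - p - q < s"
    using r by linarith
  then show "P r" using * by cases metis+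
qed auto

definition cat3 :: "nat \<Rightarrow> nat \<Rightarrow> (nat \<Rightarrow> 'a) \<Rightarrow> (nat \<Rightarrow> 'a) \<Rightarrow> (nat \<Rightarrow> 'a) \<Rightarrow> nat \<Rightarrow> 'a" where
  "cat3 p q a b e j = (if j < p then a j else if j < p + q then b (j - p) else e (j - p - q))"

lemma cat3_simps [simp]:
  "j < p \<Longrightarrow> cat3 p q a b e j = a j"
  "j < q \<Longrightarrow> cat3 p q a b e (p + j) = b j"
  "cat3 p q a b e (p + q + j) = e j"
  by (auto simp: cat3_def)

lemma ap_cat3:
  assumes "\<And>j. j < p \<Longrightarrow> A r j = A1 j" "\<And>j. j < q \<Longrightarrow> A r (p + j) = A2 j" "\<And>j. j < s \<Longrightarrow> A r (p + q + j) = A3 j"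
  shows "ap (p + q + s) A v r = (\<Sum>j<p. A1 j * v j) + (\<Sum>j<q. A2 j * v (p + j)) + (\<Sum>j<s. A3 j * v (p + q + j))"
  unfolding ap_def sum_three using assms by simp

text \<open>The map \<open>(a, b) \<mapsto> a + x * b\<close> from \<open>J \<oplus> Q\<close> onto
  \<open>I\<close> has a kernel isomorphic to \<open>J\<close>: if \<open>a + x * b = 0\<close> then
  \<open>x * b \<in> J\<close>, hence \<open>b \<in> J\<close> by \<open>colon\<close>. This gives a
  mapping cone with the modules \<open>J_i \<oplus> Q_i \<oplus> J_(i-1)\<close>. Multiplication by
  \<open>x\<close> and the lift of the inclusion both raise degrees by one, so all blocks stay
  linear.\<close>

theorem linres_cone:
  fixes J Q I :: "'k::field mpoly set"
  assumes J: "linres n (d + 1) J" and Q: "linres n d Q" and sub: "J \<subseteq> Q"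
    and x: "x \<in> polys n" "homogeneous 1 x" "x \<noteq> 0"
    and colon: "\<And>f. f \<in> polys n \<Longrightarrow> x * f \<in> J \<Longrightarrow> f \<in> J"
    and I: "\<And>f. f \<in> I \<longleftrightarrow> (\<exists>a\<in>J. \<exists>b\<in>Q. f = a + x * b)"
  shows "linres n (d + 1) I"
proof -
  obtain bJ gJ AJ where FJ: "fresolution n J bJ gJ AJ"
    and gJ': "\<forall>j<bJ 0. homogeneous (d + 1) (gJ j)" and AJ': "\<forall>i. \<forall>r<bJ i. \<forall>c<bJ (Suc i). linear_form (AJ i r c)"
    using J unfolding linres_def by (elim exE conjE)
  obtain bQ gQ AQ where FQ: "fresolution n Q bQ gQ AQ"
    and gQ': "\<forall>j<bQ 0. homogeneous d (gQ j)" and AQ': "\<forall>i. \<forall>r<bQ i. \<forall>c<bQ (Suc i). linear_form (AQ i r c)"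
    using Q unfolding linres_def by (elim exE conjE)
  have gJ: "homogeneous (d + 1) (gJ j)" if "j < bJ 0" for j using gJ' that by blast
  have gQ: "homogeneous d (gQ j)" if "j < bQ 0" for j using gQ' that by blast
  have AJ: "linear_form (AJ i r c)" if "r < bJ i" "c < bJ (Suc i)" for i r c using AJ' that by blast
  have AQ: "linear_form (AQ i r c)" if "r < bQ i" "c < bQ (Suc i)" for i r c using AQ' that by blast
  note AJp = fresolution_entries[OF FJ] and AQp = fresolution_entries[OF FQ]
  obtain phi where phi: "\<And>i r c. r < bQ i \<Longrightarrow> c < bJ i \<Longrightarrow> phi i r c \<in> polys n \<and> linear_form (phi i r c)"
    and phi0: "\<And>c. c < bJ 0 \<Longrightarrow> gJ c = ap (bQ 0) (\<lambda>_. gQ) (\<lambda>r. phi 0 r c) 0"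
    and phiS: "\<And>i r c. r < bQ i \<Longrightarrow> c < bJ (Suc i) \<Longrightarrow>
      ap (bJ i) (phi i) (\<lambda>k. AJ i k c) r = ap (bQ (Suc i)) (AQ i) (\<lambda>k. phi (Suc i) k c) r"
    by (rule chain_map_exists[OF FJ FQ sub gJ gQ AJ AQ]) blast+
  have comm0: "ap (bQ 0) (\<lambda>_. gQ) (ap (bJ 0) (phi 0) u) 0 = ap (bJ 0) (\<lambda>_. gJ) u 0" for u
    unfolding ap_ap by (unfold ap_def[of "bJ 0"], rule sum.cong) (use phi0 in simp_all)
  have commS: "ap (bJ i) (phi i) (ap (bJ (Suc i)) (AJ i) u) r = ap (bQ (Suc i)) (AQ i) (ap (bJ (Suc i)) (phi (Suc i)) u) r"
    if "r < bQ i" for i r u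
    by (rule ap_comp_eq) (rule phiS[OF that])
  \<comment> \<open>The rank of the block \<open>J_(i-1)\<close>, which is absent for
    \<open>i = 0\<close>; this makes the index \<open>i - 1\<close> in the matrix below
    harmless.\<close>
  define s where "s i = (case i of 0 \<Rightarrow> 0 | Suc k \<Rightarrow> bJ k)" for i
  define b where "b i = bJ i + bQ i + s i" for i
  define g where "g = cat3 (bJ 0) (bQ 0) gJ (\<lambda>j. x * gQ j) (\<lambda>_. 0)"
  \<comment> \<open>The third block of columns is \<open>(x, - phi, - AJ)\<close>, from the map
    \<open>e \<mapsto> (x * e, - phi e)\<close> whose cone is taken.\<close>
  define A where "A i r c = cat3 (bJ i) (bQ i)
      (\<lambda>r. cat3 (bJ (Suc i)) (bQ (Suc i)) (AJ i r) (\<lambda>_. 0) (\<lambda>c. if c = r then x else 0) c)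
      (\<lambda>r. cat3 (bJ (Suc i)) (bQ (Suc i)) (\<lambda>_. 0) (AQ i r) (\<lambda>c. - phi i r c) c)
      (\<lambda>r. cat3 (bJ (Suc i)) (bQ (Suc i)) (\<lambda>_. 0) (\<lambda>_. 0) (\<lambda>c. - AJ (i - 1) r c) c) r" for i r c
  have sS [simp]: "s (Suc i) = bJ i" "s 0 = 0" for i by (simp_all add: s_def)
  have rowJ: "ap (b (Suc i)) (A i) v r = ap (bJ (Suc i)) (AJ i) v r + x * v (bJ (Suc i) + bQ (Suc i) + r)"
    if r: "r < bJ i" for i v r
  proof -
    have "ap (b (Suc i)) (A i) v r = (\<Sum>j<bJ (Suc i). AJ i r j * v j) + (\<Sum>j<bQ (Suc i). 0 * v (bJ (Suc i) + j)) +
        (\<Sum>j<bJ i. (if j = r then x else 0) * v (bJ (Suc i) + bQ (Suc i) + j))"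
      unfolding b_def sS by (rule ap_cat3) (use r in \<open>simp_all add: A_def\<close>)
    also have "(\<Sum>j<bJ i. (if j = r then x else 0) * v (bJ (Suc i) + bQ (Suc i) + j)) =
        (\<Sum>j<bJ i. if j = r then x * v (bJ (Suc i) + bQ (Suc i) + j) else 0)"
      by (rule sum.cong) auto
    finally show ?thesis using r by (simp add: ap_def)
  qed
  have rowQ: "ap (b (Suc i)) (A i) v (bJ i + r) = ap (bQ (Suc i)) (AQ i) (\<lambda>j. v (bJ (Suc i) + j)) r
      - ap (bJ i) (phi i) (\<lambda>j. v (bJ (Suc i) + bQ (Suc i) + j)) r"
    if r: "r < bQ i" for i v r
  proof -
    have "ap (b (Suc i)) (A i) v (bJ i + r) = (\<Sum>j<bJ (Suc i). 0 * v j) + (\<Sum>j<bQ (Suc i). AQ i r j * v (bJ (Suc i) + j)) +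
        (\<Sum>j<bJ i. - phi i r j * v (bJ (Suc i) + bQ (Suc i) + j))"
      unfolding b_def sS by (rule ap_cat3) (use r in \<open>simp_all add: A_def\<close>)
    then show ?thesis by (simp add: ap_def sum_negf)
  qed
  have row3: "ap (b (Suc (Suc i))) (A (Suc i)) v (bJ (Suc i) + bQ (Suc i) + r) =
      - ap (bJ (Suc i)) (AJ i) (\<lambda>j. v (bJ (Suc (Suc i)) + bQ (Suc (Suc i)) + j)) r" for i v r
  proof -
    have "ap (b (Suc (Suc i))) (A (Suc i)) v (bJ (Suc i) + bQ (Suc i) + r) =
        (\<Sum>j<bJ (Suc (Suc i)). 0 * v j) + (\<Sum>j<bQ (Suc (Suc i)). 0 * v (bJ (Suc (Suc i)) + j)) +
        (\<Sum>j<bJ (Suc i). - AJ i r j * v (bJ (Suc (Suc i)) + bQ (Suc (Suc i)) + j))"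
      unfolding b_def sS by (rule ap_cat3) (simp_all add: A_def)
    then show ?thesis by (simp add: ap_def sum_negf)
  qed
  have rowg: "ap (b 0) (\<lambda>_. g) v 0 = ap (bJ 0) (\<lambda>_. gJ) v 0 + x * ap (bQ 0) (\<lambda>_. gQ) (\<lambda>j. v (bJ 0 + j)) 0" for v
  proof -
    have "ap (b 0) (\<lambda>_. g) v 0 = (\<Sum>j<bJ 0. gJ j * v j) + (\<Sum>j<bQ 0. (x * gQ j) * v (bJ 0 + j)) + (\<Sum>j<0. 0 * v (bJ 0 + bQ 0 + j))"
      unfolding b_def sS by (rule ap_cat3) (simp_all add: g_def)
    then show ?thesis by (simp add: ap_def sum_distrib_left mult.assoc)
  qed
  have gp: "g j \<in> polys n \<and> homogeneous (d + 1) (g j)" if "j < b 0" for j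
  proof -
    have "\<forall>j<bJ 0 + bQ 0 + 0. g j \<in> polys n \<and> homogeneous (d + 1) (g j)"
      unfolding all_less_three
    proof (intro conjI allI impI)
      fix j assume j: "j < bQ 0"
      show "g (bJ 0 + j) \<in> polys n" using fresolution_gens[OF FQ j] x j by (simp add: g_def)
      show "homogeneous (d + 1) (g (bJ 0 + j))"
        using homogeneous_mult[OF x(2) gQ[OF j]] j by (simp add: g_def add.commute[of d])
    qed (use fresolution_gens[OF FJ] gJ in \<open>simp_all add: g_def\<close>)
    then show ?thesis using that by (simp add: b_def)
  qed
  have Ap: "\<forall>r<b i. \<forall>c<b (Suc i). A i r c \<in> polys n \<and> linear_form (A i r c)" for i
  proof -
    have neg: "- f \<in> polys n \<and> linear_form (- f)" if "f \<in> polys n \<and> linear_form f" for f :: "'k mpoly"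
      using that by (simp add: homogeneous_uminus)
    have s3: "- AJ (i - 1) r c \<in> polys n \<and> linear_form (- AJ (i - 1) r c)" if "r < s i" "c < bJ i" for r c
      using that AJp[of _ "i - 1"] AJ[of _ "i - 1"] by (cases i) (simp_all add: neg)
    show ?thesis
      unfolding b_def all_less_three sS
      by (intro conjI allI impI) (use AJp AQp AJ AQ phi x s3 neg in \<open>simp_all add: A_def\<close>)
  qed
  \<comment> \<open>The third component of a kernel vector is a cycle, hence a boundary, in the
    resolution of \<open>J\<close>. For \<open>i > 0\<close> the third block of rows says so. For
    \<open>i = 0\<close> that block is missing; applying \<open>gJ\<close> to the first block of
    rows gives \<open>x\<close> times the value of \<open>gJ\<close> on the component, and
    \<open>x \<noteq> 0\<close> can be cancelled.\<close>
  have kerJ: "\<exists>f. (\<forall>c<bJ (Suc i). f c \<in> polys n) \<and> (\<forall>k<bJ i. v (bJ (Suc i) + bQ (Suc i) + k) = ap (bJ (Suc i)) (AJ i) f k)"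
    if vp: "\<And>j. j < b (Suc i) \<Longrightarrow> v j \<in> polys n" and K: "\<forall>r<b i. ap (b (Suc i)) (A i) v r = 0" for i v
  proof -
    let ?e = "\<lambda>k. v (bJ (Suc i) + bQ (Suc i) + k)"
    have ep: "?e k \<in> polys n" if "k < bJ i" for k using vp that by (simp add: b_def)
    have K1: "ap (bJ (Suc i)) (AJ i) v r + x * ?e r = 0" if "r < bJ i" for r
      using K rowJ[OF that, of v] that by (simp add: b_def)
    show ?thesis
    proof (cases i)
      case 0
      have vp': "v j \<in> polys n" if "j < bJ (Suc 0)" for j using vp[of j] that 0 by (simp add: b_def)
      have "0 = ap (bJ 0) (\<lambda>_. gJ) (ap (bJ (Suc 0)) (AJ 0) v) 0"
        using fresolution_ap_zero0[OF FJ vp'] by simp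
      also have "\<dots> = ap (bJ 0) (\<lambda>_. gJ) (\<lambda>k. - x * ?e k) 0"
        by (rule ap_cong) (use K1 0 in \<open>simp add: eq_neg_iff_add_eq_0\<close>)
      also have "\<dots> = - x * ap (bJ 0) (\<lambda>_. gJ) ?e 0" by (rule ap_mult)
      finally have "ap (bJ 0) (\<lambda>_. gJ) ?e 0 = 0" using x(3) by simp
      then show ?thesis using fresolution_exact0_ap[OF FJ, of ?e] ep unfolding 0 by simp
    next
      case (Suc i')
      have "ap (bJ i) (AJ i') ?e r = 0" if "r < bJ i'" for r
        using K row3[of i' v r] that unfolding Suc by (simp add: b_def)
      then show ?thesis using fresolution_exact_ap[OF FJ, of i' ?e] ep unfolding Suc by simp
    qed
  qed
  have F: "fresolution n I b g A"
  proof (rule fresolutionI_ap)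
    show "g j \<in> polys n" if "j < b 0" for j using gp[OF that] ..
    show "A i r c \<in> polys n" if "r < b i" "c < b (Suc i)" for i r c using Ap that by blast
    show "f \<in> I \<longleftrightarrow> (\<exists>v. (\<forall>j<b 0. v j \<in> polys n) \<and> f = ap (b 0) (\<lambda>_. g) v 0)" for f
    proof
      assume "f \<in> I"
      then obtain f1 f2 where "f1 \<in> J" "f2 \<in> Q" and f: "f = f1 + x * f2" unfolding I by blast
      then obtain u w where u: "\<forall>j<bJ 0. u j \<in> polys n" "f1 = ap (bJ 0) (\<lambda>_. gJ) u 0"
        and w: "\<forall>j<bQ 0. w j \<in> polys n" "f2 = ap (bQ 0) (\<lambda>_. gQ) w 0"
        unfolding fresolution_ideal_ap[OF FJ] fresolution_ideal_ap[OF FQ] by blast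
      let ?v = "cat3 (bJ 0) (bQ 0) u w (\<lambda>_. 0)"
      have "ap (bJ 0) (\<lambda>_. gJ) ?v 0 = f1" unfolding u(2) by (rule ap_cong) simp
      moreover have "ap (bQ 0) (\<lambda>_. gQ) (\<lambda>j. ?v (bJ 0 + j)) 0 = f2" unfolding w(2) by (rule ap_cong) simp
      moreover have "\<forall>j<b 0. ?v j \<in> polys n" unfolding b_def all_less_three using u w by simp
      ultimately show "\<exists>v. (\<forall>j<b 0. v j \<in> polys n) \<and> f = ap (b 0) (\<lambda>_. g) v 0"
        by (intro exI[of _ ?v]) (simp add: rowg f)
    next
      assume "\<exists>v. (\<forall>j<b 0. v j \<in> polys n) \<and> f = ap (b 0) (\<lambda>_. g) v 0"
      then obtain v where v: "\<forall>j<b 0. v j \<in> polys n" and f: "f = ap (b 0) (\<lambda>_. g) v 0" by blast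
      have "ap (bJ 0) (\<lambda>_. gJ) v 0 \<in> J" unfolding fresolution_ideal_ap[OF FJ]
        using v by (intro exI[of _ v]) (simp add: b_def)
      moreover have "ap (bQ 0) (\<lambda>_. gQ) (\<lambda>j. v (bJ 0 + j)) 0 \<in> Q" unfolding fresolution_ideal_ap[OF FQ]
        using v by (intro exI[of _ "\<lambda>j. v (bJ 0 + j)"]) (simp add: b_def)
      ultimately show "f \<in> I" unfolding I f rowg by blast
    qed
  next
    fix v :: "nat \<Rightarrow> 'k mpoly" assume vp: "\<And>j. j < b 0 \<Longrightarrow> v j \<in> polys n"
    have aJ: "v j \<in> polys n" if "j < bJ 0" for j using vp that by (simp add: b_def)
    have bQp: "v (bJ 0 + j) \<in> polys n" if "j < bQ 0" for j using vp that by (simp add: b_def)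
    show "ap (b 0) (\<lambda>_. g) v 0 = 0 \<longleftrightarrow>
      (\<exists>w. (\<forall>c<b (Suc 0). w c \<in> polys n) \<and> (\<forall>r<b 0. v r = ap (b (Suc 0)) (A 0) w r))"
    proof
      let ?a = "ap (bJ 0) (\<lambda>_. gJ) v 0" and ?q = "ap (bQ 0) (\<lambda>_. gQ) (\<lambda>j. v (bJ 0 + j)) 0"
      assume "ap (b 0) (\<lambda>_. g) v 0 = 0"
      then have 0: "?a + x * ?q = 0" by (simp add: rowg)
      have qp: "?q \<in> polys n" by (rule ap_polys) (use fresolution_gens[OF FQ] bQp in auto)
      have xq: "x * ?q = - ?a" using 0 by (simp add: eq_neg_iff_add_eq_0 add.commute)
      have "x * ?q = ap (bJ 0) (\<lambda>_. gJ) (\<lambda>k. - v k) 0" unfolding xq ap_uminus ..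
      moreover have "\<forall>j<bJ 0. - v j \<in> polys n" using aJ by simp
      ultimately have "x * ?q \<in> J" unfolding fresolution_ideal_ap[OF FJ]
        by (intro exI[of _ "\<lambda>k. - v k"] conjI)
      from colon[OF qp this] obtain e where ep: "\<forall>j<bJ 0. e j \<in> polys n" and e: "?q = ap (bJ 0) (\<lambda>_. gJ) e 0"
        unfolding fresolution_ideal_ap[OF FJ] by blast
      have pp: "ap (bJ 0) (phi 0) e r \<in> polys n" if "r < bQ 0" for r
        by (rule ap_polys) (use phi that ep in auto)
      have "ap (bQ 0) (\<lambda>_. gQ) (\<lambda>j. v (bJ 0 + j) - ap (bJ 0) (phi 0) e j) 0 = 0"
        by (simp add: ap_diff comm0 e[symmetric])
      then obtain b' where b'p: "\<forall>c<bQ (Suc 0). b' c \<in> polys n"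
        and b': "\<forall>r<bQ 0. v (bJ 0 + r) - ap (bJ 0) (phi 0) e r = ap (bQ (Suc 0)) (AQ 0) b' r"
        using fresolution_exact0_ap[OF FQ, of "\<lambda>j. v (bJ 0 + j) - ap (bJ 0) (phi 0) e j"] bQp pp by auto
      have "ap (bJ 0) (\<lambda>_. gJ) (\<lambda>k. v k + x * e k) 0 = 0"
        using 0 by (simp add: ap_add ap_mult e)
      then obtain a' where a'p: "\<forall>c<bJ (Suc 0). a' c \<in> polys n"
        and a': "\<forall>r<bJ 0. v r + x * e r = ap (bJ (Suc 0)) (AJ 0) a' r"
        using fresolution_exact0_ap[OF FJ, of "\<lambda>k. v k + x * e k"] aJ ep x by auto
      let ?w = "cat3 (bJ (Suc 0)) (bQ (Suc 0)) a' b' (\<lambda>k. - e k)"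
      have "\<forall>c<b (Suc 0). ?w c \<in> polys n" unfolding b_def all_less_three using a'p b'p ep by simp
      moreover have "\<forall>r<b 0. v r = ap (b (Suc 0)) (A 0) ?w r"
      proof -
        have 1: "ap (bJ (Suc 0)) (AJ 0) ?w r = ap (bJ (Suc 0)) (AJ 0) a' r" for r by (rule ap_cong) simp
        have 2: "ap (bQ (Suc 0)) (AQ 0) (\<lambda>j. ?w (bJ (Suc 0) + j)) r = ap (bQ (Suc 0)) (AQ 0) b' r" for r
          by (rule ap_cong) simp
        show ?thesis unfolding b_def[of 0] all_less_three
          using a' b' by (simp add: rowJ rowQ 1 2 ap_uminus eq_diff_eq diff_eq_eq[symmetric])
      qed
      ultimately show "\<exists>w. (\<forall>c<b (Suc 0). w c \<in> polys n) \<and> (\<forall>r<b 0. v r = ap (b (Suc 0)) (A 0) w r)" by blast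
    next
      assume "\<exists>w. (\<forall>c<b (Suc 0). w c \<in> polys n) \<and> (\<forall>r<b 0. v r = ap (b (Suc 0)) (A 0) w r)"
      then obtain w where wp: "\<forall>c<b (Suc 0). w c \<in> polys n" and w: "\<forall>r<b 0. v r = ap (b (Suc 0)) (A 0) w r" by blast
      let ?e = "\<lambda>k. w (bJ (Suc 0) + bQ (Suc 0) + k)" and ?q = "\<lambda>j. w (bJ (Suc 0) + j)"
      have wa: "w c \<in> polys n" if "c < bJ (Suc 0)" for c using wp that by (simp add: b_def)
      have wq: "?q c \<in> polys n" if "c < bQ (Suc 0)" for c using wp that by (simp add: b_def)
      have "ap (bJ 0) (\<lambda>_. gJ) v 0 = ap (bJ 0) (\<lambda>_. gJ) (\<lambda>r. ap (bJ (Suc 0)) (AJ 0) w r + x * ?e r) 0"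
        by (rule ap_cong) (use w in \<open>simp add: b_def rowJ[symmetric]\<close>)
      also have "\<dots> = x * ap (bJ 0) (\<lambda>_. gJ) ?e 0"
        using fresolution_ap_zero0[OF FJ, of w] wa by (simp add: ap_add ap_mult)
      finally have 1: "ap (bJ 0) (\<lambda>_. gJ) v 0 = x * ap (bJ 0) (\<lambda>_. gJ) ?e 0" .
      have "ap (bQ 0) (\<lambda>_. gQ) (\<lambda>j. v (bJ 0 + j)) 0 = ap (bQ 0) (\<lambda>_. gQ) (\<lambda>r. ap (bQ (Suc 0)) (AQ 0) ?q r - ap (bJ 0) (phi 0) ?e r) 0"
        by (rule ap_cong) (use w in \<open>simp add: b_def rowQ[symmetric]\<close>)
      also have "\<dots> = - ap (bJ 0) (\<lambda>_. gJ) ?e 0"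
        using fresolution_ap_zero0[OF FQ, of ?q] wq by (simp add: ap_diff comm0)
      finally show "ap (b 0) (\<lambda>_. g) v 0 = 0" by (simp add: rowg 1)
    qed
  next
    fix i and v :: "nat \<Rightarrow> 'k mpoly" assume vp: "\<And>j. j < b (Suc i) \<Longrightarrow> v j \<in> polys n"
    have aJ: "v j \<in> polys n" if "j < bJ (Suc i)" for j using vp that by (simp add: b_def)
    have bQp: "v (bJ (Suc i) + j) \<in> polys n" if "j < bQ (Suc i)" for j using vp that by (simp add: b_def)
    let ?e = "\<lambda>k. v (bJ (Suc i) + bQ (Suc i) + k)"
    show "(\<forall>r<b i. ap (b (Suc i)) (A i) v r = 0) \<longleftrightarrow>
      (\<exists>w. (\<forall>c<b (Suc (Suc i)). w c \<in> polys n) \<and> (\<forall>r<b (Suc i). v r = ap (b (Suc (Suc i))) (A (Suc i)) w r))"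
    proof
      assume K: "\<forall>r<b i. ap (b (Suc i)) (A i) v r = 0"
      obtain f where fp: "\<forall>c<bJ (Suc i). f c \<in> polys n" and f: "\<forall>k<bJ i. ?e k = ap (bJ (Suc i)) (AJ i) f k"
        using kerJ[OF vp K] by blast
      have K1: "ap (bJ (Suc i)) (AJ i) v r + x * ?e r = 0" if "r < bJ i" for r
        using K rowJ[OF that, of v] that by (simp add: b_def)
      have K2: "ap (bQ (Suc i)) (AQ i) (\<lambda>j. v (bJ (Suc i) + j)) r - ap (bJ i) (phi i) ?e r = 0" if "r < bQ i" for r
        using K rowQ[OF that, of v] that by (simp add: b_def)
      have "ap (bJ (Suc i)) (AJ i) (\<lambda>k. v k + x * f k) r = 0" if "r < bJ i" for r
        using K1[OF that] f that by (simp add: ap_add ap_mult)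
      then obtain a' where a'p: "\<forall>c<bJ (Suc (Suc i)). a' c \<in> polys n"
        and a': "\<forall>r<bJ (Suc i). v r + x * f r = ap (bJ (Suc (Suc i))) (AJ (Suc i)) a' r"
        using fresolution_exact_ap[OF FJ, of i "\<lambda>k. v k + x * f k"] aJ fp x by auto
      have pp: "ap (bJ (Suc i)) (phi (Suc i)) f r \<in> polys n" if "r < bQ (Suc i)" for r
        by (rule ap_polys) (use phi that fp in auto)
      have "ap (bQ (Suc i)) (AQ i) (\<lambda>j. v (bJ (Suc i) + j) - ap (bJ (Suc i)) (phi (Suc i)) f j) r = 0" if r: "r < bQ i" for r
      proof -
        have "ap (bJ i) (phi i) ?e r = ap (bJ i) (phi i) (ap (bJ (Suc i)) (AJ i) f) r"
          by (rule ap_cong) (use f in simp)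
        then show ?thesis using K2[OF r] by (simp add: ap_diff commS[OF r])
      qed
      then obtain b' where b'p: "\<forall>c<bQ (Suc (Suc i)). b' c \<in> polys n"
        and b': "\<forall>r<bQ (Suc i). v (bJ (Suc i) + r) - ap (bJ (Suc i)) (phi (Suc i)) f r = ap (bQ (Suc (Suc i))) (AQ (Suc i)) b' r"
        using fresolution_exact_ap[OF FQ, of i "\<lambda>j. v (bJ (Suc i) + j) - ap (bJ (Suc i)) (phi (Suc i)) f j"] bQp pp by auto
      let ?w = "cat3 (bJ (Suc (Suc i))) (bQ (Suc (Suc i))) a' b' (\<lambda>k. - f k)"
      have "\<forall>c<b (Suc (Suc i)). ?w c \<in> polys n" unfolding b_def[of "Suc (Suc i)"] all_less_three using a'p b'p fp by simp
      moreover have "\<forall>r<b (Suc i). v r = ap (b (Suc (Suc i))) (A (Suc i)) ?w r"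
      proof -
        have 1: "ap (bJ (Suc (Suc i))) (AJ (Suc i)) ?w r = ap (bJ (Suc (Suc i))) (AJ (Suc i)) a' r" for r by (rule ap_cong) simp
        have 2: "ap (bQ (Suc (Suc i))) (AQ (Suc i)) (\<lambda>j. ?w (bJ (Suc (Suc i)) + j)) r = ap (bQ (Suc (Suc i))) (AQ (Suc i)) b' r" for r
          by (rule ap_cong) simp
        show ?thesis unfolding b_def[of "Suc i"] all_less_three
          using a' b' f by (simp add: rowJ rowQ row3 1 2 ap_uminus eq_diff_eq diff_eq_eq[symmetric])
      qed
      ultimately show "\<exists>w. (\<forall>c<b (Suc (Suc i)). w c \<in> polys n) \<and> (\<forall>r<b (Suc i). v r = ap (b (Suc (Suc i))) (A (Suc i)) w r)" by blast
    next
      assume "\<exists>w. (\<forall>c<b (Suc (Suc i)). w c \<in> polys n) \<and> (\<forall>r<b (Suc i). v r = ap (b (Suc (Suc i))) (A (Suc i)) w r)"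
      then obtain w where wp: "\<forall>c<b (Suc (Suc i)). w c \<in> polys n"
        and w: "\<forall>r<b (Suc i). v r = ap (b (Suc (Suc i))) (A (Suc i)) w r" by blast
      let ?f = "\<lambda>k. w (bJ (Suc (Suc i)) + bQ (Suc (Suc i)) + k)" and ?q = "\<lambda>j. w (bJ (Suc (Suc i)) + j)"
      have wa: "w c \<in> polys n" if "c < bJ (Suc (Suc i))" for c using wp that by (simp add: b_def)
      have wq: "?q c \<in> polys n" if "c < bQ (Suc (Suc i))" for c using wp that by (simp add: b_def)
      have wf: "?f c \<in> polys n" if "c < bJ (Suc i)" for c using wp that by (simp add: b_def)
      have v1: "v r = ap (bJ (Suc (Suc i))) (AJ (Suc i)) w r + x * ?f r" if "r < bJ (Suc i)" for r
        using w that by (simp add: b_def rowJ[symmetric])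
      have v2: "v (bJ (Suc i) + r) = ap (bQ (Suc (Suc i))) (AQ (Suc i)) ?q r - ap (bJ (Suc i)) (phi (Suc i)) ?f r"
        if "r < bQ (Suc i)" for r
        using w that by (simp add: b_def rowQ[symmetric])
      have v3: "?e r = - ap (bJ (Suc i)) (AJ i) ?f r" if "r < bJ i" for r
        using w that by (simp add: b_def row3[symmetric])
      have "\<forall>r<bJ i. ap (b (Suc i)) (A i) v r = 0"
      proof (intro allI impI)
        fix r assume r: "r < bJ i"
        have "ap (bJ (Suc i)) (AJ i) v r = ap (bJ (Suc i)) (AJ i) (\<lambda>r. ap (bJ (Suc (Suc i))) (AJ (Suc i)) w r + x * ?f r) r"
          by (rule ap_cong) (rule v1)
        also have "\<dots> = x * ap (bJ (Suc i)) (AJ i) ?f r"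
          using fresolution_ap_zero[OF FJ, of i w, OF _ r] wa by (simp add: ap_add ap_mult)
        finally show "ap (b (Suc i)) (A i) v r = 0" using r by (simp add: rowJ v3)
      qed
      moreover have "\<forall>r<bQ i. ap (b (Suc i)) (A i) v (bJ i + r) = 0"
      proof (intro allI impI)
        fix r assume r: "r < bQ i"
        have "ap (bQ (Suc i)) (AQ i) (\<lambda>j. v (bJ (Suc i) + j)) r =
            ap (bQ (Suc i)) (AQ i) (\<lambda>r. ap (bQ (Suc (Suc i))) (AQ (Suc i)) ?q r - ap (bJ (Suc i)) (phi (Suc i)) ?f r) r"
          by (rule ap_cong) (rule v2)
        also have "\<dots> = - ap (bJ i) (phi i) (ap (bJ (Suc i)) (AJ i) ?f) r"
          using fresolution_ap_zero[OF FQ, of i ?q, OF _ r] wq by (simp add: ap_diff commS[OF r])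
        also have "\<dots> = ap (bJ i) (phi i) ?e r"
          unfolding ap_uminus[of "bJ i" "phi i", symmetric] by (rule ap_cong) (simp add: v3)
        finally show "ap (b (Suc i)) (A i) v (bJ i + r) = 0" using r by (simp add: rowQ)
      qed
      moreover have "\<forall>r<s i. ap (b (Suc i)) (A i) v (bJ i + bQ i + r) = 0"
      proof (cases i)
        case (Suc i')
        have "ap (bJ (Suc i')) (AJ i') ?e r = 0" if r: "r < bJ i'" for r
        proof -
          have "ap (bJ (Suc i')) (AJ i') ?e r = ap (bJ (Suc i')) (AJ i') (\<lambda>k. - ap (bJ (Suc i)) (AJ i) ?f k) r"
            by (rule ap_cong) (use v3 Suc in simp)
          then show ?thesis
            unfolding ap_uminus using fresolution_ap_zero[OF FJ, of i' ?f, OF _ r] wf Suc by simp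
        qed
        then show ?thesis unfolding Suc by (simp add: row3)
      qed simp
      ultimately show "\<forall>r<b i. ap (b (Suc i)) (A i) v r = 0"
        unfolding b_def[of i] all_less_three by blast
    qed
  qed
  show ?thesis unfolding linres_def using F gp Ap by blast
qed

section \<open>Cones of monomial ideals and simplicial vertices\<close>

lemma mon_ideal_cone:
  fixes f :: "'k::field mpoly"
  assumes M: "up_closed M" and M': "up_closed M'" and v: "v \<in> {1..n}"
  shows "f \<in> mon_ideal n (M \<union> {mvar v + k |k. k \<in> M'}) \<longleftrightarrow>
    (\<exists>a\<in>mon_ideal n M. \<exists>b\<in>mon_ideal n M'. f = a + indet v * b)"
proof
  assume f: "f \<in> mon_ideal n (M \<union> {mvar v + k |k. k \<in> M'})"
  \<comment> \<open>The terms of \<open>f\<close> in \<open>M\<close> form \<open>a\<close>; all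
    others are divisible by \<open>x_v\<close> and, after division, form \<open>b\<close>.\<close>
  define X where "X = keys f \<inter> M"
  define Y where "Y = keys f - M"
  define a where "a = (\<Sum>m\<in>X. Poly_Mapping.single m (lookup f m))"
  define b where "b = (\<Sum>m\<in>Y. Poly_Mapping.single (m - mvar v) (lookup f m))"
  have single_mem: "Poly_Mapping.single m c \<in> mon_ideal n U" if "m \<in> U" "keys m \<subseteq> {1..n}" for m U and c :: 'k
    using that by (auto simp: mon_ideal_def polys_single)
  have keysf: "keys m \<subseteq> {1..n}" if "m \<in> keys f" for m using f that by (auto simp: mon_ideal_def polys_def)
  have Y: "m - mvar v \<in> M'" "m = mvar v + (m - mvar v)" if "m \<in> Y" for m
    using f that by (auto simp: Y_def mon_ideal_def)
  have "a \<in> mon_ideal n M"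
    unfolding a_def by (intro mon_ideal_sum single_mem) (use keysf in \<open>auto simp: X_def\<close>)
  moreover have "b \<in> mon_ideal n M'"
    unfolding b_def
  proof (intro mon_ideal_sum single_mem Y(1))
    fix m assume "m \<in> Y"
    then have "keys m \<subseteq> {1..n}" using keysf by (auto simp: Y_def)
    then show "keys (m - mvar v) \<subseteq> {1..n}" using keys_minus_subset by blast
  qed
  moreover have "f = a + indet v * b"
  proof -
    have "f = (\<Sum>m\<in>X \<union> Y. Poly_Mapping.single m (lookup f m))"
      by (subst mpoly_sum_singles) (rule sum.cong, auto simp: X_def Y_def)
    also have "\<dots> = a + (\<Sum>m\<in>Y. Poly_Mapping.single m (lookup f m))"
      unfolding a_def by (rule sum.union_disjoint) (auto simp: X_def Y_def)
    also have "(\<Sum>m\<in>Y. Poly_Mapping.single m (lookup f m)) = indet v * b"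
      unfolding b_def sum_distrib_left
    proof (rule sum.cong)
      fix m assume m: "m \<in> Y"
      have "indet v * Poly_Mapping.single (m - mvar v) (lookup f m) =
          Poly_Mapping.single (mvar v + (m - mvar v)) (lookup f m)"
        by (simp add: indet_def mvar_def mult_single)
      then show "Poly_Mapping.single m (lookup f m) = indet v * Poly_Mapping.single (m - mvar v) (lookup f m)"
        unfolding Y(2)[OF m, symmetric] ..
    qed simp
    finally show ?thesis .
  qed
  ultimately show "\<exists>a\<in>mon_ideal n M. \<exists>b\<in>mon_ideal n M'. f = a + indet v * b" by blast
next
  assume "\<exists>a\<in>mon_ideal n M. \<exists>b\<in>mon_ideal n M'. f = a + indet v * b"
  then obtain a b where ab: "a \<in> mon_ideal n M" "b \<in> mon_ideal n M'" "f = a + indet v * b" by blast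
  have "indet v * b \<in> polys n" using ab v by (simp add: mon_ideal_def)
  moreover have "keys (indet v * b) \<subseteq> {mvar v + k |k. k \<in> M'}"
    using keys_mult[of "indet v" b] ab(2) by (force simp: mon_ideal_def indet_def mvar_def)
  ultimately have "indet v * b \<in> mon_ideal n (M \<union> {mvar v + k |k. k \<in> M'})" by (auto simp: mon_ideal_def)
  moreover have "a \<in> mon_ideal n (M \<union> {mvar v + k |k. k \<in> M'})" using ab(1) by (auto simp: mon_ideal_def)
  ultimately show "f \<in> mon_ideal n (M \<union> {mvar v + k |k. k \<in> M'})" unfolding ab(3) by (rule mon_ideal_add[rotated])
qed

lemma mon_ideal_colon:
  fixes f :: "'k::field mpoly"
  assumes "f \<in> polys n" "indet v * f \<in> mon_ideal n M" "\<And>k. mvar v + k \<in> M \<Longrightarrow> k \<in> M"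
  shows "f \<in> mon_ideal n M"
proof -
  have "k \<in> M" if "k \<in> keys f" for k
  proof -
    have "lookup (indet v * f) (mvar v + k) = lookup f k"
      unfolding indet_def mvar_def by (subst lookup_single_mult) simp
    then have "mvar v + k \<in> keys (indet v * f)" using that by (simp add: in_keys_iff)
    then show ?thesis using assms(2,3) by (auto simp: mon_ideal_def)
  qed
  then show ?thesis using assms(1) by (auto simp: mon_ideal_def)
qed

lemma linres_zero: "linres n d {0}"
  unfolding linres_def
  by (rule exI[of _ "\<lambda>_. 0"]) (simp add: fresolution_def)

lemma linres_unit: "linres n 0 (polys n :: 'k::field mpoly set)"
proof -
  let ?b = "\<lambda>i::nat. if i = 0 then 1 else 0 :: nat"
  have "fresolution n (polys n :: 'k mpoly set) ?b (\<lambda>_. 1) (\<lambda>_ _ _. 0)"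
    unfolding fresolution_def
  proof (intro conjI allI impI)
    fix f :: "'k mpoly"
    show "f \<in> polys n \<longleftrightarrow> (\<exists>v. (\<forall>j<?b 0. v j \<in> polys n) \<and> f = (\<Sum>j<?b 0. 1 * v j))"
      by (auto intro: exI[of _ "\<lambda>_. f"])
  qed auto
  then show ?thesis unfolding linres_def by (intro exI[of _ ?b] exI conjI) auto
qed

text \<open>\<open>linres_cone\<close> for a variable, with all conditions read off the sets of
  monomials; \<open>colon\<close> expresses that \<open>x_v\<close> is a nonzerodivisor modulo the
  ideal of \<open>M\<close>.\<close>

lemma linres_mon_ideal_cone:
  assumes J: "linres n (d + 1) (mon_ideal n M :: 'k::field mpoly set)" and Q: "linres n d (mon_ideal n M' :: 'k mpoly set)"
    and up: "up_closed M" "up_closed M'" and v: "v \<in> {1..n}" and sub: "M \<subseteq> M'"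
    and colon: "\<And>k. mvar v + k \<in> M \<Longrightarrow> k \<in> M"
  shows "linres n (d + 1) (mon_ideal n (M \<union> {mvar v + k |k. k \<in> M'}) :: 'k mpoly set)"
proof (rule linres_cone[OF J Q, of "indet v"])
  show "mon_ideal n M \<subseteq> (mon_ideal n M' :: 'k mpoly set)" using sub by (auto simp: mon_ideal_def)
  show "indet v \<in> polys n" using v by simp
  show "indet v \<noteq> (0 :: 'k mpoly)" by (metis indet_def lookup_single_eq lookup_zero zero_neq_one)
  show "f \<in> mon_ideal n M" if "f \<in> polys n" "indet v * f \<in> mon_ideal n M" for f :: "'k mpoly"
    by (rule mon_ideal_colon[OF that]) (rule colon)
qed (simp_all only: homogeneous_indet mon_ideal_cone[OF up v])

definition var_monomials :: "nat set \<Rightarrow> monomial set" where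
  "var_monomials U = {m. \<exists>u\<in>U. lookup m u \<ge> 1}"

lemma up_closed_var_monomials: "up_closed (var_monomials U)"
  unfolding up_closed_def var_monomials_def by (auto simp: lookup_add intro: trans_le_add1)

lemma mon_ideal_empty: "mon_ideal n {} = {0 :: 'k::field mpoly}"
  by (auto simp: mon_ideal_def)

lemma monomial_split1: "lookup m v \<ge> 1 \<Longrightarrow> m = mvar v + (m - mvar v)"
  by (intro poly_mapping_eqI) (auto simp: lookup_add lookup_minus lookup_mvar)

text \<open>Adding a variable is the cone with \<open>Q\<close> the whole ring and
  \<open>d = 0\<close>; iterating it produces the Koszul resolution of an ideal of
  variables.\<close>

lemma linres_variables:
  assumes "finite U" "U \<subseteq> {1..n}"
  shows "linres n 1 (mon_ideal n (var_monomials U) :: 'k::field mpoly set)"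
  using assms
proof (induction U rule: finite_induct)
  case empty
  then show ?case using linres_zero[of n 1] by (simp add: var_monomials_def mon_ideal_empty)
next
  case (insert v U)
  have "linres n (0 + 1) (mon_ideal n (var_monomials U \<union> {mvar v + k |k. k \<in> UNIV}) :: 'k mpoly set)"
  proof (rule linres_mon_ideal_cone)
    have "mon_ideal n UNIV = (polys n :: 'k mpoly set)" by (auto simp: mon_ideal_def)
    then show "linres n 0 (mon_ideal n UNIV :: 'k mpoly set)" using linres_unit by simp
    show "linres n (0 + 1) (mon_ideal n (var_monomials U) :: 'k mpoly set)" using insert by simp
    show "k \<in> var_monomials U" if "mvar v + k \<in> var_monomials U" for k
      using that insert.hyps by (auto simp: var_monomials_def lookup_add lookup_mvar split: if_splits)
    show "up_closed (UNIV :: monomial set)" by (simp add: up_closed_def)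
  qed (use insert.prems in \<open>auto simp: up_closed_var_monomials\<close>)
  moreover have "var_monomials U \<union> {mvar v + k |k. k \<in> UNIV} = var_monomials (insert v U)"
  proof
    show "var_monomials U \<union> {mvar v + k |k. k \<in> UNIV} \<subseteq> var_monomials (insert v U)"
      by (auto simp: var_monomials_def lookup_add lookup_mvar)
    show "var_monomials (insert v U) \<subseteq> var_monomials U \<union> {mvar v + k |k. k \<in> UNIV}"
    proof
      fix m assume m: "m \<in> var_monomials (insert v U)"
      show "m \<in> var_monomials U \<union> {mvar v + k |k. k \<in> UNIV}"
      proof (cases "lookup m v \<ge> 1")
        case True
        then show ?thesis using monomial_split1[OF True] by blast
      qed (use m in \<open>auto simp: var_monomials_def\<close>)
    qed
  qed
  ultimately show ?case by simp
qed


definition simplicial :: "nat set set \<Rightarrow> nat set \<Rightarrow> nat \<Rightarrow> bool" where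
  "simplicial G W v \<longleftrightarrow> (\<forall>a\<in>W - {v}. \<forall>c\<in>W - {v}. a \<noteq> c \<longrightarrow> {v, a} \<notin> G \<longrightarrow> {v, c} \<notin> G \<longrightarrow> {a, c} \<notin> G)"

text \<open>If \<open>v\<close> is simplicial in the complement, every edge of \<open>G\<close>
  inside \<open>W - {v}\<close> has an end among the \<open>G\<close>-neighbours of
  \<open>v\<close>. This is the inclusion of \<open>J\<close> in \<open>Q\<close> that the cone
  requires; the colon condition holds because \<open>x_v\<close> does not occur in the generators of
  \<open>J\<close>. Quantifying over all nonempty subsets of \<open>W\<close> makes the hypothesis
  hereditary.\<close>

theorem linres_cochordal:
  assumes G: "G \<subseteq> vertex_pairs n"
    and W: "finite W" "W \<subseteq> {1..n}"
    and simp: "\<And>W'. W' \<subseteq> W \<Longrightarrow> W' \<noteq> {} \<Longrightarrow> \<exists>v\<in>W'. simplicial G W' v"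
  shows "linres n 2 (mon_ideal n (graph_monomials {e \<in> G. e \<subseteq> W}) :: 'k::field mpoly set)"
  using W simp
proof (induction W rule: finite_psubset_induct)
  case (psubset W)
  show ?case
  proof (cases "W = {}")
    case True
    have "graph_monomials {e \<in> G. e \<subseteq> {}} = {}" by (auto simp: graph_monomials_def)
    then show ?thesis using linres_zero[of n 2] True by (simp add: mon_ideal_empty)
  next
    case False
    obtain v where v: "v \<in> W" "simplicial G W v" using psubset.prems(2)[of W] False by blast
    define W' where "W' = W - {v}"
    define U where "U = {u \<in> W'. {v, u} \<in> G}"
    have IH: "linres n 2 (mon_ideal n (graph_monomials {e \<in> G. e \<subseteq> W'}) :: 'k mpoly set)"
    proof (rule psubset.IH)
      show "W' \<subset> W" "W' \<subseteq> {1..n}" using v psubset.prems by (auto simp: W'_def)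
      show "\<exists>v\<in>X. simplicial G X v" if "X \<subseteq> W'" "X \<noteq> {}" for X
        using psubset.prems(2)[of X] that by (auto simp: W'_def)
    qed
    have vn: "v \<in> {1..n}" using v psubset.prems by blast
    have "linres n (1 + 1) (mon_ideal n (graph_monomials {e \<in> G. e \<subseteq> W'} \<union> {mvar v + k |k. k \<in> var_monomials U}) :: 'k mpoly set)"
    proof (rule linres_mon_ideal_cone)
      show "linres n 1 (mon_ideal n (var_monomials U) :: 'k mpoly set)"
        by (rule linres_variables) (use psubset in \<open>auto simp: U_def W'_def\<close>)
      show "linres n (1 + 1) (mon_ideal n (graph_monomials {e \<in> G. e \<subseteq> W'}) :: 'k mpoly set)" using IH by simp
      show "graph_monomials {e \<in> G. e \<subseteq> W'} \<subseteq> var_monomials U"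
      proof
        fix m assume "m \<in> graph_monomials {e \<in> G. e \<subseteq> W'}"
        then obtain i j where ij: "{i, j} \<in> G" "i \<in> W'" "j \<in> W'" "i \<noteq> j" "lookup m i \<ge> 1" "lookup m j \<ge> 1"
          by (auto simp: graph_monomials_def)
        then have "i \<in> U \<or> j \<in> U" using v(2) unfolding simplicial_def U_def W'_def by blast
        then show "m \<in> var_monomials U" using ij by (auto simp: var_monomials_def)
      qed
      show "k \<in> graph_monomials {e \<in> G. e \<subseteq> W'}" if k: "mvar v + k \<in> graph_monomials {e \<in> G. e \<subseteq> W'}" for k
      proof -
        obtain i j where ij: "{i, j} \<in> {e \<in> G. e \<subseteq> W'}" "i \<noteq> j" "lookup (mvar v + k) i \<ge> 1" "lookup (mvar v + k) j \<ge> 1"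
          using k unfolding graph_monomials_def by blast
        then have "i \<noteq> v" "j \<noteq> v" by (auto simp: W'_def)
        then have "lookup k i \<ge> 1" "lookup k j \<ge> 1" using ij by (auto simp: lookup_add lookup_mvar)
        then show ?thesis unfolding graph_monomials_def using ij(1,2) by blast
      qed
    qed (use vn in \<open>auto simp: up_closed_var_monomials up_closed_graph_monomials\<close>)
    moreover have "graph_monomials {e \<in> G. e \<subseteq> W'} \<union> {mvar v + k |k. k \<in> var_monomials U} = graph_monomials {e \<in> G. e \<subseteq> W}"
    proof
      show "graph_monomials {e \<in> G. e \<subseteq> W'} \<union> {mvar v + k |k. k \<in> var_monomials U} \<subseteq> graph_monomials {e \<in> G. e \<subseteq> W}"
      proof
        fix m assume "m \<in> graph_monomials {e \<in> G. e \<subseteq> W'} \<union> {mvar v + k |k. k \<in> var_monomials U}"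
        then show "m \<in> graph_monomials {e \<in> G. e \<subseteq> W}"
        proof
          assume "m \<in> graph_monomials {e \<in> G. e \<subseteq> W'}"
          then show ?thesis unfolding graph_monomials_def W'_def by blast
        next
          assume "m \<in> {mvar v + k |k. k \<in> var_monomials U}"
          then obtain k u where k: "m = mvar v + k" "u \<in> U" "lookup k u \<ge> 1" by (auto simp: var_monomials_def)
          then have "{v, u} \<in> {e \<in> G. e \<subseteq> W}" "v \<noteq> u" using v by (auto simp: U_def W'_def)
          moreover have "lookup m v \<ge> 1" "lookup m u \<ge> 1" using k by (auto simp: lookup_add lookup_mvar)
          ultimately show ?thesis unfolding graph_monomials_def by blast
        qed
      qed
    next
      show "graph_monomials {e \<in> G. e \<subseteq> W} \<subseteq> graph_monomials {e \<in> G. e \<subseteq> W'} \<union> {mvar v + k |k. k \<in> var_monomials U}"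
      proof
        fix m assume "m \<in> graph_monomials {e \<in> G. e \<subseteq> W}"
        then obtain i j where ij: "{i, j} \<in> G" "i \<in> W" "j \<in> W" "i \<noteq> j" "lookup m i \<ge> 1" "lookup m j \<ge> 1"
          by (auto simp: graph_monomials_def)
        have main: "m \<in> {mvar v + k |k. k \<in> var_monomials U}"
          if u: "{v, u} \<in> G" "u \<in> W" "u \<noteq> v" "lookup m v \<ge> 1" "lookup m u \<ge> 1" for u
        proof -
          have "u \<in> U" using u by (auto simp: U_def W'_def)
          moreover have "lookup (m - mvar v) u \<ge> 1" using u by (simp add: lookup_minus lookup_mvar)
          ultimately have "m - mvar v \<in> var_monomials U" unfolding var_monomials_def by blast
          then show ?thesis using monomial_split1[OF u(4)] by blast
        qed
        show "m \<in> graph_monomials {e \<in> G. e \<subseteq> W'} \<union> {mvar v + k |k. k \<in> var_monomials U}"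
        proof (cases "i = v \<or> j = v")
          case True
          then show ?thesis using main[of i] main[of j] ij by (auto simp: insert_commute)
        next
          case False
          then have "{i, j} \<in> {e \<in> G. e \<subseteq> W'}" using ij by (auto simp: W'_def)
          then show ?thesis unfolding graph_monomials_def using ij(4-6) by blast
        qed
      qed
    qed
    ultimately show ?thesis by simp
  qed
qed

corollary cochordal_imp_linear_resolution:
  assumes G: "G \<subseteq> vertex_pairs n"
    and simp: "\<And>W. W \<subseteq> {1..n} \<Longrightarrow> W \<noteq> {} \<Longrightarrow> \<exists>v\<in>W. simplicial G W v"
  shows "has_linear_resolution n (edge_ideal n G :: 'k::field mpoly set)"
proof -
  have "{e \<in> G. e \<subseteq> {1..n}} = G" using G by (auto simp: vertex_pairs_def)
  moreover have "linres n 2 (mon_ideal n (graph_monomials {e \<in> G. e \<subseteq> {1..n}}) :: 'k mpoly set)"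
    by (rule linres_cochordal[OF G]) (use simp in auto)
  ultimately have "linres n 2 (edge_ideal n G :: 'k mpoly set)" by (simp add: edge_ideal_eq[OF G])
  then show ?thesis by (rule linres_imp_has_linear_resolution)
qed

section \<open>Existence of minimal graded resolutions\<close>

text \<open>A decreasing sequence of natural numbers is constant once it has reached its least
  value, so a tail of a decreasing subsequence is also increasing in the weak sense.\<close>

lemma nat_seq_mono_subseq:
  fixes s :: "nat \<Rightarrow> nat"
  obtains g :: "nat \<Rightarrow> nat" where "strict_mono g" "mono (\<lambda>k. s (g k))"
proof -
  obtain g :: "nat \<Rightarrow> nat" where g: "strict_mono g" "monoseq (\<lambda>k. s (g k))" using seq_monosub[of s] by blast
  show thesis
  proof (cases "incseq (\<lambda>k. s (g k))")
    case True
    then show thesis using g that by blast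
  next
    case False
    then have dec: "decseq (\<lambda>k. s (g k))" using g(2) by (auto simp: monoseq_iff)
    obtain N where N: "\<And>k. s (g N) \<le> s (g k)"
      using ex_has_least_nat[of "\<lambda>_. True" 0 "\<lambda>k. s (g k)"] by blast
    have const: "s (g (k + N)) = s (g N)" for k
      using N[of "k + N"] decseqD[OF dec, of N "k + N"] by simp
    have "strict_mono (\<lambda>k. g (k + N))" using g(1) by (auto simp: strict_mono_def)
    moreover have "mono (\<lambda>k. s (g (k + N)))" unfolding const by (simp add: mono_def)
    ultimately show thesis by (rule that)
  qed
qed

lemma common_mono_subseq:
  fixes f :: "nat \<Rightarrow> 'a \<Rightarrow> nat"
  assumes "finite I"
  shows "\<exists>g :: nat \<Rightarrow> nat. strict_mono g \<and> (\<forall>i\<in>I. mono (\<lambda>k. f (g k) i))"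
  using assms
proof (induction I rule: finite_induct)
  case empty
  then show ?case by (intro exI[of _ id]) (simp add: strict_mono_def)
next
  case (insert x I)
  then obtain g :: "nat \<Rightarrow> nat" where g: "strict_mono g" "\<forall>i\<in>I. mono (\<lambda>k. f (g k) i)" by blast
  obtain h :: "nat \<Rightarrow> nat" where h: "strict_mono h" "mono (\<lambda>k. f (g (h k)) x)"
    using nat_seq_mono_subseq[of "\<lambda>k. f (g k) x"] by blast
  have "strict_mono (\<lambda>k. g (h k))" using g(1) h(1) by (auto simp: strict_mono_def)
  moreover have "mono (\<lambda>k. f (g (h k)) i)" if "i \<in> I" for i
    using g(2) that strict_mono_mono[OF h(1)] by (auto simp: mono_def)
  ultimately show ?case using h(2) by (intro exI[of _ "\<lambda>k. g (h k)"]) auto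
qed

text \<open>The monomials of \<open>L\<close> that are minimal for divisibility suffice, by
  induction on the degree. Were there infinitely many, a sequence of them would have a subsequence
  along which all \<open>n\<close> exponents are nondecreasing, and one minimal monomial would
  properly divide another.\<close>

lemma dickson:
  fixes L :: "monomial set"
  assumes L: "\<And>m. m \<in> L \<Longrightarrow> keys m \<subseteq> {1..n}"
  obtains B where "finite B" "B \<subseteq> L" "\<And>m. m \<in> L \<Longrightarrow> \<exists>b\<in>B. \<exists>a. m = b + a"
proof -
  define B where "B = {m \<in> L. \<forall>m'\<in>L. \<forall>a. m = m' + a \<longrightarrow> a = 0}"
  have "\<exists>b\<in>B. \<exists>a. m = b + a" if "m \<in> L" for m
    using that
  proof (induction "mdeg m" arbitrary: m rule: less_induct)
    case less
    show ?case
    proof (cases "m \<in> B")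
      case True
      then show ?thesis by (intro bexI[of _ m] exI[of _ 0]) simp_all
    next
      case False
      then obtain m' a where m': "m' \<in> L" "m = m' + a" "a \<noteq> 0" using less.prems by (auto simp: B_def)
      then have "0 < mdeg a" by (metis gr0I mdeg_eq_0_iff)
      then have "mdeg m' < mdeg m" using m'(2) by simp
      from less.hyps[OF this m'(1)] obtain b c where "b \<in> B" "m' = b + c" by blast
      then show ?thesis using m'(2) by (intro bexI[of _ b] exI[of _ "c + a"]) (simp_all add: add.assoc)
    qed
  qed
  moreover have "finite B"
  proof (rule ccontr)
    assume "infinite B"
    then obtain f :: "nat \<Rightarrow> monomial" where f: "inj f" "range f \<subseteq> B" using infinite_countable_subset by blast
    obtain g :: "nat \<Rightarrow> nat" where g: "strict_mono g" "\<forall>i\<in>{1..n}. mono (\<lambda>k. lookup (f (g k)) i)"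
      using common_mono_subseq[of "{1..n}" "\<lambda>k. lookup (f k)"] by blast
    have fB: "f k \<in> B" for k using f(2) by blast
    have "lookup (f (g 0)) i \<le> lookup (f (g 1)) i" for i
    proof (cases "i \<in> {1..n}")
      case True
      then have "mono (\<lambda>k. lookup (f (g k)) i)" using g(2) by blast
      from monoD[OF this, of 0 1] show ?thesis by simp
    next
      case False
      have "keys (f (g 0)) \<subseteq> {1..n}" using L fB by (auto simp: B_def)
      then have "i \<notin> keys (f (g 0))" using False by blast
      then show ?thesis by (simp add: in_keys_iff)
    qed
    then have eq: "f (g 1) = f (g 0) + (f (g 1) - f (g 0))"
      by (intro poly_mapping_eqI) (simp add: lookup_add lookup_minus)
    have "f (g 0) \<in> L" using fB[of "g 0"] by (simp add: B_def)
    then have "f (g 1) - f (g 0) = 0" using fB[of "g 1"] eq unfolding B_def by blast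
    then have "f (g 1) = f (g 0)" using eq by simp
    then have "g 1 = g 0" using f(1) by (simp add: inj_eq)
    then show False using g(1) by (simp add: strict_mono_eq)
  qed
  ultimately show thesis using that[of B] by (auto simp: B_def)
qed

lemma finite_monomials_of_degree: "finite {m. keys m \<subseteq> {1..n} \<and> mdeg m = D}"
proof (rule finite_subset)
  let ?f = "\<lambda>m::monomial. \<lambda>i\<in>{1..n}. lookup m i"
  show "finite (?f -` (PiE {1..n} (\<lambda>_. {0..D})) \<inter> {m. keys m \<subseteq> {1..n}})"
  proof (rule finite_vimage_IntI)
    show "inj_on ?f {m. keys m \<subseteq> {1..n}}"
    proof (rule inj_onI)
      fix m m' assume m: "m \<in> {m. keys m \<subseteq> {1..n}}" "m' \<in> {m. keys m \<subseteq> {1..n}}" and eq: "?f m = ?f m'"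
      show "m = m'"
      proof (rule poly_mapping_eqI)
        fix i
        show "lookup m i = lookup m' i"
        proof (cases "i \<in> {1..n}")
          case True
          then show ?thesis using fun_cong[OF eq, of i] by simp
        next
          case False
          then have "i \<notin> keys m" "i \<notin> keys m'" using m by auto
          then show ?thesis by (simp add: in_keys_iff)
        qed
      qed
    qed
  qed (intro finite_PiE, auto)
  show "{m. keys m \<subseteq> {1..n} \<and> mdeg m = D} \<subseteq> ?f -` (PiE {1..n} (\<lambda>_. {0..D})) \<inter> {m. keys m \<subseteq> {1..n}}"
  proof
    fix m :: monomial assume m: "m \<in> {m. keys m \<subseteq> {1..n} \<and> mdeg m = D}"
    then have "mdeg m = (\<Sum>i\<in>{1..n}. lookup m i)" by (intro mdeg_eq_sum) auto
    then have "lookup m i \<le> D" if "i \<in> {1..n}" for i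
      using m that member_le_sum[of i "{1..n}" "lookup m"] by simp
    then show "m \<in> ?f -` (PiE {1..n} (\<lambda>_. {0..D})) \<inter> {m. keys m \<subseteq> {1..n}}" using m by auto
  qed
qed

section \<open>Graded submodules of free modules and their generators\<close>

definition lspan :: "nat \<Rightarrow> (nat \<Rightarrow> 'k::field mpoly) set \<Rightarrow> (nat \<Rightarrow> 'k mpoly) set" where
  "lspan n X = {\<lambda>j. \<Sum>x\<in>X. c x * x j |c. \<forall>x\<in>X. c x \<in> polys n}"

lemma lspanI: "(\<And>x. x \<in> X \<Longrightarrow> c x \<in> polys n) \<Longrightarrow> (\<And>j. v j = (\<Sum>x\<in>X. c x * x j)) \<Longrightarrow> v \<in> lspan n X"
  unfolding lspan_def by (rule CollectI, rule exI[of _ c]) auto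

lemma lspanE:
  assumes "v \<in> lspan n X"
  obtains c where "\<And>x. x \<in> X \<Longrightarrow> c x \<in> polys n" "\<And>j. v j = (\<Sum>x\<in>X. c x * x j)"
  using assms unfolding lspan_def by auto

lemma lspan_zero: "(\<lambda>_. 0) \<in> lspan n X"
  by (rule lspanI[of _ "\<lambda>_. 0"]) auto

lemma lspan_superset: "finite X \<Longrightarrow> x \<in> X \<Longrightarrow> x \<in> lspan n X"
  by (rule lspanI[of _ "\<lambda>y. if y = x then 1 else 0"]) (auto simp: if_distrib[of "\<lambda>a. a * _"] cong: if_cong)

lemma lspan_add: "v \<in> lspan n X \<Longrightarrow> w \<in> lspan n X \<Longrightarrow> (\<lambda>j. v j + w j) \<in> lspan n X"
  by (elim lspanE, rule lspanI[of _ "\<lambda>x. c x + d x" for c d]) (auto simp: distrib_right sum.distrib)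

lemma lspan_scale: "f \<in> polys n \<Longrightarrow> v \<in> lspan n X \<Longrightarrow> (\<lambda>j. f * v j) \<in> lspan n X"
  by (elim lspanE, rule lspanI[of _ "\<lambda>x. f * c x" for c]) (auto simp: sum_distrib_left mult.assoc)

lemma lspan_sum:
  "(\<And>e. e \<in> E \<Longrightarrow> v e \<in> lspan n X) \<Longrightarrow> (\<lambda>j. \<Sum>e\<in>E. v e j) \<in> lspan n X"
proof (induction E rule: infinite_finite_induct)
  case (insert e E)
  then show ?case using lspan_add[of "v e" n X "\<lambda>j. \<Sum>e\<in>E. v e j"] by simp
qed (auto simp: lspan_zero)

lemma lspan_subset:
  assumes "v \<in> lspan n X" "\<And>x. x \<in> X \<Longrightarrow> x \<in> lspan n Y"
  shows "v \<in> lspan n Y"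
proof -
  obtain c where c: "\<And>x. x \<in> X \<Longrightarrow> c x \<in> polys n" "\<And>j. v j = (\<Sum>x\<in>X. c x * x j)"
    by (rule lspanE[OF assms(1)]) blast
  have "(\<lambda>j. \<Sum>x\<in>X. c x * x j) \<in> lspan n Y"
    by (rule lspan_sum) (use c assms(2) in \<open>auto intro: lspan_scale\<close>)
  then show ?thesis using c(2) by presburger
qed

text \<open>Vectors vanish beyond the rank, so that equality of functions is equality in the free
  module. In the last clause, \<open>e\<close> is the total degree and coordinate \<open>j\<close>
  is shifted by the degree of its basis element.\<close>

definition graded_sub :: "nat \<Rightarrow> nat \<Rightarrow> (nat \<Rightarrow> int) \<Rightarrow> (nat \<Rightarrow> 'k::field mpoly) set \<Rightarrow> bool" where
  "graded_sub n r dr N \<longleftrightarrow> (\<forall>v\<in>N. (\<forall>j<r. v j \<in> polys n) \<and> (\<forall>j\<ge>r. v j = 0)) \<and> (\<lambda>_. 0) \<in> N \<and>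
     (\<forall>v\<in>N. \<forall>w\<in>N. (\<lambda>j. v j + w j) \<in> N) \<and> (\<forall>f\<in>polys n. \<forall>v\<in>N. (\<lambda>j. f * v j) \<in> N) \<and>
     (\<forall>e. \<forall>v\<in>N. (\<lambda>j. hcomp (e - dr j) (v j)) \<in> N)"

definition graded_vec :: "nat \<Rightarrow> (nat \<Rightarrow> int) \<Rightarrow> int \<Rightarrow> (nat \<Rightarrow> 'k::field mpoly) \<Rightarrow> bool" where
  "graded_vec r dr e v \<longleftrightarrow> (\<forall>j<r. homogeneous (e - dr j) (v j))"

lemma graded_subD:
  assumes "graded_sub n r dr N"
  shows graded_sub_polys: "\<And>v j. v \<in> N \<Longrightarrow> v j \<in> polys n"
    and graded_sub_ge: "\<And>v j. v \<in> N \<Longrightarrow> j \<ge> r \<Longrightarrow> v j = 0"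
    and graded_sub_zero: "(\<lambda>_. 0) \<in> N"
    and graded_sub_add: "\<And>v w. v \<in> N \<Longrightarrow> w \<in> N \<Longrightarrow> (\<lambda>j. v j + w j) \<in> N"
    and graded_sub_scale: "\<And>f v. f \<in> polys n \<Longrightarrow> v \<in> N \<Longrightarrow> (\<lambda>j. f * v j) \<in> N"
    and graded_sub_hcomp: "\<And>e v. v \<in> N \<Longrightarrow> (\<lambda>j. hcomp (e - dr j) (v j)) \<in> N"
proof -
  show "v j \<in> polys n" if "v \<in> N" for v j
    using assms that by (cases "j < r") (auto simp: graded_sub_def not_less)
qed (use assms in \<open>auto simp: graded_sub_def\<close>)

lemma graded_sub_lspan:
  assumes "graded_sub n r dr N" "X \<subseteq> N" "v \<in> lspan n X"
  shows "v \<in> N"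
proof -
  obtain c where c: "\<And>x. x \<in> X \<Longrightarrow> c x \<in> polys n" "\<And>j. v j = (\<Sum>x\<in>X. c x * x j)"
    by (rule lspanE[OF assms(3)]) blast
  have "(\<lambda>j. \<Sum>x\<in>Y. c x * x j) \<in> N" if "Y \<subseteq> X" for Y
    using that
  proof (induction Y rule: infinite_finite_induct)
    case (insert x Y)
    have "(\<lambda>j. c x * x j) \<in> N" using insert.prems c(1) assms(2) by (intro graded_sub_scale[OF assms(1)]) auto
    then show ?case using insert graded_sub_add[OF assms(1)] by simp
  qed (use graded_sub_zero[OF assms(1)] in auto)
  from this[of X] have "(\<lambda>j. \<Sum>x\<in>X. c x * x j) \<in> N" by simp
  then show ?thesis using c(2) by presburger
qed

lemma hcomp_decomposition:
  assumes "finite E" "\<And>m. m \<in> keys f \<Longrightarrow> int (mdeg m) + d \<in> E"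
  shows "f = (\<Sum>e\<in>E. hcomp (e - d) f)"
proof (rule poly_mapping_eqI)
  fix m
  show "lookup f m = lookup (\<Sum>e\<in>E. hcomp (e - d) f) m"
  proof (cases "m \<in> keys f")
    case True
    have "lookup (\<Sum>e\<in>E. hcomp (e - d) f) m = (\<Sum>e\<in>E. if e = int (mdeg m) + d then lookup f m else 0)"
      unfolding lookup_sum lookup_hcomp by (rule sum.cong) auto
    then show ?thesis using assms True by simp
  next
    case False
    then show ?thesis by (auto simp: lookup_sum lookup_hcomp in_keys_iff intro!: sum.neutral)
  qed
qed

text \<open>A Groebner basis argument. The leading term of a homogeneous vector is the largest
  monomial in its last nonzero coordinate. For each of the \<open>r\<close> positions,
  \<open>dickson\<close> yields finitely many leading monomials of \<open>N\<close> that divide all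
  the others, and homogeneous vectors with these leading terms generate \<open>N\<close> by
  reduction.\<close>

lemma graded_sub_finitely_generated:
  fixes N :: "(nat \<Rightarrow> 'k::field mpoly) set"
  assumes N: "graded_sub n r dr N"
  obtains X where "finite X" "X \<subseteq> N" "\<And>x. x \<in> X \<Longrightarrow> \<exists>e. graded_vec r dr e x" "N \<subseteq> lspan n X"
proof -
  define lead where "lead p m e v \<longleftrightarrow> v \<in> N \<and> graded_vec r dr e v \<and> (\<forall>j>p. v j = 0) \<and> m \<in> keys (v p) \<and> (\<forall>k\<in>keys (v p). k \<le> m)"
    for p m e and v :: "nat \<Rightarrow> 'k mpoly"
  define LS where "LS p = {m. \<exists>e v. lead p m e v}" for p
  have "\<forall>p. \<exists>B. finite B \<and> B \<subseteq> LS p \<and> (\<forall>m\<in>LS p. \<exists>b\<in>B. \<exists>a. m = b + a)"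
  proof
    fix p
    have L: "keys m \<subseteq> {1..n}" if m: "m \<in> LS p" for m
    proof -
      obtain e v where "lead p m e v" using m unfolding LS_def by blast
      then have "v p \<in> polys n" "m \<in> keys (v p)" using graded_sub_polys[OF N] by (auto simp: lead_def)
      then show ?thesis by (auto simp: polys_def)
    qed
    show "\<exists>B. finite B \<and> B \<subseteq> LS p \<and> (\<forall>m\<in>LS p. \<exists>b\<in>B. \<exists>a. m = b + a)"
      by (rule dickson[of "LS p" n]) (rule L, assumption, blast)
  qed
  from choice[OF this] obtain B where B0: "\<And>p. finite (B p) \<and> B p \<subseteq> LS p \<and> (\<forall>m\<in>LS p. \<exists>b\<in>B p. \<exists>a. m = b + a)"
    by blast
  have B: "finite (B p)" "m \<in> B p \<Longrightarrow> \<exists>e v. lead p m e v"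
    "lead p m e v \<Longrightarrow> \<exists>b\<in>B p. \<exists>a. m = b + a" for p m e v
  proof -
    show "finite (B p)" using B0 by blast
    show "\<exists>e v. lead p m e v" if "m \<in> B p" using B0[of p] that unfolding LS_def by blast
    show "\<exists>b\<in>B p. \<exists>a. m = b + a" if "lead p m e v"
    proof -
      have "m \<in> LS p" using that unfolding LS_def by blast
      then show ?thesis using B0[of p] by blast
    qed
  qed
  have "\<forall>pm. \<exists>v. snd pm \<in> B (fst pm) \<longrightarrow> (\<exists>e. lead (fst pm) (snd pm) e v)" using B(2) by blast
  from choice[OF this] obtain F where F: "\<And>p m. m \<in> B p \<Longrightarrow> \<exists>e. lead p m e (F (p, m))" by auto
  define X where "X = (\<Union>p<r. (\<lambda>m. F (p, m)) ` B p)"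
  have finX: "finite X" using B(1) by (simp add: X_def)
  have XN: "X \<subseteq> N" "\<And>x. x \<in> X \<Longrightarrow> \<exists>e. graded_vec r dr e x" using F by (fastforce simp: X_def lead_def)+
  have reduce: "v \<in> lspan n X" if "v \<in> N" "graded_vec r dr e v" "\<And>j. j \<ge> p \<Longrightarrow> v j = 0" "p \<le> r" for v e p
    using that
  proof (induction p arbitrary: v)
    case 0
    then have "v = (\<lambda>_. 0)" by auto
    then show ?case using lspan_zero by simp
  next
    case (Suc p)
    define T where "T = {m. keys m \<subseteq> {1..n} \<and> mdeg m = nat (e - dr p)}"
    have finT: "finite T" unfolding T_def by (rule finite_monomials_of_degree)
    \<comment> \<open>Reduction keeps the degree, and \<open>T\<close> contains the finitely many
      monomials possible at position \<open>p\<close>. Each subtraction removes the leading monomial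
      and creates only smaller ones, so the number of elements of \<open>T\<close> below some
      remaining key drops.\<close>
    show ?case using Suc.prems(1-3)
    proof (induction "card {m \<in> T. \<exists>k\<in>keys (v p). m \<le> k}" arbitrary: v rule: less_induct)
      case less
      show ?case
      proof (cases "v p = 0")
        case True
        have "v j = 0" if "j \<ge> p" for j
          using True less.prems(3)[of j] that by (cases "j = p") auto
        then show ?thesis using Suc.IH[of v] less.prems Suc.prems(4) by simp
      next
        case False
        define m where "m = Max (keys (v p))"
        have m: "m \<in> keys (v p)" "\<And>k. k \<in> keys (v p) \<Longrightarrow> k \<le> m"
          using False Max_in[of "keys (v p)"] by (simp_all add: m_def)
        have "lead p m e v" unfolding lead_def using less.prems m by auto
        then obtain b a where b: "b \<in> B p" "m = b + a" using B(3) by blast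
        obtain eb where lb: "lead p b eb (F (p, b))" using F[OF b(1)] by blast
        define f where "f = F (p, b)"
        have fX: "f \<in> X" using b(1) Suc.prems(4) by (auto simp: X_def f_def)
        have f: "f \<in> N" "graded_vec r dr eb f" "\<And>j. j > p \<Longrightarrow> f j = 0" "b \<in> keys (f p)" "\<And>k. k \<in> keys (f p) \<Longrightarrow> k \<le> b"
          using lb by (auto simp: lead_def f_def)
        define c where "c = lookup (v p) m / lookup (f p) b"
        define s where "s = Poly_Mapping.single a c"
        have keysm: "keys m \<subseteq> {1..n}" using graded_sub_polys[OF N less.prems(1), of p] m by (auto simp: polys_def)
        have degm: "int (mdeg m) = e - dr p" using less.prems(2) m(1) Suc.prems(4) by (auto simp: graded_vec_def homogeneous_def)
        have degb: "int (mdeg b) = eb - dr p" using f(2,4) Suc.prems(4) by (auto simp: graded_vec_def homogeneous_def)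
        have mT: "m \<in> T" using keysm degm by (auto simp: T_def)
        have sp: "s \<in> polys n" unfolding s_def using keysm b(2) by (intro polys_single) (auto simp: keys_add_monomial)
        have hs: "homogeneous (e - eb) s" unfolding s_def
          by (rule homogeneous_single) (use degm degb b(2) in simp)
        define u where "u j = v j + (- s) * f j" for j
        have uN: "u \<in> N" unfolding u_def[abs_def]
          by (intro graded_sub_add[OF N] graded_sub_scale[OF N] less.prems f polys_uminus sp)
        have uh: "graded_vec r dr e u"
          unfolding graded_vec_def
        proof (intro allI impI)
          fix j assume j: "j < r"
          have "homogeneous (e - eb + (eb - dr j)) (- s * f j)"
            by (rule homogeneous_mult[OF homogeneous_uminus[OF hs]]) (use f(2) j in \<open>simp add: graded_vec_def\<close>)
          then show "homogeneous (e - dr j) (u j)"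
            unfolding u_def by (intro homogeneous_add) (use less.prems(2) j in \<open>simp_all add: graded_vec_def\<close>)
        qed
        have u0: "u j = 0" if "j \<ge> Suc p" for j using less.prems(3)[OF that] f(3)[of j] that by (simp add: u_def)
        have ku: "k < m" if k: "k \<in> keys (u p)" for k
        proof -
          have "k \<in> keys (v p) \<or> k \<in> keys (s * f p)"
            using k Poly_Mapping.keys_add[of "v p" "- s * f p"] by (auto simp: u_def in_keys_iff lookup_uminus)
          then have "k \<le> m"
          proof
            assume "k \<in> keys (s * f p)"
            then obtain k' where "k' \<in> keys (f p)" "k = a + k'"
              using keys_mult[of s "f p"] by (auto simp: s_def split: if_splits)
            then show ?thesis using f(5)[of k'] b(2) by (simp add: add.commute)
          qed (rule m(2))
          moreover have "k \<noteq> m"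
          proof
            assume "k = m"
            have "lookup (s * f p) m = c * lookup (f p) b"
              unfolding s_def b(2) add.commute[of b a] by (rule lookup_single_mult)
            then have "lookup (u p) m = 0"
              using f(4) by (simp add: u_def lookup_minus c_def in_keys_iff)
            then show False using k \<open>k = m\<close> by (simp add: in_keys_iff)
          qed
          ultimately show ?thesis by simp
        qed
        have "{m \<in> T. \<exists>k\<in>keys (u p). m \<le> k} \<subset> {m \<in> T. \<exists>k\<in>keys (v p). m \<le> k}"
        proof
          show "{m \<in> T. \<exists>k\<in>keys (u p). m \<le> k} \<subseteq> {m \<in> T. \<exists>k\<in>keys (v p). m \<le> k}"
            using ku m(1) by (auto intro!: bexI[of _ m]) (meson le_less_trans less_imp_le)
          have "m \<notin> {m \<in> T. \<exists>k\<in>keys (u p). m \<le> k}" using ku by (auto simp: not_le)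
          moreover have "m \<in> {m \<in> T. \<exists>k\<in>keys (v p). m \<le> k}" using mT m(1) by auto
          ultimately show "{m \<in> T. \<exists>k\<in>keys (u p). m \<le> k} \<noteq> {m \<in> T. \<exists>k\<in>keys (v p). m \<le> k}" by blast
        qed
        then have "card {m \<in> T. \<exists>k\<in>keys (u p). m \<le> k} < card {m \<in> T. \<exists>k\<in>keys (v p). m \<le> k}"
          using finT by (intro psubset_card_mono) auto
        from less.hyps[OF this uN uh u0] have uX: "u \<in> lspan n X" by simp
        have "(\<lambda>j. u j + s * f j) \<in> lspan n X"
          by (rule lspan_add[OF uX lspan_scale[OF sp lspan_superset[OF finX fX]]])
        moreover have "(\<lambda>j. u j + s * f j) = v" by (rule ext) (simp add: u_def)
        ultimately show ?thesis by simp
      qed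
    qed
  qed
  have "v \<in> lspan n X" if v: "v \<in> N" for v
  proof -
    define E where "E = (\<Union>j<r. (\<lambda>m. int (mdeg m) + dr j) ` keys (v j))"
    have finE: "finite E" by (simp add: E_def)
    have "(\<lambda>j. \<Sum>e\<in>E. hcomp (e - dr j) (v j)) \<in> lspan n X"
    proof (rule lspan_sum)
      fix e
      show "(\<lambda>j. hcomp (e - dr j) (v j)) \<in> lspan n X"
        by (rule reduce[of _ e r]) (use graded_sub_hcomp[OF N v] graded_sub_ge[OF N v] in \<open>simp_all add: graded_vec_def\<close>)
    qed
    moreover have "(\<lambda>j. \<Sum>e\<in>E. hcomp (e - dr j) (v j)) = v"
    proof
      fix j
      show "(\<Sum>e\<in>E. hcomp (e - dr j) (v j)) = v j"
      proof (cases "j < r")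
        case True
        show ?thesis by (rule hcomp_decomposition[symmetric, OF finE]) (use True in \<open>auto simp: E_def\<close>)
      next
        case False
        then show ?thesis using graded_sub_ge[OF N v] by simp
      qed
    qed
    ultimately show ?thesis by simp
  qed
  then show thesis using that[of X] finX XN by blast
qed

text \<open>Graded Nakayama: in a homogeneous generating set of least size no relation has a
  coefficient with nonzero constant term, since the corresponding generator could be solved for and
  dropped. The predicate \<open>P\<close> restricts the degrees in all competing generating sets, so
  it survives the minimization.\<close>

lemma graded_sub_minimal_generators:
  fixes N :: "(nat \<Rightarrow> 'k::field mpoly) set"
  assumes N: "graded_sub n r dr N"
    and X: "finite X" "X \<subseteq> N" "\<And>x. x \<in> X \<Longrightarrow> \<exists>e. graded_vec r dr e x \<and> P e" "N \<subseteq> lspan n X"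
  obtains c :: nat and de B where
    "\<And>k. k < c \<Longrightarrow> B k \<in> N \<and> graded_vec r dr (de k) (B k) \<and> P (de k)"
    "\<And>v. v \<in> N \<Longrightarrow> \<exists>w. (\<forall>k<c. w k \<in> polys n) \<and> (\<forall>j. v j = (\<Sum>k<c. B k j * w k))"
    "\<And>w. (\<And>k. k < c \<Longrightarrow> w k \<in> polys n) \<Longrightarrow> (\<lambda>j. \<Sum>k<c. B k j * w k) \<in> N"
    "\<And>w k. (\<And>k. k < c \<Longrightarrow> w k \<in> polys n) \<Longrightarrow> (\<And>j. (\<Sum>k<c. B k j * w k) = 0) \<Longrightarrow> k < c \<Longrightarrow> w k \<in> irrelevant_ideal n"
proof -
  define ok where "ok X \<longleftrightarrow> finite X \<and> X \<subseteq> N \<and> (\<forall>x\<in>X. \<exists>e. graded_vec r dr e x \<and> P e) \<and> N \<subseteq> lspan n X" for X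
  have "ok X" using X by (simp add: ok_def)
  then obtain Y where Y: "ok Y" and min: "\<And>Z. ok Z \<Longrightarrow> card Y \<le> card Z"
    using ex_has_least_nat[of ok X card] by blast
  have finY: "finite Y" and YN: "Y \<subseteq> N" and span: "N \<subseteq> lspan n Y" using Y by (auto simp: ok_def)
  obtain dg where dg: "\<And>x. x \<in> Y \<Longrightarrow> graded_vec r dr (dg x) x \<and> P (dg x)" using Y unfolding ok_def by metis
  have irr: "w x0 \<in> irrelevant_ideal n" if w: "\<And>x. x \<in> Y \<Longrightarrow> w x \<in> polys n" and z: "\<And>j. (\<Sum>x\<in>Y. w x * x j) = 0" and x0: "x0 \<in> Y" for w x0
  proof (rule ccontr)
    assume "w x0 \<notin> irrelevant_ideal n"
    then have k: "lookup (w x0) 0 \<noteq> 0" using w[OF x0] by (simp add: irrelevant_ideal_def)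
    \<comment> \<open>The homogeneous part of the relation in the degree of \<open>x0\<close>; in it
      the coefficient of \<open>x0\<close> is a nonzero constant.\<close>
    define w' where "w' x = hcomp (dg x0 - dg x) (w x)" for x
    have z': "(\<Sum>x\<in>Y. w' x * x j) = 0" for j
    proof (cases "j < r")
      case True
      have "(\<Sum>x\<in>Y. w' x * x j) = (\<Sum>x\<in>Y. hcomp (dg x0 - dr j) (w x * x j))"
      proof (rule sum.cong)
        fix x assume "x \<in> Y"
        then have "homogeneous (dg x - dr j) (x j)" using dg True by (auto simp: graded_vec_def)
        from hcomp_mult'[OF this, of "dg x0 - dr j" "w x"]
        show "w' x * x j = hcomp (dg x0 - dr j) (w x * x j)" by (simp add: w'_def mult.commute)
      qed simp
      then show ?thesis by (simp add: hcomp_sum[symmetric] z)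
    next
      case False
      then show ?thesis using graded_sub_ge[OF N] YN by (intro sum.neutral) (auto simp: not_less)
    qed
    define k where "k = lookup (w x0) 0"
    have k0: "k \<noteq> 0" using k by (simp add: k_def)
    have w'x0: "w' x0 = Poly_Mapping.single 0 k"
      using homogeneous_0_const[OF homogeneous_hcomp[of 0 "w x0"]] by (simp add: w'_def k_def lookup_hcomp)
    have "x0 \<in> lspan n (Y - {x0})"
    proof (rule lspanI[of _ "\<lambda>x. - Poly_Mapping.single 0 (inverse k) * w' x"])
      show "- Poly_Mapping.single 0 (inverse k) * w' x \<in> polys n" if "x \<in> Y - {x0}" for x
        using w that by (intro polys_mult polys_uminus) (auto simp: w'_def)
      fix j
      have "w' x0 * x0 j + (\<Sum>x\<in>Y - {x0}. w' x * x j) = 0"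
        using z'[of j] finY x0 by (simp add: sum.remove)
      then have "Poly_Mapping.single 0 (inverse k) * (w' x0 * x0 j) = - (Poly_Mapping.single 0 (inverse k) * (\<Sum>x\<in>Y - {x0}. w' x * x j))"
        by (simp add: eq_neg_iff_add_eq_0[symmetric])
      moreover have "Poly_Mapping.single 0 (inverse k) * (w' x0 * x0 j) = x0 j"
        unfolding w'x0 mult.assoc[symmetric] mult_single using k0 by simp
      ultimately show "x0 j = (\<Sum>x\<in>Y - {x0}. - Poly_Mapping.single 0 (inverse k) * w' x * x j)"
        by (simp add: sum_distrib_left sum_negf mult.assoc)
    qed
    then have "lspan n Y \<subseteq> lspan n (Y - {x0})"
      using lspan_subset[of _ n Y "Y - {x0}"] lspan_superset[of "Y - {x0}"] finY by blast
    then have "ok (Y - {x0})" using Y by (auto simp: ok_def)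
    from min[OF this] show False using card_Diff1_less[OF finY x0] by simp
  qed
  obtain h where h: "bij_betw h {0..<card Y} Y" using ex_bij_betw_nat_finite[OF finY] by blast
  have h': "bij_betw h {..<card Y} Y" using h by (simp add: lessThan_atLeast0)
  have hY: "h k \<in> Y" if "k < card Y" for k using h' that by (auto simp: bij_betw_def)
  have inj: "inj_on h {..<card Y}" using h' by (simp add: bij_betw_def)
  have reindex: "(\<Sum>k<card Y. F (h k)) = (\<Sum>x\<in>Y. F x)" for F :: "(nat \<Rightarrow> 'k mpoly) \<Rightarrow> 'k mpoly"
    using sum.reindex_bij_betw[OF h'] .
  have inv: "the_inv_into {..<card Y} h (h k) = k" if "k < card Y" for k
    using the_inv_into_f_f[OF inj] that by simp
  have invY: "the_inv_into {..<card Y} h x < card Y" if "x \<in> Y" for x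
    using the_inv_into_into[OF inj, of x "{..<card Y}"] h' that by (auto simp: bij_betw_def)
  show thesis
  proof (rule that[of "card Y" h "\<lambda>k. dg (h k)"])
    show "h k \<in> N \<and> graded_vec r dr (dg (h k)) (h k) \<and> P (dg (h k))" if "k < card Y" for k
      using hY[OF that] dg YN by blast
    show "\<exists>w. (\<forall>k<card Y. w k \<in> polys n) \<and> (\<forall>j. v j = (\<Sum>k<card Y. h k j * w k))" if v: "v \<in> N" for v
    proof -
      obtain c where c: "\<And>x. x \<in> Y \<Longrightarrow> c x \<in> polys n" "\<And>j. v j = (\<Sum>x\<in>Y. c x * x j)"
        using lspanE[OF subsetD[OF span v]] by blast
      show ?thesis
      proof (intro exI[of _ "\<lambda>k. c (h k)"] conjI allI impI)
        show "v j = (\<Sum>k<card Y. h k j * c (h k))" for j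
          unfolding c(2) using reindex[of "\<lambda>x. c x * x j"] by (simp add: mult.commute)
      qed (use c hY in auto)
    qed
    have conv: "(\<Sum>k<card Y. h k j * w k) = (\<Sum>x\<in>Y. w (the_inv_into {..<card Y} h x) * x j)" for w j
    proof -
      have "(\<Sum>k<card Y. h k j * w k) = (\<Sum>k<card Y. w (the_inv_into {..<card Y} h (h k)) * h k j)"
        by (rule sum.cong) (simp_all add: inv mult.commute)
      then show ?thesis using reindex[of "\<lambda>x. w (the_inv_into {..<card Y} h x) * x j"] by simp
    qed
    show "(\<lambda>j. \<Sum>k<card Y. h k j * w k) \<in> N" if "\<And>k. k < card Y \<Longrightarrow> w k \<in> polys n" for w
      by (rule graded_sub_lspan[OF N YN], rule lspanI[OF _ conv]) (use that invY in auto)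
    show "w k \<in> irrelevant_ideal n" if w: "\<And>k. k < card Y \<Longrightarrow> w k \<in> polys n"
      and z: "\<And>j. (\<Sum>k<card Y. h k j * w k) = 0" and k: "k < card Y" for w k
    proof -
      have "w (the_inv_into {..<card Y} h (h k)) \<in> irrelevant_ideal n"
      proof (rule irr[of "\<lambda>x. w (the_inv_into {..<card Y} h x)" "h k"])
        show "w (the_inv_into {..<card Y} h x) \<in> polys n" if "x \<in> Y" for x by (rule w[OF invY[OF that]])
        show "(\<Sum>x\<in>Y. w (the_inv_into {..<card Y} h x) * x j) = 0" for j using z[of j] by (simp only: conv)
      qed (rule hY[OF k])
      then show ?thesis by (simp add: inv k)
    qed
  qed
qed

section \<open>Construction of the later maps of a minimal resolution\<close>

definition kernel_set :: "nat \<Rightarrow> nat \<Rightarrow> nat \<Rightarrow> (nat \<Rightarrow> nat \<Rightarrow> 'k::field mpoly) \<Rightarrow> (nat \<Rightarrow> 'k mpoly) set" where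
  "kernel_set n r c A = {v. (\<forall>j<c. v j \<in> polys n) \<and> (\<forall>j\<ge>c. v j = 0) \<and> (\<forall>i<r. ap c A v i = 0)}"

lemma graded_sub_kernel:
  assumes hom: "\<And>i j. i < r \<Longrightarrow> j < c \<Longrightarrow> homogeneous (dc j - dr i) (A i j)"
  shows "graded_sub n c dc (kernel_set n r c A)"
  unfolding graded_sub_def
proof (intro conjI ballI allI)
  show "(\<lambda>j. v j + w j) \<in> kernel_set n r c A" if "v \<in> kernel_set n r c A" "w \<in> kernel_set n r c A" for v w
    using that by (simp add: kernel_set_def ap_add)
  show "(\<lambda>j. f * v j) \<in> kernel_set n r c A" if "f \<in> polys n" "v \<in> kernel_set n r c A" for f v
    using that by (simp add: kernel_set_def ap_mult)
  show "(\<lambda>j. hcomp (e - dc j) (v j)) \<in> kernel_set n r c A" if v: "v \<in> kernel_set n r c A" for e v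
  proof -
    have "ap c A (\<lambda>j. hcomp (e - dc j) (v j)) i = 0" if i: "i < r" for i
    proof -
      have "ap c A (\<lambda>j. hcomp (e - dc j) (v j)) i = (\<Sum>j<c. hcomp (e - dr i) (A i j * v j))"
        unfolding ap_def
      proof (rule sum.cong)
        fix j assume "j \<in> {..<c}"
        then show "A i j * hcomp (e - dc j) (v j) = hcomp (e - dr i) (A i j * v j)"
          using hcomp_mult'[OF hom[OF i, of j], of "e - dr i" "v j"] by simp
      qed simp
      also have "\<dots> = hcomp (e - dr i) (ap c A v i)" by (simp add: ap_def hcomp_sum)
      finally show ?thesis using v i by (simp add: kernel_set_def)
    qed
    then show ?thesis using v by (simp add: kernel_set_def)
  qed
qed (auto simp: kernel_set_def)

text \<open>\<open>graded_sub_minimal_generators\<close> for a kernel. The last conclusion, on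
  relations between the new columns, is what makes the following matrix minimal.\<close>

lemma minimal_kernel_generators:
  fixes A :: "nat \<Rightarrow> nat \<Rightarrow> 'k::field mpoly"
  assumes hom: "\<And>i j. i < r \<Longrightarrow> j < c \<Longrightarrow> homogeneous (dc j - dr i) (A i j)"
    and X: "finite X" "X \<subseteq> kernel_set n r c A" "\<And>x. x \<in> X \<Longrightarrow> \<exists>e. graded_vec c dc e x \<and> P e" "kernel_set n r c A \<subseteq> lspan n X"
  obtains c' de B where
    "\<And>j k. j < c \<Longrightarrow> k < c' \<Longrightarrow> B j k \<in> polys n \<and> homogeneous (de k - dc j) (B j k)"
    "\<And>k. k < c' \<Longrightarrow> P (de k)"
    "\<And>v. (\<And>j. j < c \<Longrightarrow> v j \<in> polys n) \<Longrightarrow> (\<forall>i<r. ap c A v i = 0) \<longleftrightarrow>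
      (\<exists>w. (\<forall>k<c'. w k \<in> polys n) \<and> (\<forall>j<c. v j = ap c' B w j))"
    "\<And>w k. (\<And>k. k < c' \<Longrightarrow> w k \<in> polys n) \<Longrightarrow> (\<forall>j<c. ap c' B w j = 0) \<Longrightarrow> k < c' \<Longrightarrow> w k \<in> irrelevant_ideal n"
proof -
  let ?N = "kernel_set n r c A"
  have N: "graded_sub n c dc ?N" by (rule graded_sub_kernel[OF hom])
  obtain c' :: nat and de B where
    1: "\<And>k. k < c' \<Longrightarrow> B k \<in> ?N \<and> graded_vec c dc (de k) (B k) \<and> P (de k)" and
    2: "\<And>v. v \<in> ?N \<Longrightarrow> \<exists>w. (\<forall>k<c'. w k \<in> polys n) \<and> (\<forall>j. v j = (\<Sum>k<c'. B k j * w k))" and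
    3: "\<And>w. (\<And>k. k < c' \<Longrightarrow> w k \<in> polys n) \<Longrightarrow> (\<lambda>j. \<Sum>k<c'. B k j * w k) \<in> ?N" and
    4: "\<And>w k. (\<And>k. k < c' \<Longrightarrow> w k \<in> polys n) \<Longrightarrow> (\<And>j. (\<Sum>k<c'. B k j * w k) = 0) \<Longrightarrow> k < c' \<Longrightarrow> w k \<in> irrelevant_ideal n"
    by (rule graded_sub_minimal_generators[OF N X]) blast+
  have Bge: "B k j = 0" if "k < c'" "j \<ge> c" for k j using 1[OF that(1)] that(2) by (simp add: kernel_set_def)
  show thesis
  proof (rule that[of c' "\<lambda>j k. B k j" de])
    show "B k j \<in> polys n \<and> homogeneous (de k - dc j) (B k j)" if "j < c" "k < c'" for j k
      using 1[OF that(2)] that by (auto simp: kernel_set_def graded_vec_def)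
    show "P (de k)" if "k < c'" for k using 1[OF that] by blast
    show "(\<forall>i<r. ap c A v i = 0) \<longleftrightarrow> (\<exists>w. (\<forall>k<c'. w k \<in> polys n) \<and> (\<forall>j<c. v j = ap c' (\<lambda>j k. B k j) w j))"
      if v: "\<And>j. j < c \<Longrightarrow> v j \<in> polys n" for v
    proof
      assume K: "\<forall>i<r. ap c A v i = 0"
      define u where "u j = (if j < c then v j else 0)" for j
      have "ap c A u i = ap c A v i" for i by (rule ap_cong) (simp add: u_def)
      then have "u \<in> ?N" using K v by (simp add: kernel_set_def u_def)
      then obtain w where "\<forall>k<c'. w k \<in> polys n" "\<forall>j. u j = (\<Sum>k<c'. B k j * w k)" using 2 by blast
      then show "\<exists>w. (\<forall>k<c'. w k \<in> polys n) \<and> (\<forall>j<c. v j = ap c' (\<lambda>j k. B k j) w j)"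
        by (intro exI[of _ w]) (auto simp: ap_def u_def split: if_splits)
    next
      assume "\<exists>w. (\<forall>k<c'. w k \<in> polys n) \<and> (\<forall>j<c. v j = ap c' (\<lambda>j k. B k j) w j)"
      then obtain w where w: "\<forall>k<c'. w k \<in> polys n" "\<forall>j<c. v j = ap c' (\<lambda>j k. B k j) w j" by blast
      have "ap c A v i = ap c A (\<lambda>j. \<Sum>k<c'. B k j * w k) i" for i
        by (rule ap_cong) (use w in \<open>simp add: ap_def\<close>)
      then show "\<forall>i<r. ap c A v i = 0" using 3[of w] w by (simp add: kernel_set_def)
    qed
    show "w k \<in> irrelevant_ideal n" if w: "\<And>k. k < c' \<Longrightarrow> w k \<in> polys n"
      and z: "\<forall>j<c. ap c' (\<lambda>j k. B k j) w j = 0" and k: "k < c'" for w k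
    proof (rule 4[OF w _ k])
      show "(\<Sum>k<c'. B k j * w k) = 0" for j
        using z Bge by (cases "j < c") (auto simp: ap_def)
    qed
  qed
qed

text \<open>
  A stage consists of a matrix with its numbers of rows and columns and their degrees. Its kernel
  has to lie in the irrelevant ideal times the free module, so that the next matrix is minimal.
\<close>

definition stage :: "nat \<Rightarrow> nat \<times> (nat \<Rightarrow> int) \<times> nat \<times> (nat \<Rightarrow> int) \<times> (nat \<Rightarrow> nat \<Rightarrow> 'k::field mpoly) \<Rightarrow> bool" where
  "stage n = (\<lambda>(r, dr, c, dc, A).
     (\<forall>i<r. \<forall>j<c. A i j \<in> irrelevant_ideal n \<and> homogeneous (dc j - dr i) (A i j)) \<and>
     (\<forall>w. (\<forall>k<c. w k \<in> polys n) \<longrightarrow> (\<forall>i<r. ap c A w i = 0) \<longrightarrow> (\<forall>k<c. w k \<in> irrelevant_ideal n)))"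

definition next_stage :: "nat \<Rightarrow> nat \<times> (nat \<Rightarrow> int) \<times> nat \<times> (nat \<Rightarrow> int) \<times> (nat \<Rightarrow> nat \<Rightarrow> 'k::field mpoly) \<Rightarrow>
    nat \<times> (nat \<Rightarrow> int) \<times> nat \<times> (nat \<Rightarrow> int) \<times> (nat \<Rightarrow> nat \<Rightarrow> 'k mpoly) \<Rightarrow> bool" where
  "next_stage n = (\<lambda>(r, dr, c, dc, A) (r', dr', c', dc', A'). r' = c \<and> dr' = dc \<and>
     (\<forall>v. (\<forall>j<c. v j \<in> polys n) \<longrightarrow> ((\<forall>i<r. ap c A v i = 0) \<longleftrightarrow>
       (\<exists>w. (\<forall>k<c'. w k \<in> polys n) \<and> (\<forall>j<c. v j = ap c' A' w j)))))"

text \<open>The columns of the new matrix lie in the kernel of \<open>A\<close>, so the second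
  condition on \<open>s\<close> places their entries in the irrelevant ideal; the minimal choice of
  generators restores that condition for the new stage.\<close>

lemma stage_step:
  fixes s :: "nat \<times> (nat \<Rightarrow> int) \<times> nat \<times> (nat \<Rightarrow> int) \<times> (nat \<Rightarrow> nat \<Rightarrow> 'k::field mpoly)"
  assumes "stage n s"
  shows "\<exists>s'. stage n s' \<and> next_stage n s s'"
proof -
  obtain r dr c dc A where s: "s = (r, dr, c, dc, A)" by (cases s)
  have hom: "homogeneous (dc j - dr i) (A i j)" if "i < r" "j < c" for i j
    using assms that by (simp add: s stage_def)
  have irr: "w k \<in> irrelevant_ideal n" if "\<And>k. k < c \<Longrightarrow> w k \<in> polys n" "\<And>i. i < r \<Longrightarrow> ap c A w i = 0" "k < c" for w k
    using assms that by (simp add: s stage_def)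
  have N: "graded_sub n c dc (kernel_set n r c A)" by (rule graded_sub_kernel[OF hom])
  obtain X where X: "finite X" "X \<subseteq> kernel_set n r c A" "\<And>x. x \<in> X \<Longrightarrow> \<exists>e. graded_vec c dc e x" "kernel_set n r c A \<subseteq> lspan n X"
    by (rule graded_sub_finitely_generated[OF N]) blast
  have X3: "\<exists>e. graded_vec c dc e x \<and> True" if "x \<in> X" for x using X(3)[OF that] by simp
  obtain c' de B where
    B: "\<And>j k. j < c \<Longrightarrow> k < c' \<Longrightarrow> B j k \<in> polys n \<and> homogeneous (de k - dc j) (B j k)" and
    ex: "\<And>v. (\<And>j. j < c \<Longrightarrow> v j \<in> polys n) \<Longrightarrow> (\<forall>i<r. ap c A v i = 0) \<longleftrightarrow>
      (\<exists>w. (\<forall>k<c'. w k \<in> polys n) \<and> (\<forall>j<c. v j = ap c' B w j))" and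
    min: "\<And>w k. (\<And>k. k < c' \<Longrightarrow> w k \<in> polys n) \<Longrightarrow> (\<forall>j<c. ap c' B w j = 0) \<Longrightarrow> k < c' \<Longrightarrow> w k \<in> irrelevant_ideal n"
    by (rule minimal_kernel_generators[where P = "\<lambda>_. True", OF hom X(1,2) X3 X(4)]) blast+
  have "B j k \<in> irrelevant_ideal n" if "j < c" "k < c'" for j k
  proof (rule irr[OF _ _ that(1)])
    show "B j k \<in> polys n" if "j < c" for j using B[OF that \<open>k < c'\<close>] by blast
    have "\<forall>i<r. ap c A (\<lambda>j. B j k) i = 0"
    proof (rule ex[THEN iffD2])
      show "B j k \<in> polys n" if "j < c" for j using B[OF that \<open>k < c'\<close>] by blast
      show "\<exists>w. (\<forall>k<c'. w k \<in> polys n) \<and> (\<forall>j<c. B j k = ap c' B w j)"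
        by (rule exI[of _ "\<lambda>l. if l = k then 1 else 0"]) (use that in \<open>simp add: ap_def if_distrib cong: if_cong\<close>)
    qed
    then show "ap c A (\<lambda>j. B j k) i = 0" if "i < r" for i using that by blast
  qed
  then have "stage n (c, dc, c', de, B)" using B min by (simp add: stage_def)
  moreover have "next_stage n s (c, dc, c', de, B)" using ex by (simp add: s next_stage_def)
  ultimately show ?thesis by blast
qed

text \<open>For a linear presentation only the generators and the first matrix are constructed by
  hand, while the definition asks for a complete minimal resolution. Dependent choice on stages
  supplies the rest.\<close>

lemma minimal_resolution_extension:
  fixes A0 :: "nat \<Rightarrow> nat \<Rightarrow> 'k::field mpoly"
  assumes st: "stage n (r, dr, c, dc, A0)"
    and g: "\<And>j. j < r \<Longrightarrow> g j \<in> polys n \<and> homogeneous (dr j) (g j)"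
    and I: "\<And>f. f \<in> I \<longleftrightarrow> (\<exists>v. (\<forall>j<r. v j \<in> polys n) \<and> f = ap r (\<lambda>_. g) v 0)"
    and ex: "\<And>v. (\<And>j. j < r \<Longrightarrow> v j \<in> polys n) \<Longrightarrow> ap r (\<lambda>_. g) v 0 = 0 \<longleftrightarrow>
      (\<exists>w. (\<forall>k<c. w k \<in> polys n) \<and> (\<forall>j<r. v j = ap c A0 w j))"
  obtains b d A where "minimal_graded_free_resolution n I b d (vec (b 0) g) A"
    "b 0 = r" "b 1 = c" "\<And>i j. i < r \<Longrightarrow> j < c \<Longrightarrow> A 0 $$ (i, j) = A0 i j"
proof -
  \<comment> \<open>Pins the sequence of stages to the prescribed first matrix.\<close>
  define P where "P i s \<longleftrightarrow> stage n s \<and> (i = 0 \<longrightarrow> s = (r, dr, c, dc, A0))"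
    for i :: nat and s :: "nat \<times> (nat \<Rightarrow> int) \<times> nat \<times> (nat \<Rightarrow> int) \<times> (nat \<Rightarrow> nat \<Rightarrow> 'k mpoly)"
  have "\<exists>s. P 0 s" using st by (auto simp: P_def)
  moreover have "\<exists>s'. P (Suc i) s' \<and> next_stage n s s'" if "P i s" for i s
    using stage_step[of n s] that by (auto simp: P_def)
  ultimately obtain S where S: "\<And>i. P i (S i) \<and> next_stage n (S i) (S (Suc i))"
    using dependent_nat_choice[of P "\<lambda>_. next_stage n"] by blast
  define b where "b i = fst (S i)" for i
  define d where "d i = fst (snd (S i))" for i
  define A where "A i = snd (snd (snd (snd (S i))))" for i
  have Si: "S i = (b i, d i, b (Suc i), d (Suc i), A i)" for i
  proof -
    obtain r1 d1 c1 e1 A1 where 1: "S i = (r1, d1, c1, e1, A1)" by (cases "S i")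
    obtain r2 d2 c2 e2 A2 where 2: "S (Suc i) = (r2, d2, c2, e2, A2)" by (cases "S (Suc i)")
    show ?thesis using S[of i] 1 2 by (simp add: next_stage_def b_def d_def A_def)
  qed
  have S0: "b 0 = r" "d 0 = dr" "b (Suc 0) = c" "A 0 = A0"
    using S[of 0] Si[of 0] by (auto simp: P_def)
  have stA: "A i p q \<in> irrelevant_ideal n \<and> homogeneous (d (Suc i) q - d i p) (A i p q)"
    if "p < b i" "q < b (Suc i)" for i p q
    using S[of i] that by (simp add: P_def Si stage_def)
  have exA: "(\<forall>p<b i. ap (b (Suc i)) (A i) v p = 0) \<longleftrightarrow>
      (\<exists>w. (\<forall>k<b (Suc (Suc i)). w k \<in> polys n) \<and> (\<forall>j<b (Suc i). v j = ap (b (Suc (Suc i))) (A (Suc i)) w j))"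
    if "\<And>j. j < b (Suc i) \<Longrightarrow> v j \<in> polys n" for i v
    using S[of i] that by (simp add: Si next_stage_def)
  have F: "fresolution n I b g A"
  proof (rule fresolutionI_ap)
    show "A i p q \<in> polys n" if "p < b i" "q < b (Suc i)" for i p q
      using stA[OF that] by (simp add: irrelevant_ideal_def)
  qed (use g I ex exA S0 in simp_all)
  have "minimal_graded_free_resolution n I b d (vec (b 0) g) (\<lambda>i. mat (b i) (b (Suc i)) (\<lambda>(r, c). A i r c))"
    by (rule minimal_graded_free_resolutionI[OF F]) (use g S0 stA in simp_all)
  then show thesis by (rule that) (simp_all add: S0)
qed

section \<open>Linear presentations of edge ideals\<close>

definition esum :: "nat set \<Rightarrow> monomial" where
  "esum e = (\<Sum>i\<in>e. mvar i)"

lemma lookup_esum: "finite e \<Longrightarrow> lookup (esum e) i = (if i \<in> e then 1 else 0)"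
  by (simp add: esum_def lookup_sum lookup_mvar)

lemma keys_esum: "finite e \<Longrightarrow> keys (esum e) = e"
  by (auto simp: in_keys_iff lookup_esum split: if_splits)

lemma mdeg_esum: "finite e \<Longrightarrow> mdeg (esum e) = card e"
  by (subst mdeg_eq_sum[of e]) (auto simp: keys_esum lookup_esum)

lemma graph_monomials_iff:
  assumes "G \<subseteq> vertex_pairs n"
  shows "m \<in> graph_monomials G \<longleftrightarrow> (\<exists>e\<in>G. \<exists>k. m = esum e + k)"
proof
  assume "m \<in> graph_monomials G"
  then obtain i j where ij: "{i, j} \<in> G" "i \<noteq> j" "lookup m i \<ge> 1" "lookup m j \<ge> 1"
    by (auto simp: graph_monomials_def)
  have "m = esum {i, j} + (m - Poly_Mapping.single i 1 - Poly_Mapping.single j 1)"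
    by (subst monomial_split2[OF ij(2-4)]) (simp add: esum_def mvar_def ij(2) add.commute)
  then show "\<exists>e\<in>G. \<exists>k. m = esum e + k" using ij(1) by blast
next
  assume "\<exists>e\<in>G. \<exists>k. m = esum e + k"
  then obtain e k where e: "e \<in> G" "m = esum e + k" by blast
  then obtain i j where ij: "e = {i, j}" "i \<noteq> j"
    using assms unfolding vertex_pairs_def by (auto simp: card_2_iff)
  have "lookup m i \<ge> 1 \<and> lookup m j \<ge> 1" by (simp add: e(2) ij(1) lookup_add lookup_esum)
  then show "m \<in> graph_monomials G" unfolding graph_monomials_def using e(1) ij by blast
qed

text \<open>The complement of two disjoint edges on their four vertices is a 4-cycle; listing the
  vertices alternately makes the two edges of \<open>G\<close> its diagonals.\<close>

lemma induced_4_cycleI: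
  assumes E: "{a, a'} \<in> G" "{c, c'} \<in> G" and nE: "{a, c} \<notin> G" "{a, c'} \<notin> G" "{a', c} \<notin> G" "{a', c'} \<notin> G"
    and d: "distinct [a, c, a', c']" "set [a, c, a', c'] \<subseteq> {1..n}"
  shows "induced_cycle n G [a, c, a', c']"
  unfolding induced_cycle_def
proof (intro conjI allI impI d)
  fix i l assume il: "i < l" "l < length [a, c, a', c']"
  then have "(i, l) \<in> {(0, 1), (0, 2), (0, 3), (1, 2), (1, 3), (2, 3)}" by auto
  then show "({[a, c, a', c'] ! i, [a, c, a', c'] ! l} \<notin> G) = (l = Suc i \<or> i = 0 \<and> Suc l = length [a, c, a', c'])"
    using nE E by (auto simp: insert_commute numeral_eq_Suc)
qed

text \<open>The relation of a pair of edge monomials: each is multiplied by what it lacks to their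
  least common multiple. As the monomials are squarefree, the missing factors are products over set
  differences.\<close>

definition syz :: "(nat \<Rightarrow> nat set) \<Rightarrow> nat \<Rightarrow> nat \<Rightarrow> nat \<Rightarrow> 'k::field mpoly" where
  "syz h j k i = (if i = j then Poly_Mapping.single (esum (h k - h j)) 1 else 0) -
     (if i = k then Poly_Mapping.single (esum (h j - h k)) 1 else 0)"

text \<open>
  The syzygies of a set of monomials are generated by the pairwise ones. If every two disjoint
  edges are joined by a third edge, the pairwise syzygy of two disjoint edges is a combination of
  linear ones through the third edge.
\<close>

theorem no_induced_4_cycle_imp_linear_presentation:
  assumes G: "G \<subseteq> vertex_pairs n"
    and no4: "\<And>vs. length vs = 4 \<Longrightarrow> \<not> induced_cycle n G vs"
  shows "has_linear_presentation n (edge_ideal n G :: 'k::field mpoly set)"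
proof -
  have finG: "finite G"
    by (rule finite_subset[OF G]) (simp add: vertex_pairs_def)
  obtain h where "bij_betw h {0..<card G} G" using ex_bij_betw_nat_finite[OF finG] by blast
  then have h: "bij_betw h {..<card G} G" by (simp add: lessThan_atLeast0)
  define r where "r = card G"
  have hG: "h j \<in> G" if "j < r" for j using h that by (auto simp: bij_betw_def r_def)
  have hsurj: "\<exists>j<r. h j = e" if "e \<in> G" for e
  proof -
    have "e \<in> h ` {..<r}" using h that by (simp add: bij_betw_def r_def)
    then show ?thesis by blast
  qed
  have hinj: "h j = h k \<longleftrightarrow> j = k" if "j < r" "k < r" for j k
    using h that by (auto simp: bij_betw_def r_def inj_on_def)
  have card2: "card (h j) = 2" and hn: "h j \<subseteq> {1..n}" and hfin: "finite (h j)" if "j < r" for j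
    using hG[OF that] G by (auto simp: vertex_pairs_def intro: finite_subset)
  define g where "g j = Poly_Mapping.single (esum (h j)) (1::'k)" for j
  have gp: "g j \<in> polys n \<and> homogeneous 2 (g j)" if "j < r" for j
    using hn[OF that] hfin[OF that] card2[OF that]
    by (simp add: g_def polys_single homogeneous_single keys_esum mdeg_esum)
  define K where "K = kernel_set n 1 r (\<lambda>_. g)"
  have syz_ker: "syz h j k \<in> K" if "j < r" "k < r" for j k
  proof -
    have p: "Poly_Mapping.single (esum (h k - h j)) (1::'k) \<in> polys n" if "j < r" "k < r" for j k
      using hn[OF that(2)] hfin[OF that(2)] by (intro polys_single) (auto simp: keys_esum)
    have "ap r (\<lambda>_. g) (syz h j k) 0 = (\<Sum>i<r. (if i = j then g i * Poly_Mapping.single (esum (h k - h j)) 1 else 0) -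
        (if i = k then g i * Poly_Mapping.single (esum (h j - h k)) 1 else 0))"
      unfolding ap_def by (rule sum.cong) (auto simp: syz_def right_diff_distrib)
    also have "\<dots> = g j * Poly_Mapping.single (esum (h k - h j)) 1 - g k * Poly_Mapping.single (esum (h j - h k)) 1"
      using that by (simp add: sum_subtractf)
    also have "esum (h j) + esum (h k - h j) = esum (h k) + esum (h j - h k)"
      by (rule poly_mapping_eqI) (use hfin that in \<open>auto simp: lookup_add lookup_esum\<close>)
    then have "g j * Poly_Mapping.single (esum (h k - h j)) 1 - g k * Poly_Mapping.single (esum (h j - h k)) 1 = 0"
      by (simp add: g_def mult_single)
    finally have "ap r (\<lambda>_. g) (syz h j k) 0 = 0" .
    moreover have "(syz h j k i :: 'k mpoly) \<in> polys n" for i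
      unfolding syz_def by (intro polys_diff) (use p[OF that] p[OF that(2,1)] in auto)
    moreover have "syz h j k i = (0 :: 'k mpoly)" if "i \<ge> r" for i using \<open>j < r\<close> \<open>k < r\<close> that by (simp add: syz_def)
    ultimately show ?thesis by (simp add: K_def kernel_set_def)
  qed
  have gsubK: "graded_sub n r (\<lambda>_. 2) K"
    unfolding K_def by (rule graded_sub_kernel[where dr = "\<lambda>_. 0"]) (use gp in simp)
  \<comment> \<open>Pairs of distinct edges with a common vertex: both coefficients of their syzygy
    are variables.\<close>
  define X :: "(nat \<Rightarrow> 'k mpoly) set" where "X = {syz h j k |j k. j < r \<and> k < r \<and> j \<noteq> k \<and> h j \<inter> h k \<noteq> {}}"
  have finX: "finite X"
  proof -
    have "X \<subseteq> (\<lambda>(j, k). syz h j k) ` ({..<r} \<times> {..<r})" by (auto simp: X_def)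
    then show ?thesis by (rule finite_subset) simp
  qed
  have XK: "X \<subseteq> K" using syz_ker by (auto simp: X_def)
  \<comment> \<open>Total degree 3 is the generator degree 2 plus 1. Kept as the predicate on
    degrees, it survives the passage to minimal generators and forces linear entries.\<close>
  have Xhel: "\<exists>e. graded_vec r (\<lambda>_. 2) e x \<and> e = 3" if x: "x \<in> X" for x
  proof -
    obtain j k where jk: "x = syz h j k" "j < r" "k < r" "j \<noteq> k" "h j \<inter> h k \<noteq> {}"
      using x unfolding X_def by blast
    have one: "card (h k - h j) = 1" if "j < r" "k < r" "j \<noteq> k" "h j \<inter> h k \<noteq> {}" for j k
    proof -
      have "card (h k) = card (h k - h j) + card (h k \<inter> h j)"
        using hfin[OF that(2)] card_Int_Diff[of "h k" "h j"] by simp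
      moreover have "card (h k \<inter> h j) \<noteq> 0" using hfin[OF that(2)] that(4) by auto
      moreover have "card (h k - h j) \<noteq> 0"
      proof
        assume "card (h k - h j) = 0"
        then have "h k \<subseteq> h j" using hfin[OF that(2)] by auto
        then have "h k = h j" using card2 that hfin by (intro card_subset_eq) auto
        then show False using hinj that by blast
      qed
      ultimately show ?thesis using card2[OF that(2)] by linarith
    qed
    have "homogeneous 1 (syz h j k i :: 'k mpoly)" for i
      unfolding syz_def using one[of j k] one[of k j] jk hfin
      by (intro homogeneous_diff) (auto intro!: homogeneous_single simp: mdeg_esum Int_commute)
    then show ?thesis unfolding jk(1) by (simp add: graded_vec_def)
  qed
  have syzX: "syz h j k \<in> lspan n X" if jk: "j < r" "k < r" for j k
  proof (cases "j = k \<or> h j \<inter> h k \<noteq> {}")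
    case True
    show ?thesis
    proof (cases "j = k")
      case True
      then have "syz h j k = (\<lambda>_. 0 :: 'k mpoly)" by (auto simp: syz_def)
      then show ?thesis using lspan_zero by metis
    next
      case False
      then have "syz h j k \<in> X" using True jk by (auto simp: X_def)
      then show ?thesis by (rule lspan_superset[OF finX])
    qed
  next
    case False
    obtain a a' where a: "h j = {a, a'}" "a \<noteq> a'" using card2[OF jk(1)] by (auto simp: card_2_iff)
    obtain c c' where c: "h k = {c, c'}" "c \<noteq> c'" using card2[OF jk(2)] by (auto simp: card_2_iff)
    have disj: "a \<noteq> c" "a \<noteq> c'" "a' \<noteq> c" "a' \<noteq> c'" using False a c by auto
    \<comment> \<open>If no edge of \<open>G\<close> joined the two disjoint edges, their vertices
      would form an induced 4-cycle of the complement.\<close>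
    have "\<exists>p p' q q'. h j = {p, p'} \<and> h k = {q, q'} \<and> {p, q} \<in> G"
    proof (rule ccontr)
      assume neg: "\<not> ?thesis"
      have *: "{p, q} \<notin> G" if "h j = {p, p'}" "h k = {q, q'}" for p p' q q' using neg that by blast
      have nE: "{a, c} \<notin> G" "{a, c'} \<notin> G" "{a', c} \<notin> G" "{a', c'} \<notin> G"
        using *[of a a' c c'] *[of a a' c' c] *[of a' a c c'] *[of a' a c' c] a(1) c(1) by (simp_all add: insert_commute)
      have E: "{a, a'} \<in> G" "{c, c'} \<in> G" using hG jk a c by metis+
      have "induced_cycle n G [a, c, a', c']"
        using disj a c hn[OF jk(1)] hn[OF jk(2)] by (intro induced_4_cycleI E nE) auto
      then show False using no4 by simp
    qed
    then obtain p p' q q' where pq: "h j = {p, p'}" "h k = {q, q'}" "{p, q} \<in> G" by blast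
    have d: "p \<noteq> p'" "q \<noteq> q'" "p \<noteq> q" "p \<noteq> q'" "p' \<noteq> q" "p' \<noteq> q'"
      using pq a c disj False by (auto simp: doubleton_eq_iff)
    obtain l where l: "l < r" "h l = {p, q}" using hsurj[OF pq(3)] by blast
    have lj: "l \<noteq> j" "l \<noteq> k" using l pq d by (auto simp: doubleton_eq_iff)
    have "syz h j l \<in> X" "syz h l k \<in> X"
      using l lj jk pq unfolding X_def by blast+
    \<comment> \<open>Passing through the third edge \<open>{p, q}\<close>, the two summands have
      \<open>x_p' x_q'\<close> with opposite signs at position \<open>l\<close>, which
      cancels.\<close>
    then have "(\<lambda>i. Poly_Mapping.single (mvar q') 1 * syz h j l i + Poly_Mapping.single (mvar p') 1 * syz h l k i) \<in> lspan n X"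
      using hn[OF jk(1)] hn[OF jk(2)] pq
      by (intro lspan_add lspan_scale lspan_superset finX polys_single) auto
    moreover have "(\<lambda>i. Poly_Mapping.single (mvar q') 1 * syz h j l i + Poly_Mapping.single (mvar p') 1 * syz h l k i) = (syz h j k :: nat \<Rightarrow> 'k mpoly)"
    proof
      fix i
      have D: "h l - h j = {q}" "h j - h l = {p'}" "h k - h l = {q'}" "h l - h k = {p}" "h k - h j = {q, q'}" "h j - h k = {p, p'}"
        using l pq d by auto
      show "Poly_Mapping.single (mvar q') 1 * syz h j l i + Poly_Mapping.single (mvar p') 1 * syz h l k i = (syz h j k i :: 'k mpoly)"
      proof -
        have es: "esum {q} = mvar q" "esum {p} = mvar p" "esum {q'} = mvar q'" "esum {p'} = mvar p'"
          "esum {q, q'} = mvar q' + mvar q" "esum {p, p'} = mvar p' + mvar p"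
          using d by (simp_all add: esum_def add.commute)
        have "j \<noteq> k" using False by simp
        then consider "i = j" "i \<noteq> l" "i \<noteq> k" | "i = l" "i \<noteq> j" "i \<noteq> k" | "i = k" "i \<noteq> j" "i \<noteq> l"
          | "i \<noteq> j" "i \<noteq> l" "i \<noteq> k" using lj by metis
        then show ?thesis
          by cases (simp_all add: syz_def D es mult_single add.commute[of "mvar p'" "mvar q'"])
      qed
    qed
    ultimately show ?thesis by simp
  qed
  \<comment> \<open>A term of \<open>g j * v j\<close> has to cancel against a term of some other
    \<open>g k * v k\<close>. Subtracting the matching multiple of the pairwise syzygy deletes the
    monomial at \<open>j\<close> and adds no new one at \<open>k\<close>, so the total number of
    terms falls.\<close>
  have KX: "v \<in> lspan n X" if "v \<in> K" for v
    using that
  proof (induction "\<Sum>j<r. card (keys (v j))" arbitrary: v rule: less_induct)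
    case less
    show ?case
    proof (cases "\<forall>j<r. v j = 0")
      case True
      then have "v = (\<lambda>_. 0)" using graded_sub_ge[OF gsubK less.prems] by (metis not_less ext)
      then show ?thesis using lspan_zero by metis
    next
      case False
      then obtain j where j: "j < r" "v j \<noteq> 0" by blast
      then obtain m where "lookup (v j) m \<noteq> 0" by (metis lookup_zero poly_mapping_eqI)
      then have m: "m \<in> keys (v j)" by (simp add: in_keys_iff)
      have sum0: "(\<Sum>i<r. g i * v i) = 0" using less.prems by (simp add: K_def kernel_set_def ap_def)
      have lj: "lookup (g j * v j) (esum (h j) + m) \<noteq> 0"
        unfolding g_def lookup_single_mult using m by (simp add: in_keys_iff)
      have "\<exists>k<r. k \<noteq> j \<and> lookup (g k * v k) (esum (h j) + m) \<noteq> 0"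
      proof (rule ccontr)
        assume "\<not> ?thesis"
        then have z: "lookup (g k * v k) (esum (h j) + m) = 0" if "k < r" "k \<noteq> j" for k using that by blast
        have "0 = (\<Sum>i<r. lookup (g i * v i) (esum (h j) + m))"
          using sum0 by (simp add: lookup_sum[symmetric])
        also have "\<dots> = (\<Sum>i<r. if i = j then lookup (g j * v j) (esum (h j) + m) else 0)"
          by (rule sum.cong) (use z in auto)
        also have "\<dots> = lookup (g j * v j) (esum (h j) + m)" using j by simp
        finally show False using lj by simp
      qed
      then obtain k where k: "k < r" "k \<noteq> j" "lookup (g k * v k) (esum (h j) + m) \<noteq> 0" by blast
      then obtain m' where m': "esum (h j) + m = esum (h k) + m'"
        unfolding g_def using lookup_single_mult_not[of "esum (h j) + m" "esum (h k)" 1 "v k"] by blast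
      have m'k: "m' \<in> keys (v k)" using k(3) unfolding m' g_def lookup_single_mult by (simp add: in_keys_iff)
      \<comment> \<open>The monomial common to both products, divided by the least common multiple
        of the two edge monomials.\<close>
      define a where "a = esum (h j) + m - esum (h j \<union> h k)"
      have look: "lookup (esum (h j)) i + lookup m i = lookup (esum (h k)) i + lookup m' i" for i
        using m' by (metis lookup_add)
      have am: "m = a + esum (h k - h j)" "m' = a + esum (h j - h k)"
        using look hfin[OF j(1)] hfin[OF k(1)]
        by (intro poly_mapping_eqI; force simp: a_def lookup_add lookup_minus lookup_esum split: if_splits)+
      have an: "keys a \<subseteq> {1..n}"
      proof -
        have "keys m \<subseteq> {1..n}" using graded_sub_polys[OF gsubK less.prems, of j] m by (auto simp: polys_def)
        then show ?thesis using am(1) by (simp add: keys_add_monomial)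
      qed
      define s where "s = Poly_Mapping.single a (lookup (v j) m)"
      have sp: "s \<in> polys n" unfolding s_def by (rule polys_single[OF an])
      define u where "u i = v i + - s * syz h j k i" for i
      have uK: "u \<in> K" unfolding u_def[abs_def]
        by (intro graded_sub_add[OF gsubK] graded_sub_scale[OF gsubK] less.prems polys_uminus sp syz_ker j k)
      have uj: "u j = v j - Poly_Mapping.single m (lookup (v j) m)"
        using k(2) by (simp add: u_def syz_def s_def mult_single am(1)[symmetric])
      have uk: "u k = v k + Poly_Mapping.single m' (lookup (v j) m)"
        using k(2) by (simp add: u_def syz_def s_def mult_single am(2)[symmetric])
      have ui: "u i = v i" if "i \<noteq> j" "i \<noteq> k" for i using that by (simp add: u_def syz_def)
      have "keys (u j) \<subseteq> keys (v j) - {m}"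
        unfolding uj by (auto simp: in_keys_iff lookup_minus lookup_single when_def split: if_splits)
      then have cj: "card (keys (u j)) < card (keys (v j))"
        using m by (intro psubset_card_mono) auto
      have "keys (u k) \<subseteq> keys (v k)"
        unfolding uk using m'k by (auto simp: in_keys_iff lookup_add lookup_single when_def split: if_splits)
      then have ck: "card (keys (u k)) \<le> card (keys (v k))" by (intro card_mono) auto
      have "(\<Sum>i<r. card (keys (u i))) < (\<Sum>i<r. card (keys (v i)))"
      proof (rule sum_strict_mono_ex1)
        show "\<forall>i\<in>{..<r}. card (keys (u i)) \<le> card (keys (v i))" using cj ck ui by (metis less_imp_le order_refl)
        show "\<exists>i\<in>{..<r}. card (keys (u i)) < card (keys (v i))" using cj j by blast
      qed simp
      from less.hyps[OF this uK] have uX: "u \<in> lspan n X" .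
      have "(\<lambda>i. u i + s * syz h j k i) \<in> lspan n X"
        by (rule lspan_add[OF uX lspan_scale[OF sp syzX[OF j(1) k(1)]]])
      moreover have "(\<lambda>i. u i + s * syz h j k i) = v" by (rule ext) (simp add: u_def)
      ultimately show ?thesis by simp
    qed
  qed
  have homg: "homogeneous (2 - (0::int)) (g j)" if "i < (1::nat)" "j < r" for i j using gp[OF that(2)] by simp
  obtain c de B where
    B: "\<And>j k. j < r \<Longrightarrow> k < c \<Longrightarrow> B j k \<in> polys n \<and> homogeneous (de k - 2) (B j k)" and
    de: "\<And>k. k < c \<Longrightarrow> de k = 3" and
    ex: "\<And>v. (\<And>j. j < r \<Longrightarrow> v j \<in> polys n) \<Longrightarrow> (\<forall>i<(1::nat). ap r (\<lambda>_. g) v i = 0) \<longleftrightarrow>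
      (\<exists>w. (\<forall>k<c. w k \<in> polys n) \<and> (\<forall>j<r. v j = ap c B w j))" and
    min: "\<And>w k. (\<And>k. k < c \<Longrightarrow> w k \<in> polys n) \<Longrightarrow> (\<forall>j<r. ap c B w j = 0) \<Longrightarrow> k < c \<Longrightarrow> w k \<in> irrelevant_ideal n"
    by (rule minimal_kernel_generators[where P = "\<lambda>e. e = 3" and r = 1 and c = r and A = "\<lambda>_. g"
          and dc = "\<lambda>_. 2" and dr = "\<lambda>_. 0" and n = n and X = X,
          OF homg finX XK[unfolded K_def] Xhel subsetI[OF KX, unfolded K_def]]) blast+
  have Blin: "linear_form (B j k)" if "j < r" "k < c" for j k using B[OF that] de[OF that(2)] by simp
  have Birr: "B j k \<in> irrelevant_ideal n" if "j < r" "k < c" for j k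
    using irrelevant_homogeneous[of "B j k" n 1] B[OF that] Blin[OF that] by simp
  have st: "stage n (r, \<lambda>_. 2, c, de, B)" using B Birr min by (simp add: stage_def)
  have I: "f \<in> edge_ideal n G \<longleftrightarrow> (\<exists>v. (\<forall>j<r. v j \<in> polys n) \<and> f = ap r (\<lambda>_. g) v 0)" for f :: "'k mpoly"
  proof
    assume f: "f \<in> edge_ideal n G"
    have "\<exists>v. (\<forall>j<r. v j \<in> polys n) \<and> Poly_Mapping.single m (lookup f m) = ap r (\<lambda>_. g) v 0"
      if m: "m \<in> keys f" for m
    proof -
      have "m \<in> graph_monomials G" using f m unfolding edge_ideal_eq[OF G] mon_ideal_def by blast
      then obtain e k where e: "e \<in> G" "m = esum e + k" unfolding graph_monomials_iff[OF G] by blast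
      then obtain j where j: "j < r" "h j = e" using hsurj by blast
      have "keys m \<subseteq> {1..n}" using f m unfolding edge_ideal_eq[OF G] mon_ideal_def polys_def by blast
      then have k: "keys k \<subseteq> {1..n}" using e(2) by (simp add: keys_add_monomial)
      have "ap r (\<lambda>_. g) (\<lambda>i. if i = j then Poly_Mapping.single k (lookup f m) else 0) 0 =
          (\<Sum>i<r. if i = j then g i * Poly_Mapping.single k (lookup f m) else 0)"
        unfolding ap_def by (rule sum.cong) auto
      also have "\<dots> = Poly_Mapping.single m (lookup f m)" using j e by (simp add: g_def mult_single)
      finally show ?thesis using k
        by (intro exI[of _ "\<lambda>i. if i = j then Poly_Mapping.single k (lookup f m) else 0"]) (simp add: polys_single)
    qed
    then obtain v where v: "\<And>m. m \<in> keys f \<Longrightarrow> (\<forall>j<r. v m j \<in> polys n) \<and> Poly_Mapping.single m (lookup f m) = ap r (\<lambda>_. g) (v m) 0"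
      by metis
    have "f = (\<Sum>m\<in>keys f. ap r (\<lambda>_. g) (v m) 0)"
      by (subst mpoly_sum_singles) (rule sum.cong, use v in auto)
    also have "\<dots> = ap r (\<lambda>_. g) (\<lambda>j. \<Sum>m\<in>keys f. v m j) 0"
      unfolding ap_def by (subst sum.swap) (simp add: sum_distrib_left)
    finally show "\<exists>v. (\<forall>j<r. v j \<in> polys n) \<and> f = ap r (\<lambda>_. g) v 0"
      using v by (intro exI[of _ "\<lambda>j. \<Sum>m\<in>keys f. v m j"] conjI allI impI polys_sum) auto
  next
    assume "\<exists>v. (\<forall>j<r. v j \<in> polys n) \<and> f = ap r (\<lambda>_. g) v 0"
    then obtain v where v: "\<forall>j<r. v j \<in> polys n" "f = ap r (\<lambda>_. g) v 0" by blast
    show "f \<in> edge_ideal n G"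
      unfolding v(2) ap_def edge_ideal_eq[OF G]
    proof (rule mon_ideal_sum)
      fix j assume j: "j \<in> {..<r}"
      have "g j \<in> mon_ideal n (graph_monomials G)"
        using gp[of j] hG[of j] j graph_monomials_iff[OF G, of "esum (h j)"] unfolding mon_ideal_def g_def
        by (auto intro!: bexI[of _ "h j"] exI[of _ 0])
      then have "v j * g j \<in> mon_ideal n (graph_monomials G)"
        using v(1) j by (intro mon_ideal_mult up_closed_graph_monomials) auto
      then show "g j * v j \<in> mon_ideal n (graph_monomials G)" by (simp add: mult.commute)
    qed
  qed
  obtain b d A where res: "minimal_graded_free_resolution n (edge_ideal n G) b d (vec (b 0) g) A"
    and b: "b 0 = r" "b 1 = c" and A0: "\<And>i j. i < r \<Longrightarrow> j < c \<Longrightarrow> A 0 $$ (i, j) = B i j"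
    by (rule minimal_resolution_extension[OF st gp I]) (use ex in auto)
  have "\<forall>i<b 0. \<forall>j<b 1. linear_form (A 0 $$ (i, j))" using b A0 Blin by simp
  then show ?thesis unfolding has_linear_presentation_def using res by blast
qed

lemma has_linear_resolution_imp_presentation:
  "has_linear_resolution n I \<Longrightarrow> has_linear_presentation n I"
  unfolding has_linear_resolution_def has_linear_presentation_def One_nat_def by blast

text \<open>For length 4 the obstruction involves only \<open>4 - 3 = 1\<close> map, the
  presentation matrix.\<close>

lemma linear_presentation_imp_no_induced_4_cycle:
  assumes "G \<subseteq> vertex_pairs n" "has_linear_presentation n (edge_ideal n G :: 'k::field mpoly set)"
    "length vs = 4" "induced_cycle n G vs"
  shows False
proof -
  obtain b d g A where M: "minimal_graded_free_resolution n (edge_ideal n G :: 'k mpoly set) b d g A"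
    and lin: "\<forall>r<b 0. \<forall>c<b 1. linear_form (A 0 $$ (r, c))"
    using assms(2) unfolding has_linear_presentation_def by (elim exE conjE)
  have F: "fresolution n (edge_ideal n G :: 'k mpoly set) b (\<lambda>j. g $ j) (\<lambda>i r c. A i $$ (r, c))"
    and hom: "\<forall>j<b 0. homogeneous (d 0 j) (g $ j)"
    using M unfolding minimal_graded_free_resolution_iff by - ((elim conjE, assumption)+)
  show False
    by (rule linear_imp_no_induced_cycle[OF assms(1) F _ _ _ assms(4), of "d 0"])
       (use hom lin assms(3) in auto)
qed

lemma linear_resolution_imp_no_induced_cycle:
  assumes "G \<subseteq> vertex_pairs n" "has_linear_resolution n (edge_ideal n G :: 'k::field mpoly set)"
    "length vs \<ge> 4" "induced_cycle n G vs"
  shows False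
proof -
  obtain b d g A where M: "minimal_graded_free_resolution n (edge_ideal n G :: 'k mpoly set) b d g A"
    and lin: "\<forall>i. \<forall>r<b i. \<forall>c<b (Suc i). linear_form (A i $$ (r, c))"
    using assms(2) unfolding has_linear_resolution_def by (elim exE conjE)
  have F: "fresolution n (edge_ideal n G :: 'k mpoly set) b (\<lambda>j. g $ j) (\<lambda>i r c. A i $$ (r, c))"
    and hom: "\<forall>j<b 0. homogeneous (d 0 j) (g $ j)"
    using M unfolding minimal_graded_free_resolution_iff by - ((elim conjE, assumption)+)
  show False
    by (rule linear_imp_no_induced_cycle[OF assms(1) F _ assms(3) _ assms(4), of "d 0"])
       (use hom lin in auto)
qed

section \<open>Cycles in graphs\<close>

text \<open>Cycles are counted as edge sets, which depend neither on the starting point nor on the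
  direction of the list. The index modulo the length closes the cycle.\<close>

definition cyc_edges :: "nat list \<Rightarrow> nat set set" where
  "cyc_edges vs = (\<lambda>i. {vs ! i, vs ! (Suc i mod length vs)}) ` {..<length vs}"

definition cycle_lists :: "nat \<Rightarrow> nat \<Rightarrow> nat list set" where
  "cycle_lists n k = {vs. length vs = k \<and> distinct vs \<and> set vs \<subseteq> {1..n}}"

definition cycles :: "nat \<Rightarrow> nat \<Rightarrow> nat set set set" where
  "cycles n k = cyc_edges ` cycle_lists n k"


text \<open>The configuration in the complement that becomes negligible when \<open>n * q\<close>
  stays bounded and \<open>q\<close> tends to 0. A short cycle of the complement with a chord is an
  instance.\<close>

definition dense :: "nat \<Rightarrow> nat \<Rightarrow> nat set set \<Rightarrow> bool" where
  "dense n M G \<longleftrightarrow> (\<exists>V E. V \<subseteq> {1..n} \<and> card V \<le> M \<and> E \<subseteq> Pow V \<inter> vertex_pairs n \<and> card V < card E \<and> E \<inter> G = {})"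

lemma cyc_edge_iff:
  assumes "distinct vs" "3 \<le> length vs" "a < length vs" "c < length vs"
  shows "{vs ! a, vs ! c} \<in> cyc_edges vs \<longleftrightarrow> c = Suc a mod length vs \<or> a = Suc c mod length vs"
proof -
  have "0 < length vs" using assms(2) by linarith
  then have "{vs ! a, vs ! c} = {vs ! i, vs ! (Suc i mod length vs)} \<longleftrightarrow>
      a = i \<and> c = Suc i mod length vs \<or> a = Suc i mod length vs \<and> c = i" if "i < length vs" for i
    using that assms by (auto simp: doubleton_eq_iff nth_eq_iff_index_eq)
  then show ?thesis unfolding cyc_edges_def using assms(3,4) by (auto simp: image_iff)
qed

lemma Suc_mod_less [simp]: "i < k \<Longrightarrow> Suc i mod k < (k::nat)"
  by (rule mod_less_divisor) auto

lemma Suc_mod_cases: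
  assumes "i < (k::nat)"
  shows "Suc i mod k = (if Suc i = k then 0 else Suc i)"
  using assms by auto

lemma card_cyc_edges:
  assumes "distinct vs" "3 \<le> length vs"
  shows "card (cyc_edges vs) = length vs"
proof -
  have "inj_on (\<lambda>i. {vs ! i, vs ! (Suc i mod length vs)}) {..<length vs}"
  proof (rule inj_onI)
    fix i j assume ij: "i \<in> {..<length vs}" "j \<in> {..<length vs}"
      and eq: "{vs ! i, vs ! (Suc i mod length vs)} = {vs ! j, vs ! (Suc j mod length vs)}"
    have "Suc i mod length vs < length vs" "Suc j mod length vs < length vs" using ij by auto
    then have "i = j \<or> (i = Suc j mod length vs \<and> Suc i mod length vs = j)"
      using eq ij assms(1) by (auto simp: doubleton_eq_iff nth_eq_iff_index_eq)
    then show "i = j" using ij assms(2) by (auto simp: Suc_mod_cases split: if_splits)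
  qed
  then show ?thesis unfolding cyc_edges_def by (simp add: card_image)
qed

lemma finite_cyc_edges [simp]: "finite (cyc_edges vs)"
  by (simp add: cyc_edges_def)

lemma cyc_edges_subset: "e \<in> cyc_edges vs \<Longrightarrow> e \<subseteq> set vs"
  by (auto simp: cyc_edges_def)

lemma Union_cyc_edges: "\<Union>(cyc_edges vs) = set vs"
proof
  show "\<Union>(cyc_edges vs) \<subseteq> set vs" using cyc_edges_subset by blast
  show "set vs \<subseteq> \<Union>(cyc_edges vs)" by (auto simp: cyc_edges_def in_set_conv_nth)
qed

lemma cyc_edges_vertex_pairs:
  assumes "distinct vs" "2 \<le> length vs" "set vs \<subseteq> {1..n}"
  shows "cyc_edges vs \<subseteq> vertex_pairs n"
proof
  fix e assume "e \<in> cyc_edges vs"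
  then obtain i where i: "i < length vs" "e = {vs ! i, vs ! (Suc i mod length vs)}" by (auto simp: cyc_edges_def)
  have m: "Suc i mod length vs < length vs" using i(1) by auto
  moreover have "Suc i mod length vs \<noteq> i" using i(1) assms(2) by (auto simp: Suc_mod_cases)
  ultimately have "vs ! i \<noteq> vs ! (Suc i mod length vs)" using assms(1) i(1) by (simp add: nth_eq_iff_index_eq)
  moreover have "vs ! i \<in> {1..n}" "vs ! (Suc i mod length vs) \<in> {1..n}"
    using assms(3) nth_mem[OF i(1)] nth_mem[OF m] by blast+
  ultimately show "e \<in> vertex_pairs n" unfolding i(2) vertex_pairs_mem by blast
qed

text \<open>A vertex of a cycle has two neighbours on it, and distinctness rules out turning back,
  so \<open>ws\<close> is forced to follow \<open>vs\<close> step by step; it can close up only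
  after the full length. Assuming only an inclusion of edge sets serves
  \<open>overlapping_cycles\<close>, where it shows that a cycle contained in another one equals
  it.\<close>

lemma cyc_edges_determined:
  assumes vs: "distinct vs" "3 \<le> length vs" and ws: "distinct ws" "3 \<le> length ws"
    and sub: "cyc_edges ws \<subseteq> cyc_edges vs" and st: "ws ! 0 = vs ! 0" "ws ! 1 = vs ! 1"
  shows "ws = vs"
proof -
  let ?k = "length vs" and ?l = "length ws"
  have step: "i < ?k \<and> ws ! i = vs ! i" if "i < ?l" for i
    using that
  proof (induction i rule: less_induct)
    case (less i)
    consider "i = 0" | "i = 1" | j where "i = Suc (Suc j)" by (metis One_nat_def not0_implies_Suc)
    then show ?case
    proof cases
      case (3 j)
      have j: "j < ?k" "ws ! j = vs ! j" "Suc j < ?k" "ws ! Suc j = vs ! Suc j"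
        using less.IH[of j] less.IH[of "Suc j"] less.prems 3 by auto
      have "{ws ! Suc j, ws ! Suc (Suc j)} \<in> cyc_edges ws"
        using less.prems 3 by (subst cyc_edge_iff[OF ws]) auto
      then have e: "{vs ! Suc j, ws ! i} \<in> cyc_edges vs" using sub j 3 by auto
      then have "ws ! i \<in> set vs" using cyc_edges_subset by blast
      then obtain c where c: "c < ?k" "ws ! i = vs ! c" by (metis in_set_conv_nth)
      have "c = Suc (Suc j) mod ?k \<or> Suc j = Suc c mod ?k"
        using e unfolding c(2) cyc_edge_iff[OF vs j(3) c(1)] .
      moreover have "c \<noteq> j"
      proof
        assume "c = j"
        then have "ws ! i = ws ! j" using c j by simp
        then show False using ws(1) less.prems 3 by (simp add: nth_eq_iff_index_eq)
      qed
      moreover have "c \<noteq> 0"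
      proof
        assume "c = 0"
        then have "ws ! i = ws ! 0" using c st by simp
        moreover have "0 < ?l" using ws(2) by linarith
        ultimately have "i = 0" using nth_eq_iff_index_eq[OF ws(1) less.prems] by blast
        then show False using 3 by simp
      qed
      ultimately have "c = i" using j(3) c(1) 3 by (auto simp: Suc_mod_cases split: if_splits)
      then show ?thesis using c by simp
    qed (use st vs in auto)
  qed
  have lk: "?l \<le> ?k" using step[of "?l - 1"] ws by (cases ?l) auto
  have "{ws ! (?l - 1), ws ! 0} \<in> cyc_edges ws"
  proof -
    have "Suc (?l - 1) = ?l" "0 < ?l" using ws by linarith+
    then show ?thesis by (subst cyc_edge_iff[OF ws]) simp_all
  qed
  then have "{vs ! (?l - 1), vs ! 0} \<in> cyc_edges vs" using sub step[of "?l - 1"] st ws by auto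
  moreover have "?l - 1 < ?k" "0 < ?k" using lk ws by auto
  ultimately have "0 = Suc (?l - 1) mod ?k \<or> ?l - 1 = Suc 0 mod ?k" using cyc_edge_iff[OF vs] by blast
  then have "?l = ?k" using lk ws vs by (auto simp: Suc_mod_cases split: if_splits)
  then show ?thesis using step by (intro nth_equalityI) auto
qed

lemma cyc_edges_rotate:
  assumes "distinct vs" "3 \<le> length vs"
  shows "cyc_edges (rotate m vs) = cyc_edges vs"
proof (rule card_subset_eq)
  show "cyc_edges (rotate m vs) \<subseteq> cyc_edges vs"
  proof
    fix e assume "e \<in> cyc_edges (rotate m vs)"
    then obtain i where i: "i < length vs" "e = {rotate m vs ! i, rotate m vs ! (Suc i mod length vs)}"
      by (auto simp: cyc_edges_def)
    have "Suc i mod length vs < length vs" using i(1) by simp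
    then have "e = {vs ! ((m + i) mod length vs), vs ! (Suc ((m + i) mod length vs) mod length vs)}"
      using i by (simp add: nth_rotate mod_simps)
    moreover have "(m + i) mod length vs < length vs" using i(1) by (intro mod_less_divisor) auto
    ultimately show "e \<in> cyc_edges vs" by (auto simp: cyc_edges_def)
  qed
qed (use assms in \<open>simp_all add: card_cyc_edges\<close>)

lemma cyc_edges_rev:
  assumes "distinct vs" "3 \<le> length vs"
  shows "cyc_edges (rev vs) = cyc_edges vs"
proof (rule card_subset_eq)
  show "cyc_edges (rev vs) \<subseteq> cyc_edges vs"
  proof
    fix e assume "e \<in> cyc_edges (rev vs)"
    then obtain i where i: "i < length vs" "e = {rev vs ! i, rev vs ! (Suc i mod length vs)}"
      by (auto simp: cyc_edges_def)
    show "e \<in> cyc_edges vs"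
    proof (cases "Suc i = length vs")
      case True
      have l: "Suc (length vs - 1) = length vs" "0 < length vs" using assms by linarith+
      have "e = {vs ! (length vs - 1), vs ! 0}" using i True l(2) by (simp add: rev_nth insert_commute)
      also have "\<dots> \<in> cyc_edges vs" using l by (subst cyc_edge_iff[OF assms]) simp_all
      finally show ?thesis .
    next
      case False
      then have "e = {vs ! (length vs - Suc i), vs ! (length vs - Suc (Suc i))}" using i by (simp add: rev_nth)
      then show ?thesis using assms i False by (simp only:, subst cyc_edge_iff) (auto simp: Suc_diff_Suc)
    qed
  qed
qed (use assms in \<open>simp_all add: card_cyc_edges\<close>)

text \<open>Rotation by \<open>i + 2\<close> moves the positions \<open>i\<close> and
  \<open>i + 1\<close> to the end of the list, so the reversed list starts with them in the opposite
  order.\<close>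

lemma rev_rotate_nth:
  assumes "i < length vs" "2 \<le> length vs"
  shows "rev (rotate (i + 2) vs) ! 0 = vs ! (Suc i mod length vs)" "rev (rotate (i + 2) vs) ! 1 = vs ! i"
proof -
  have nth: "rotate m vs ! j = vs ! ((m + j) mod length vs)" if "j < length vs" for m j
    using that by (rule nth_rotate)
  have "rev (rotate (i + 2) vs) ! 0 = rotate (i + 2) vs ! (length vs - 1)"
    using assms by (subst rev_nth) auto
  also have "\<dots> = vs ! ((i + 2 + (length vs - 1)) mod length vs)" using assms by (intro nth) auto
  also have "i + 2 + (length vs - 1) = Suc i + length vs" using assms by linarith
  finally show "rev (rotate (i + 2) vs) ! 0 = vs ! (Suc i mod length vs)" by (simp only: mod_add_self2)
  have "rev (rotate (i + 2) vs) ! 1 = rotate (i + 2) vs ! (length vs - 2)"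
    using assms by (subst rev_nth) (auto simp: numeral_2_eq_2)
  also have "\<dots> = vs ! ((i + 2 + (length vs - 2)) mod length vs)" using assms by (intro nth) auto
  also have "i + 2 + (length vs - 2) = i + length vs" using assms by linarith
  finally show "rev (rotate (i + 2) vs) ! 1 = vs ! i" using assms(1) by (simp only: mod_add_self2 mod_less)
qed

lemma cycle_starting_at:
  assumes vs: "distinct vs" "3 \<le> length vs" and e: "{a, c} \<in> cyc_edges vs"
  obtains ws where "length ws = length vs" "distinct ws" "cyc_edges ws = cyc_edges vs" "ws ! 0 = a" "ws ! 1 = c"
proof -
  let ?k = "length vs"
  obtain i where i: "i < ?k" "{a, c} = {vs ! i, vs ! (Suc i mod ?k)}" using e by (auto simp: cyc_edges_def)
  have k1: "0 < ?k" "1 < ?k" using vs by auto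
  from i(2) have "a = vs ! i \<and> c = vs ! (Suc i mod ?k) \<or> a = vs ! (Suc i mod ?k) \<and> c = vs ! i"
    by (simp add: doubleton_eq_iff)
  then show thesis
  proof
    assume "a = vs ! i \<and> c = vs ! (Suc i mod ?k)"
    then show thesis using that[of "rotate i vs"] vs i k1 by (simp add: nth_rotate cyc_edges_rotate)
  next
    assume ac: "a = vs ! (Suc i mod ?k) \<and> c = vs ! i"
    have "rev (rotate (i + 2) vs) ! 0 = a" "rev (rotate (i + 2) vs) ! 1 = c"
      using rev_rotate_nth[OF i(1)] k1 ac by simp_all
    then show thesis using vs
      by (intro that[of "rev (rotate (i + 2) vs)"]) (simp_all add: cyc_edges_rev cyc_edges_rotate del: rotate_Suc)
  qed
qed

lemma cyc_edge_doubleton: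
  assumes "distinct vs" "2 \<le> length vs" "e \<in> cyc_edges vs"
  obtains x y where "e = {x, y}" "x \<noteq> y"
proof -
  obtain i where i: "i < length vs" "e = {vs ! i, vs ! (Suc i mod length vs)}" using assms(3) by (auto simp: cyc_edges_def)
  have "Suc i mod length vs \<noteq> i" using i(1) assms(2) by (auto simp: Suc_mod_cases)
  then have "vs ! i \<noteq> vs ! (Suc i mod length vs)" using assms(1) i(1) by (simp add: nth_eq_iff_index_eq)
  then show thesis using i(2) that by blast
qed

text \<open>A list with the given edge set is determined by its first two entries, and these can be
  any edge of the cycle in either orientation.\<close>

lemma card_cycle_fiber:
  assumes vs: "distinct vs" "3 \<le> length vs"
  shows "card {ws. length ws = length vs \<and> distinct ws \<and> cyc_edges ws = cyc_edges vs} = 2 * length vs"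
proof -
  let ?k = "length vs"
  let ?F = "{ws. length ws = ?k \<and> distinct ws \<and> cyc_edges ws = cyc_edges vs}"
  let ?O = "{(a, c). {a, c} \<in> cyc_edges vs}"
  have "bij_betw (\<lambda>ws. (ws ! 0, ws ! 1)) ?F ?O"
  proof (rule bij_betwI')
    fix ws ws' assume "ws \<in> ?F" "ws' \<in> ?F"
    then show "((ws ! 0, ws ! 1) = (ws' ! 0, ws' ! 1)) = (ws = ws')"
      using cyc_edges_determined[of ws' ws] vs by auto
  next
    fix ws assume ws: "ws \<in> ?F"
    then have "{ws ! 0, ws ! 1} \<in> cyc_edges ws" using vs by (subst cyc_edge_iff) auto
    then show "(ws ! 0, ws ! 1) \<in> ?O" using ws by simp
  next
    fix x assume "x \<in> ?O"
    then obtain a c where x: "x = (a, c)" "{a, c} \<in> cyc_edges vs" by blast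
    obtain ws where "length ws = ?k" "distinct ws" "cyc_edges ws = cyc_edges vs" "ws ! 0 = a" "ws ! 1 = c"
      by (rule cycle_starting_at[OF vs x(2)])
    then show "\<exists>ws\<in>?F. x = (ws ! 0, ws ! 1)" using x(1) by (intro bexI[of _ ws]) simp_all
  qed
  then have "card ?F = card ?O" by (rule bij_betw_same_card)
  also have "?O = (\<Union>e\<in>cyc_edges vs. {(a, c). {a, c} = e})" by auto
  also have "card \<dots> = (\<Sum>e\<in>cyc_edges vs. card {(a, c). {a, c} = e})"
  proof (rule card_UN_disjoint)
    show "\<forall>e\<in>cyc_edges vs. finite {(a, c). {a, c} = e}"
    proof
      fix e assume e: "e \<in> cyc_edges vs"
      have "{(a, c). {a, c} = e} \<subseteq> set vs \<times> set vs" using cyc_edges_subset[OF e] by auto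
      then show "finite {(a, c). {a, c} = e}" by (rule finite_subset) simp
    qed
  qed auto
  also have "\<dots> = (\<Sum>e\<in>cyc_edges vs. 2)"
  proof (rule sum.cong)
    fix e assume e: "e \<in> cyc_edges vs"
    obtain x y where xy: "e = {x, y}" "x \<noteq> y" by (rule cyc_edge_doubleton[OF vs(1) _ e]) (use vs(2) in simp)
    have "{(a, c). {a, c} = e} = {(x, y), (y, x)}" unfolding xy(1) by (auto simp: doubleton_eq_iff)
    then show "card {(a, c). {a, c} = e} = 2" using xy(2) by simp
  qed simp
  finally show ?thesis using card_cyc_edges[OF vs] by simp
qed

lemma card_cycles:
  assumes k: "3 \<le> k"
  shows "2 * k * card (cycles n k) = card (cycle_lists n k)"
proof -
  have fin: "finite (cycle_lists n k)"
    by (rule finite_subset[OF _ finite_lists_length_eq[of "{1..n}" k]]) (auto simp: cycle_lists_def)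
  have "card (cycle_lists n k) = (\<Sum>vs\<in>cycle_lists n k. 1)" by simp
  also have "\<dots> = (\<Sum>E\<in>cyc_edges ` cycle_lists n k. \<Sum>vs\<in>{vs \<in> cycle_lists n k. cyc_edges vs = E}. 1)"
    by (rule sum.image_gen[OF fin])
  also have "\<dots> = (\<Sum>E\<in>cyc_edges ` cycle_lists n k. 2 * k)"
  proof (rule sum.cong)
    fix E assume "E \<in> cyc_edges ` cycle_lists n k"
    then obtain vs where vs: "E = cyc_edges vs" "vs \<in> cycle_lists n k" by blast
    then have v: "distinct vs" "3 \<le> length vs" "length vs = k" "set vs \<subseteq> {1..n}" using k by (auto simp: cycle_lists_def)
    have "{ws \<in> cycle_lists n k. cyc_edges ws = E} = {ws. length ws = length vs \<and> distinct ws \<and> cyc_edges ws = cyc_edges vs}"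
      unfolding vs(1) cycle_lists_def using v by (auto simp: Union_cyc_edges[symmetric])
    then show "(\<Sum>ws\<in>{ws \<in> cycle_lists n k. cyc_edges ws = E}. 1) = 2 * k"
      using card_cycle_fiber[OF v(1,2)] v(3) by simp
  qed simp
  finally show ?thesis by (simp add: cycles_def)
qed

text \<open>Attach to each position of \<open>ws\<close> its outgoing edge. A vertex outside
  \<open>vs\<close> has an outgoing edge outside \<open>vs\<close>, and where \<open>ws\<close>
  leaves \<open>vs\<close> after a common edge, a new edge starts at an old vertex. So
  \<open>ws\<close> contributes more new edges than new vertices, while \<open>vs\<close> has
  equally many of both.\<close>

lemma overlapping_cycles:
  assumes vs: "distinct vs" "3 \<le> length vs" and ws: "distinct ws" "3 \<le> length ws"
    and ne: "cyc_edges ws \<noteq> cyc_edges vs" and int: "cyc_edges vs \<inter> cyc_edges ws \<noteq> {}"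
  shows "card (set vs \<union> set ws) < card (cyc_edges vs \<union> cyc_edges ws)"
proof -
  let ?k = "length vs" and ?l = "length ws"
  let ?e = "\<lambda>i. {ws ! i, ws ! (Suc i mod ?l)}"
  have l0: "0 < ?l" using ws by auto
  have nsub: "\<not> cyc_edges ws \<subseteq> cyc_edges vs"
  proof
    assume sub: "cyc_edges ws \<subseteq> cyc_edges vs"
    have "{ws ! 0, ws ! 1} \<in> cyc_edges ws" using ws by (subst cyc_edge_iff) auto
    then have "{ws ! 0, ws ! 1} \<in> cyc_edges vs" using sub by blast
    then obtain us where us: "length us = ?k" "distinct us" "cyc_edges us = cyc_edges vs" "us ! 0 = ws ! 0" "us ! 1 = ws ! 1"
      by (rule cycle_starting_at[OF vs])
    then have "ws = us" using us cyc_edges_determined[of us ws] vs ws sub by auto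
    then show False using us ne by simp
  qed
  define I where "I = {i. i < ?l \<and> ?e i \<notin> cyc_edges vs}"
  define J where "J = {i. i < ?l \<and> ws ! i \<notin> set vs}"
  have JI: "J \<subseteq> I" using cyc_edges_subset[of _ vs] by (auto simp: I_def J_def)
  \<comment> \<open>Otherwise the common edge would propagate around all of
    \<open>ws\<close>.\<close>
  have "\<exists>i. i < ?l \<and> ?e i \<in> cyc_edges vs \<and> ?e (Suc i mod ?l) \<notin> cyc_edges vs"
  proof (rule ccontr)
    assume neg: "\<not> ?thesis"
    obtain i0 where i0: "i0 < ?l" "?e i0 \<in> cyc_edges vs" using int by (auto simp: cyc_edges_def[of ws])
    have "?e ((i0 + j) mod ?l) \<in> cyc_edges vs" for j
    proof (induction j)
      case (Suc j)
      have "(i0 + j) mod ?l < ?l" using l0 by simp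
      then have "?e (Suc ((i0 + j) mod ?l) mod ?l) \<in> cyc_edges vs" using neg Suc by blast
      then show ?case by (simp add: mod_simps)
    qed (use i0 in simp)
    note all = this
    have "?e i \<in> cyc_edges vs" if "i < ?l" for i
    proof -
      have "(i0 + (i + ?l - i0)) mod ?l = i" using i0 that by simp
      then show ?thesis using all[of "i + ?l - i0"] by simp
    qed
    then have "cyc_edges ws \<subseteq> cyc_edges vs" by (auto simp: cyc_edges_def[of ws])
    then show False using nsub by blast
  qed
  then obtain i where i: "i < ?l" "?e i \<in> cyc_edges vs" "?e (Suc i mod ?l) \<notin> cyc_edges vs" by blast
  have "Suc i mod ?l \<in> I" using i l0 by (simp add: I_def)
  moreover have "Suc i mod ?l \<notin> J" using cyc_edges_subset[OF i(2)] by (auto simp: J_def)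
  ultimately have "J \<subset> I" using JI by blast
  moreover have "finite I" by (simp add: I_def)
  ultimately have cJI: "card J < card I" by (rule psubset_card_mono[rotated])
  have "card I = card (cyc_edges ws - cyc_edges vs)"
  proof -
    have "inj_on ?e {..<?l}" using card_cyc_edges[OF ws] unfolding cyc_edges_def by (intro eq_card_imp_inj_on) auto
    then have "inj_on ?e I" by (rule inj_on_subset) (auto simp: I_def)
    then have "card (?e ` I) = card I" by (rule card_image)
    moreover have "?e ` I = cyc_edges ws - cyc_edges vs"
      unfolding I_def cyc_edges_def[of ws] by blast
    ultimately show ?thesis by simp
  qed
  moreover have "card J = card (set ws - set vs)"
  proof -
    have "inj_on (\<lambda>i. ws ! i) J" using ws(1) by (auto simp: inj_on_def J_def nth_eq_iff_index_eq)
    then have "card ((\<lambda>i. ws ! i) ` J) = card J" by (rule card_image)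
    moreover have "(\<lambda>i. ws ! i) ` J = set ws - set vs" unfolding J_def set_conv_nth[of ws] by blast
    ultimately show ?thesis by simp
  qed
  moreover have "card (set vs \<union> set ws) = card (set vs) + card (set ws - set vs)"
    by (metis Un_Diff_cancel card_Un_disjoint Diff_disjoint finite_set finite_Diff)
  moreover have "card (cyc_edges vs \<union> cyc_edges ws) = card (cyc_edges vs) + card (cyc_edges ws - cyc_edges vs)"
    by (metis Un_Diff_cancel card_Un_disjoint Diff_disjoint finite_cyc_edges finite_Diff)
  moreover have "card (set vs) = card (cyc_edges vs)" using vs by (simp add: distinct_card card_cyc_edges)
  ultimately show ?thesis using cJI by simp
qed

lemma induced_cycle_cyc_edges:
  assumes "induced_cycle n G vs" "3 \<le> length vs"
  shows "cyc_edges vs \<inter> G = {}"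
proof -
  have "{vs ! i, vs ! (Suc i mod length vs)} \<notin> G" if i: "i < length vs" for i
  proof (cases "Suc i = length vs")
    case True
    have "{vs ! 0, vs ! i} \<notin> G"
      using assms True unfolding induced_cycle_def by (auto dest!: spec[of _ 0] spec[of _ i])
    then show ?thesis using True by (simp add: insert_commute)
  next
    case False
    then show ?thesis using assms i unfolding induced_cycle_def by (auto dest!: spec[of _ i] spec[of _ "Suc i"])
  qed
  then show ?thesis by (auto simp: cyc_edges_def)
qed

text \<open>A cycle of the complement that is not induced has a chord, which is one more edge on the
  same \<open>k\<close> vertices.\<close>

lemma non_induced_cycle_dense:
  assumes vs: "vs \<in> cycle_lists n k" and k: "3 \<le> k" "k \<le> M"
    and av: "cyc_edges vs \<inter> G = {}" and ni: "\<not> induced_cycle n G vs"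
  shows "dense n M G"
proof -
  have v: "distinct vs" "3 \<le> length vs" "length vs = k" "set vs \<subseteq> {1..n}" using vs k by (auto simp: cycle_lists_def)
  obtain i j where ij: "i < j" "j < length vs"
    "({vs ! i, vs ! j} \<notin> G) \<noteq> (j = Suc i \<or> (i = 0 \<and> Suc j = length vs))"
    using ni v unfolding induced_cycle_def by blast
  have mem: "{vs ! i, vs ! j} \<in> cyc_edges vs \<longleftrightarrow> j = Suc i \<or> (i = 0 \<and> Suc j = length vs)"
    using cyc_edge_iff[OF v(1,2), of i j] ij(1,2) by (auto simp: Suc_mod_cases split: if_splits)
  have e: "{vs ! i, vs ! j} \<notin> G" "{vs ! i, vs ! j} \<notin> cyc_edges vs" using ij(3) mem av by blast+
  have "vs ! i \<noteq> vs ! j" using ij v(1) by (simp add: nth_eq_iff_index_eq)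
  then have ep: "{vs ! i, vs ! j} \<in> vertex_pairs n"
  proof -
    have "vs ! i \<in> set vs" "vs ! j \<in> set vs" using ij(1,2) by simp_all
    then show ?thesis using \<open>vs ! i \<noteq> vs ! j\<close> v(4) unfolding vertex_pairs_mem by blast
  qed
  show ?thesis unfolding dense_def
  proof (intro exI[of _ "set vs"] exI[of _ "insert {vs ! i, vs ! j} (cyc_edges vs)"] conjI)
    show "card (set vs) \<le> M" using v k by (simp add: distinct_card)
    have "{vs ! i, vs ! j} \<subseteq> set vs" using ij(1,2) by auto
    then show "insert {vs ! i, vs ! j} (cyc_edges vs) \<subseteq> Pow (set vs) \<inter> vertex_pairs n"
      using ep cyc_edges_subset[of _ vs] cyc_edges_vertex_pairs[of vs n] v by auto
    show "card (set vs) < card (insert {vs ! i, vs ! j} (cyc_edges vs))"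
      using e v by (simp add: card_cyc_edges distinct_card)
  qed (use e av v in auto)
qed

text \<open>The end point of a longest path has all its neighbours among the next two path vertices.\<close>

lemma no_long_cycle_simplicial:
  assumes no: "\<And>vs. distinct vs \<Longrightarrow> set vs \<subseteq> {1..n} \<Longrightarrow> 4 \<le> length vs \<Longrightarrow> cyc_edges vs \<inter> G \<noteq> {}"
    and W: "W \<subseteq> {1..n}" "W \<noteq> {}"
  shows "\<exists>v\<in>W. simplicial G W v"
proof -
  define P where "P vs \<longleftrightarrow> vs \<noteq> [] \<and> distinct vs \<and> set vs \<subseteq> W \<and> (\<forall>i. Suc i < length vs \<longrightarrow> {vs ! i, vs ! Suc i} \<notin> G)"
    for vs :: "nat list"
  obtain w where "w \<in> W" using W by blast
  then have "P [w]" by (simp add: P_def)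
  moreover have "\<forall>vs. P vs \<longrightarrow> length vs < Suc n"
  proof (intro allI impI)
    fix vs assume "P vs"
    then have "length vs = card (set vs)" "set vs \<subseteq> {1..n}" using W by (auto simp: P_def distinct_card)
    then show "length vs < Suc n" using card_mono[of "{1..n}" "set vs"] by simp
  qed
  ultimately obtain vs where vs: "P vs" and mx: "\<And>us. P us \<Longrightarrow> length us \<le> length vs"
    using ex_has_greatest_nat[of P "[w]" length] by (metis less_imp_le)
  have v: "vs \<noteq> []" "distinct vs" "set vs \<subseteq> W" "\<And>i. Suc i < length vs \<Longrightarrow> {vs ! i, vs ! Suc i} \<notin> G"
    using vs by (auto simp: P_def)
  define v0 where "v0 = vs ! 0"
  have nb: "\<exists>j\<in>{1, 2}. j < length vs \<and> u = vs ! j" if u: "u \<in> W - {v0}" "{v0, u} \<notin> G" for u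
  proof -
    have "u \<in> set vs"
    proof (rule ccontr)
      assume nu: "u \<notin> set vs"
      have "P (u # vs)"
        unfolding P_def
      proof (intro conjI allI impI)
        fix i assume "Suc i < length (u # vs)"
        then show "{(u # vs) ! i, (u # vs) ! Suc i} \<notin> G"
          using u v(4)[of "i - 1"] by (cases i) (auto simp: v0_def insert_commute)
      qed (use u v nu in auto)
      from mx[OF this] show False by simp
    qed
    then obtain j where j: "j < length vs" "u = vs ! j" by (metis in_set_conv_nth)
    have "j \<noteq> 0" using u j unfolding v0_def by (metis Diff_iff singletonI)
    \<comment> \<open>A neighbour of \<open>v0\<close> three or more steps along the path would
      close a cycle of length at least 4.\<close>
    moreover have "\<not> 3 \<le> j"
    proof
      assume j3: "3 \<le> j"
      define ws where "ws = take (Suc j) vs"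
      have len: "length ws = Suc j" using j by (simp add: ws_def)
      have nthw: "ws ! i = vs ! i" if "i \<le> j" for i using that by (simp add: ws_def)
      have "cyc_edges ws \<inter> G = {}"
      proof -
        have "{ws ! i, ws ! (Suc i mod length ws)} \<notin> G" if "i < length ws" for i
        proof (cases "i = j")
          case True
          then show ?thesis using u j by (simp add: len nthw v0_def insert_commute)
        next
          case False
          then have "Suc i mod length ws = Suc i" "Suc i \<le> j" using that len by auto
          then show ?thesis using v(4)[of i] j by (simp add: nthw)
        qed
        then show ?thesis by (auto simp: cyc_edges_def)
      qed
      moreover have "set ws \<subseteq> {1..n}" using set_take_subset[of "Suc j" vs] v(3) W(1) by (auto simp: ws_def)
      moreover have "distinct ws" using v(2) by (simp add: ws_def)
      ultimately show False using no[of ws] len j3 by simp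
    qed
    ultimately show ?thesis using j by (intro bexI[of _ j]) auto
  qed
  have "simplicial G W v0"
    unfolding simplicial_def
  proof (intro ballI impI)
    fix a c assume a: "a \<in> W - {v0}" and c: "c \<in> W - {v0}" and ac: "a \<noteq> c" "{v0, a} \<notin> G" "{v0, c} \<notin> G"
    obtain j l where jl: "j \<in> {1, 2}" "l \<in> {1, 2}" "j < length vs" "l < length vs" "a = vs ! j" "c = vs ! l"
      using nb[OF a ac(2)] nb[OF c ac(3)] by blast
    then have "j \<noteq> l" using ac by auto
    then have "2 < length vs" "{a, c} = {vs ! 1, vs ! 2}" using jl by auto
    then show "{a, c} \<notin> G" using v(4)[of 1] by (simp add: numeral_2_eq_2)
  qed
  moreover have "v0 \<in> W" using v by (auto simp: v0_def)
  ultimately show ?thesis by blast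
qed

text \<open>An end of the only edge is simplicial, because no edge of \<open>G\<close> is left
  between the other vertices. If no edge meets \<open>W\<close>, every vertex is simplicial.\<close>

lemma few_edges_simplicial:
  assumes "card G \<le> 1" "finite G" "W \<noteq> {}"
  shows "\<exists>v\<in>W. simplicial G W v"
proof (cases "\<exists>e\<in>G. \<exists>v\<in>e. v \<in> W")
  case True
  then obtain e v where e: "e \<in> G" "v \<in> e" "v \<in> W" by blast
  have "G = {e}" using assms e(1) by (metis One_nat_def card_le_Suc0_iff_eq is_singletonI' is_singleton_the_elem singletonD empty_iff)
  then have "simplicial G W v" using e(2) by (auto simp: simplicial_def)
  then show ?thesis using e by blast
next
  case False
  then have "simplicial G W v" for v by (auto simp: simplicial_def)
  then show ?thesis using assms(3) by blast
qed

text \<open>An edge joining \<open>e\<close> and \<open>f\<close> would meet both and differ from at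
  least one of them, against pairwise disjointness.\<close>

lemma matching_induced_4_cycle:
  assumes G: "G \<subseteq> vertex_pairs n" and ef: "e \<in> G" "f \<in> G" "e \<noteq> f"
    and disj: "\<And>e f. e \<in> G \<Longrightarrow> f \<in> G \<Longrightarrow> e \<noteq> f \<Longrightarrow> e \<inter> f = {}"
  obtains vs where "length vs = 4" "induced_cycle n G vs"
proof -
  obtain a a' where a: "e = {a, a'}" "a \<noteq> a'" "e \<subseteq> {1..n}" using G ef(1) by (auto simp: vertex_pairs_def card_2_iff)
  obtain c c' where c: "f = {c, c'}" "c \<noteq> c'" "f \<subseteq> {1..n}" using G ef(2) by (auto simp: vertex_pairs_def card_2_iff)
  have d: "a \<noteq> c" "a \<noteq> c'" "a' \<noteq> c" "a' \<noteq> c'" using disj[OF ef] a c by auto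
  have x: "{p, q} \<notin> G" if "p \<in> e" "q \<in> f" for p q
  proof
    assume pq: "{p, q} \<in> G"
    have "{p, q} \<noteq> e \<or> {p, q} \<noteq> f" using ef(3) by blast
    then show False using disj[OF pq ef(1)] disj[OF pq ef(2)] that disj[OF ef] by auto
  qed
  have nE: "{a, c} \<notin> G" "{a, c'} \<notin> G" "{a', c} \<notin> G" "{a', c'} \<notin> G"
    using x a c by simp_all
  have E: "{a, a'} \<in> G" "{c, c'} \<in> G" using ef a c by simp_all
  have "induced_cycle n G [a, c, a', c']"
    using d a c by (intro induced_4_cycleI E nE) auto
  then show thesis using that[of "[a, c, a', c']"] by simp
qed

section \<open>Random graphs\<close>

definition pr :: "nat \<Rightarrow> real \<Rightarrow> (nat set set \<Rightarrow> bool) \<Rightarrow> real" where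
  "pr n p Q = measure_pmf.prob (erdos_renyi n p) {G. Q G}"

lemma finite_vertex_pairs [simp]: "finite (vertex_pairs n)"
  by (simp add: vertex_pairs_def)

lemma set_erdos_renyi: "G \<in> set_pmf (erdos_renyi n p) \<Longrightarrow> G \<subseteq> vertex_pairs n"
  by (auto simp: erdos_renyi_def)

lemma pr_mono:
  assumes "\<And>G. G \<subseteq> vertex_pairs n \<Longrightarrow> Q G \<Longrightarrow> R G"
  shows "pr n p Q \<le> pr n p R"
proof -
  have "pr n p Q = measure_pmf.prob (erdos_renyi n p) ({G. Q G} \<inter> set_pmf (erdos_renyi n p))"
    unfolding pr_def by (simp add: measure_Int_set_pmf)
  also have "\<dots> \<le> pr n p R"
    unfolding pr_def using assms set_erdos_renyi by (intro measure_pmf.finite_measure_mono) auto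
  finally show ?thesis .
qed

lemma pr_cong:
  assumes "\<And>G. G \<subseteq> vertex_pairs n \<Longrightarrow> Q G \<longleftrightarrow> R G"
  shows "pr n p Q = pr n p R"
  using pr_mono[of n Q R p] pr_mono[of n R Q p] assms by fastforce

lemma pr_nonneg [simp]: "0 \<le> pr n p Q" by (simp add: pr_def)

lemma pr_True: "pr n p (\<lambda>_. True) = 1" by (simp add: pr_def)

lemma pr_split: "pr n p Q = pr n p (\<lambda>G. Q G \<and> R G) + pr n p (\<lambda>G. Q G \<and> \<not> R G)"
proof -
  have "{G. Q G} = {G. Q G \<and> R G} \<union> {G. Q G \<and> \<not> R G}" by auto
  then show ?thesis unfolding pr_def
    by (simp only:) (rule measure_pmf.finite_measure_Union, auto)
qed

lemma pr_disj_le: "pr n p (\<lambda>G. Q G \<or> R G) \<le> pr n p Q + pr n p R"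
proof -
  have "{G. Q G \<or> R G} = {G. Q G} \<union> {G. R G}" by auto
  then show ?thesis unfolding pr_def by (simp only:) (rule measure_Un_le, auto)
qed

lemma pr_bex_le:
  assumes "finite X"
  shows "pr n p (\<lambda>G. \<exists>x\<in>X. R x G) \<le> (\<Sum>x\<in>X. pr n p (R x))"
proof -
  have "{G. \<exists>x\<in>X. R x G} = (\<Union>x\<in>X. {G. R x G})" by auto
  then show ?thesis unfolding pr_def using measure_pmf.finite_measure_subadditive_finite[OF assms] by simp
qed

text \<open>Condition on the coordinate \<open>e\<close> of the product distribution:
  \<open>Q\<close> has the same value on both branches.\<close>

lemma pr_edge_indep:
  assumes p: "0 \<le> p" "p \<le> 1" and e: "e \<in> vertex_pairs n" and Q: "\<And>G. Q (insert e G) \<longleftrightarrow> Q (G - {e})"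
  shows "pr n p (\<lambda>G. e \<notin> G \<and> Q G) = (1 - p) * pr n p Q"
proof -
  define A where "A = vertex_pairs n - {e}"
  define PA where "PA = Pi_pmf A False (\<lambda>_. bernoulli_pmf p)"
  have VP: "vertex_pairs n = insert e A" "e \<notin> A" "finite A" using e by (auto simp: A_def)
  have er: "erdos_renyi n p = bind_pmf (bernoulli_pmf p) (\<lambda>y. map_pmf (\<lambda>f. {x \<in> vertex_pairs n. (f(e := y)) x}) PA)"
    unfolding erdos_renyi_def PA_def
    by (subst VP(1), subst Pi_pmf_insert'[OF VP(3,2)])
       (simp add: map_bind_pmf map_pmf_def bind_assoc_pmf bind_return_pmf VP(1)[symmetric])
  have em: "emeasure (erdos_renyi n p) S =
      emeasure PA {f. {x \<in> vertex_pairs n. (f(e := True)) x} \<in> S} * ennreal p +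
      emeasure PA {f. {x \<in> vertex_pairs n. (f(e := False)) x} \<in> S} * ennreal (1 - p)" for S
    unfolding er using p by (simp add: vimage_def)
  have Qe: "Q {x \<in> vertex_pairs n. (f(e := True)) x} \<longleftrightarrow> Q {x \<in> vertex_pairs n. (f(e := False)) x}" for f
  proof -
    have "{x \<in> vertex_pairs n. (f(e := True)) x} = insert e {x \<in> vertex_pairs n. (f(e := False)) x}"
      "{x \<in> vertex_pairs n. (f(e := False)) x} - {e} = {x \<in> vertex_pairs n. (f(e := False)) x}"
      using e by auto
    then show ?thesis using Q[of "{x \<in> vertex_pairs n. (f(e := False)) x}"] by simp
  qed
  define m where "m = measure PA {f. Q {x \<in> vertex_pairs n. (f(e := False)) x}}"
  have "emeasure (erdos_renyi n p) {G. Q G} = ennreal m * ennreal p + ennreal m * ennreal (1 - p)"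
  proof -
    have "{f. Q {x \<in> vertex_pairs n. (f(e := True)) x}} = {f. Q {x \<in> vertex_pairs n. (f(e := False)) x}}"
      using Qe by blast
    then show ?thesis
      unfolding em by (simp only: mem_Collect_eq measure_pmf.emeasure_eq_measure m_def)
  qed
  also have "\<dots> = ennreal m"
    using p by (simp add: ennreal_mult[symmetric] ennreal_plus[symmetric] m_def distrib_left[symmetric] del: ennreal_plus)
  finally have 1: "pr n p Q = m" by (simp add: pr_def measure_pmf.emeasure_eq_measure m_def)
  have "emeasure (erdos_renyi n p) {G. e \<notin> G \<and> Q G} = ennreal m * ennreal (1 - p)"
    unfolding em using e by (simp add: measure_pmf.emeasure_eq_measure m_def)
  then have "ennreal (pr n p (\<lambda>G. e \<notin> G \<and> Q G)) = ennreal ((1 - p) * m)"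
    using p by (simp add: pr_def measure_pmf.emeasure_eq_measure ennreal_mult[symmetric] m_def mult.commute)
  then have "pr n p (\<lambda>G. e \<notin> G \<and> Q G) = (1 - p) * m"
    using p by (subst (asm) ennreal_inj) (auto simp: m_def)
  then show ?thesis using 1 by simp
qed

lemma pr_indep:
  assumes p: "0 \<le> p" "p \<le> 1" and C: "C \<subseteq> vertex_pairs n"
    and Q: "\<And>G G'. G - C = G' - C \<Longrightarrow> Q G \<longleftrightarrow> Q G'"
  shows "pr n p (\<lambda>G. C \<inter> G = {} \<and> Q G) = (1 - p) ^ card C * pr n p Q"
proof -
  have "finite C" using C finite_subset finite_vertex_pairs by blast
  then show ?thesis using C Q
  proof (induction C rule: finite_induct)
    case (insert e C)
    have "pr n p (\<lambda>G. insert e C \<inter> G = {} \<and> Q G) = pr n p (\<lambda>G. e \<notin> G \<and> (C \<inter> G = {} \<and> Q G))"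
      by (rule pr_cong) auto
    also have "\<dots> = (1 - p) * pr n p (\<lambda>G. C \<inter> G = {} \<and> Q G)"
    proof (rule pr_edge_indep[OF p])
      show "e \<in> vertex_pairs n" using insert.prems by blast
      fix G
      have "Q (insert e G) \<longleftrightarrow> Q (G - {e})" by (rule insert.prems(2)) auto
      moreover have "C \<inter> insert e G = C \<inter> (G - {e})" using insert.hyps by auto
      ultimately show "(C \<inter> insert e G = {} \<and> Q (insert e G)) = (C \<inter> (G - {e}) = {} \<and> Q (G - {e}))" by simp
    qed
    also have "pr n p (\<lambda>G. C \<inter> G = {} \<and> Q G) = (1 - p) ^ card C * pr n p Q"
    proof (rule insert.IH)
      show "C \<subseteq> vertex_pairs n" using insert.prems by blast
      show "Q G = Q G'" if "G - C = G' - C" for G G'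
        by (rule insert.prems(2)) (use that in blast)
    qed
    finally show ?case using insert.hyps by simp
  qed simp
qed

lemma pr_avoid:
  assumes "0 \<le> p" "p \<le> 1" "C \<subseteq> vertex_pairs n"
  shows "pr n p (\<lambda>G. C \<inter> G = {}) = (1 - p) ^ card C"
  using pr_indep[OF assms, of "\<lambda>_. True"] by (simp add: pr_True)

text \<open>
  A Chen--Stein type estimate: including the events \<open>C \<inter> G = {}\<close> one at a time, each one is
  independent of those earlier events that share no edge with it, and the others contribute the error.
\<close>

lemma pr_avoid_family:
  assumes p: "0 \<le> p" "p \<le> 1" and F: "finite F" "\<And>C. C \<in> F \<Longrightarrow> C \<subseteq> vertex_pairs n"
  shows "\<bar>pr n p (\<lambda>G. \<forall>C\<in>F. C \<inter> G \<noteq> {}) - (\<Prod>C\<in>F. 1 - (1 - p) ^ card C)\<bar>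
    \<le> (\<Sum>C\<in>F. \<Sum>D\<in>{D \<in> F. D \<noteq> C \<and> C \<inter> D \<noteq> {}}. (1 - p) ^ card (C \<union> D))"
  using F
proof (induction F rule: finite_induct)
  case empty
  then show ?case by (simp add: pr_True)
next
  case (insert C F)
  define q where "q = 1 - p"
  have q: "0 \<le> q" "q \<le> 1" using p by (auto simp: q_def)
  define av where "av X G \<longleftrightarrow> (\<forall>C\<in>X. C \<inter> G \<noteq> {})" for X and G :: "nat set set"
  \<comment> \<open>\<open>X\<close> collects the earlier sets that share an edge with
    \<open>C\<close>, and \<open>N\<close> those whose events are independent of the event for
    \<open>C\<close>. The sum \<open>S\<close> bounds the effect of replacing \<open>F\<close> by
    \<open>N\<close>.\<close>
  define X where "X = {D \<in> F. C \<inter> D \<noteq> {}}"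
  define N where "N = F - X"
  define S where "S = (\<Sum>D\<in>X. q ^ card (C \<union> D))"
  have fin: "finite X" using insert.hyps by (simp add: X_def)
  have CV: "C \<subseteq> vertex_pairs n" and FV: "\<And>D. D \<in> F \<Longrightarrow> D \<subseteq> vertex_pairs n" using insert.prems by auto
  define a where "a = pr n p (\<lambda>G. av F G \<and> C \<inter> G = {})"
  have fC: "pr n p (av (insert C F)) = pr n p (av F) - a"
  proof -
    have "pr n p (av (insert C F)) = pr n p (\<lambda>G. av F G \<and> \<not> C \<inter> G = {})"
      by (rule pr_cong) (auto simp: av_def)
    then show ?thesis using pr_split[of n p "av F" "\<lambda>G. C \<inter> G = {}"] by (simp add: a_def)
  qed
  have ind: "pr n p (\<lambda>G. C \<inter> G = {} \<and> av N G) = q ^ card C * pr n p (av N)"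
    unfolding q_def
  proof (rule pr_indep[OF p CV])
    fix G G' assume G: "G - C = G' - C"
    have "D \<inter> G = D \<inter> G'" if "D \<in> N" for D
    proof -
      have "D \<inter> C = {}" using that by (auto simp: N_def X_def)
      then have "D \<inter> G = D \<inter> (G - C)" "D \<inter> G' = D \<inter> (G' - C)" by auto
      then show ?thesis using G by simp
    qed
    then show "av N G \<longleftrightarrow> av N G'" by (simp add: av_def)
  qed
  have le1: "a \<le> q ^ card C * pr n p (av N)"
    unfolding a_def ind[symmetric] by (rule pr_mono) (auto simp: av_def N_def)
  have ge1: "q ^ card C * pr n p (av N) \<le> a + S"
  proof -
    have "q ^ card C * pr n p (av N) \<le> pr n p (\<lambda>G. (av F G \<and> C \<inter> G = {}) \<or> (\<exists>D\<in>X. (C \<union> D) \<inter> G = {}))"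
      unfolding ind[symmetric] by (rule pr_mono) (auto simp: av_def N_def Int_Un_distrib2)
    also have "\<dots> \<le> a + pr n p (\<lambda>G. \<exists>D\<in>X. (C \<union> D) \<inter> G = {})"
      unfolding a_def by (rule pr_disj_le)
    also have "pr n p (\<lambda>G. \<exists>D\<in>X. (C \<union> D) \<inter> G = {}) \<le> (\<Sum>D\<in>X. pr n p (\<lambda>G. (C \<union> D) \<inter> G = {}))"
      by (rule pr_bex_le[OF fin])
    also have "\<dots> = S" unfolding S_def q_def
    proof (rule sum.cong)
      fix D assume "D \<in> X"
      then show "pr n p (\<lambda>G. (C \<union> D) \<inter> G = {}) = (1 - p) ^ card (C \<union> D)"
        using CV FV[of D] by (intro pr_avoid p) (auto simp: X_def)
    qed simp
    finally show ?thesis by simp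
  qed
  have le2: "pr n p (av F) \<le> pr n p (av N)" by (rule pr_mono) (auto simp: av_def N_def)
  have ge2: "q ^ card C * pr n p (av N) \<le> q ^ card C * pr n p (av F) + S"
  proof -
    have "pr n p (av N) \<le> pr n p (\<lambda>G. av F G \<or> (\<exists>D\<in>X. D \<inter> G = {}))"
      by (rule pr_mono) (auto simp: av_def N_def)
    also have "\<dots> \<le> pr n p (av F) + pr n p (\<lambda>G. \<exists>D\<in>X. D \<inter> G = {})" by (rule pr_disj_le)
    also have "pr n p (\<lambda>G. \<exists>D\<in>X. D \<inter> G = {}) \<le> (\<Sum>D\<in>X. pr n p (\<lambda>G. D \<inter> G = {}))"
      by (rule pr_bex_le[OF fin])
    also have "\<dots> = (\<Sum>D\<in>X. q ^ card D)" unfolding q_def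
    proof (rule sum.cong)
      fix D assume "D \<in> X"
      then show "pr n p (\<lambda>G. D \<inter> G = {}) = (1 - p) ^ card D"
        using FV[of D] by (intro pr_avoid p) (auto simp: X_def)
    qed simp
    finally have "q ^ card C * pr n p (av N) \<le> q ^ card C * (pr n p (av F) + (\<Sum>D\<in>X. q ^ card D))"
      using q by (intro mult_left_mono) auto
    also have "\<dots> = q ^ card C * pr n p (av F) + (\<Sum>D\<in>X. q ^ (card C + card D))"
      by (simp add: distrib_left sum_distrib_left power_add)
    \<comment> \<open>Since \<open>card (C \<union> D) \<le> card C + card D\<close> and
      \<open>q \<le> 1\<close>, the products of the separate probabilities are covered by
      \<open>S\<close> too.\<close>
    also have "(\<Sum>D\<in>X. q ^ (card C + card D)) \<le> S"
      unfolding S_def by (intro sum_mono power_decreasing card_Un_le q)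
    finally show ?thesis by simp
  qed
  have step: "\<bar>a - q ^ card C * pr n p (av F)\<bar> \<le> S"
  proof -
    have "q ^ card C * pr n p (av F) \<le> q ^ card C * pr n p (av N)"
      using le2 q by (intro mult_left_mono) auto
    then show ?thesis using le1 ge1 ge2 by linarith
  qed
  define P where "P = (\<Prod>C\<in>F. 1 - q ^ card C)"
  define R where "R = (\<Sum>C\<in>F. \<Sum>D\<in>{D \<in> F. D \<noteq> C \<and> C \<inter> D \<noteq> {}}. q ^ card (C \<union> D))"
  have IH: "\<bar>pr n p (av F) - P\<bar> \<le> R"
    using insert.IH insert.prems unfolding av_def[abs_def] P_def R_def q_def by blast
  have qc: "0 \<le> 1 - q ^ card C" "1 - q ^ card C \<le> 1" using q power_le_one[of q "card C"] by auto
  \<comment> \<open>The old error is multiplied by \<open>1 - q ^ card C\<close>, which is at most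
    1, so each inclusion only adds its own \<open>S\<close>.\<close>
  have "\<bar>pr n p (av (insert C F)) - (1 - q ^ card C) * P\<bar> =
      \<bar>(q ^ card C * pr n p (av F) - a) + (1 - q ^ card C) * (pr n p (av F) - P)\<bar>"
    unfolding fC by (simp add: algebra_simps)
  also have "\<dots> \<le> \<bar>q ^ card C * pr n p (av F) - a\<bar> + \<bar>(1 - q ^ card C) * (pr n p (av F) - P)\<bar>"
    by (rule abs_triangle_ineq)
  also have "\<dots> \<le> S + R"
  proof (rule add_mono)
    show "\<bar>q ^ card C * pr n p (av F) - a\<bar> \<le> S" using step by (simp add: abs_minus_commute)
    have "\<bar>(1 - q ^ card C) * (pr n p (av F) - P)\<bar> = (1 - q ^ card C) * \<bar>pr n p (av F) - P\<bar>"
      using qc by (simp add: abs_mult)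
    also have "\<dots> \<le> 1 * \<bar>pr n p (av F) - P\<bar>" using qc by (intro mult_right_mono) auto
    finally show "\<bar>(1 - q ^ card C) * (pr n p (av F) - P)\<bar> \<le> R" using IH by simp
  qed
  also have "S + R \<le> (\<Sum>C'\<in>insert C F. \<Sum>D\<in>{D \<in> insert C F. D \<noteq> C' \<and> C' \<inter> D \<noteq> {}}. q ^ card (C' \<union> D))"
  proof -
    have "{D \<in> insert C F. D \<noteq> C \<and> C \<inter> D \<noteq> {}} = X" using insert.hyps by (auto simp: X_def)
    moreover have "R \<le> (\<Sum>C'\<in>F. \<Sum>D\<in>{D \<in> insert C F. D \<noteq> C' \<and> C' \<inter> D \<noteq> {}}. q ^ card (C' \<union> D))"
      unfolding R_def using insert.hyps q by (intro sum_mono sum_mono2) auto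
    ultimately show ?thesis using insert.hyps by (simp add: S_def)
  qed
  finally show ?case unfolding av_def[abs_def] P_def q_def using insert.hyps by simp
qed

text \<open>The factor \<open>(2 ^ 2 ^ v)\<^sup>2\<close> bounds the number of pairs of edge sets on \<open>v\<close> vertices.\<close>

definition dense_bound :: "nat \<Rightarrow> nat \<Rightarrow> real \<Rightarrow> real" where
  "dense_bound M n q = (\<Sum>v\<le>M. real n ^ v * ((2 ^ 2 ^ v) ^ 2 * q ^ Suc v))"

lemma sum_subsets_bound:
  fixes phi :: "nat \<Rightarrow> real"
  assumes "\<And>v. 0 \<le> phi v"
  shows "(\<Sum>V\<in>{V. V \<subseteq> {1..n} \<and> card V \<le> M}. phi (card V)) \<le> (\<Sum>v\<le>M. real n ^ v * phi v)"
proof -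
  let ?S = "{V. V \<subseteq> {1..n} \<and> card V \<le> M}"
  have "(\<Sum>V\<in>?S. phi (card V)) = (\<Sum>v\<in>{..M}. \<Sum>V\<in>{V \<in> ?S. card V = v}. phi (card V))"
    by (rule sum.group[symmetric]) auto
  also have "\<dots> \<le> (\<Sum>v\<le>M. real n ^ v * phi v)"
  proof (rule sum_mono)
    fix v assume "v \<in> {..M}"
    then have "{V \<in> ?S. card V = v} = {V. V \<subseteq> {1..n} \<and> card V = v}" by auto
    then have "(\<Sum>V\<in>{V \<in> ?S. card V = v}. phi (card V)) = real (n choose v) * phi v"
      using n_subsets[of "{1..n}" v] by simp
    also have "\<dots> \<le> real n ^ v * phi v"
    proof (rule mult_right_mono)
      have "n choose v \<le> n ^ v" by (cases "v \<le> n") (simp_all add: binomial_le_pow binomial_eq_0 not_le)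
      then show "real (n choose v) \<le> real n ^ v" by (metis of_nat_le_iff of_nat_power)
    qed (rule assms)
    finally show "(\<Sum>V\<in>{V \<in> ?S. card V = v}. phi (card V)) \<le> real n ^ v * phi v" .
  qed
  finally show ?thesis .
qed

lemma card_Pow_Pow: "finite V \<Longrightarrow> card (Pow (Pow V)) = 2 ^ 2 ^ card V"
  by (simp add: card_Pow)

text \<open>Union bound over vertex sets and edge sets; as \<open>q \<le> 1\<close>, avoiding more
  than \<open>card V\<close> edges has probability at most \<open>q ^ Suc (card V)\<close>.\<close>

lemma pr_dense_le:
  assumes p: "0 \<le> p" "p \<le> 1"
  shows "pr n p (dense n M) \<le> dense_bound M n (1 - p)"
proof -
  define q where "q = 1 - p"
  have q: "0 \<le> q" "q \<le> 1" using p by (auto simp: q_def)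
  let ?S = "{V. V \<subseteq> {1..n} \<and> card V \<le> M}"
  let ?E = "\<lambda>V. {E. E \<subseteq> Pow V \<inter> vertex_pairs n \<and> card V < card E}"
  have finE: "finite (?E V)" for V by (rule finite_subset[of _ "Pow (vertex_pairs n)"]) auto
  have "pr n p (dense n M) \<le> pr n p (\<lambda>G. \<exists>V\<in>?S. \<exists>E\<in>?E V. E \<inter> G = {})"
    by (rule pr_mono) (auto simp: dense_def)
  also have "\<dots> \<le> (\<Sum>V\<in>?S. pr n p (\<lambda>G. \<exists>E\<in>?E V. E \<inter> G = {}))"
    by (rule pr_bex_le) simp
  also have "\<dots> \<le> (\<Sum>V\<in>?S. (2 ^ 2 ^ card V) ^ 2 * q ^ Suc (card V))"
  proof (rule sum_mono)
    fix V assume V: "V \<in> ?S"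
    then have finV: "finite V" using finite_subset by blast
    have "pr n p (\<lambda>G. \<exists>E\<in>?E V. E \<inter> G = {}) \<le> (\<Sum>E\<in>?E V. pr n p (\<lambda>G. E \<inter> G = {}))"
      by (rule pr_bex_le[OF finE])
    also have "\<dots> \<le> (\<Sum>E\<in>?E V. q ^ Suc (card V))"
    proof (rule sum_mono)
      fix E assume E: "E \<in> ?E V"
      then have "pr n p (\<lambda>G. E \<inter> G = {}) = q ^ card E" unfolding q_def by (intro pr_avoid p) auto
      also have "\<dots> \<le> q ^ Suc (card V)" using E q by (intro power_decreasing) auto
      finally show "pr n p (\<lambda>G. E \<inter> G = {}) \<le> q ^ Suc (card V)" .
    qed
    also have "\<dots> = real (card (?E V)) * q ^ Suc (card V)" by simp
    also have "\<dots> \<le> (2 ^ 2 ^ card V) ^ 2 * q ^ Suc (card V)"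
    proof (rule mult_right_mono)
      have "card (?E V) \<le> card (Pow (Pow V))" using finV by (intro card_mono) auto
      then have "real (card (?E V)) \<le> real (2 ^ 2 ^ card V)"
        unfolding card_Pow_Pow[OF finV] by (simp only: of_nat_le_iff)
      then have "real (card (?E V)) \<le> 2 ^ 2 ^ card V" by simp
      also have "\<dots> \<le> (2 ^ 2 ^ card V) ^ 2" by (rule self_le_power) auto
      finally show "real (card (?E V)) \<le> (2 ^ 2 ^ card V) ^ 2" .
    qed (use q in simp)
    finally show "pr n p (\<lambda>G. \<exists>E\<in>?E V. E \<inter> G = {}) \<le> (2 ^ 2 ^ card V) ^ 2 * q ^ Suc (card V)" .
  qed
  also have "\<dots> \<le> (\<Sum>v\<le>M. real n ^ v * ((2 ^ 2 ^ v) ^ 2 * q ^ Suc v))"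
    by (rule sum_subsets_bound) (use q in simp)
  finally show ?thesis by (simp add: dense_bound_def q_def)
qed

section \<open>Short cycles and induced cycles\<close>

definition short_cycles :: "nat \<Rightarrow> nat set \<Rightarrow> nat set set set" where
  "short_cycles n K = (\<Union>k\<in>K. cycles n k)"

lemma finite_cycle_lists [simp]: "finite (cycle_lists n k)"
  by (rule finite_subset[OF _ finite_lists_length_eq[of "{1..n}" k]]) (auto simp: cycle_lists_def)

lemma finite_cycles [simp]: "finite (cycles n k)"
  by (simp add: cycles_def)

lemma cycles_card: "3 \<le> k \<Longrightarrow> C \<in> cycles n k \<Longrightarrow> card C = k"
  by (auto simp: cycles_def cycle_lists_def card_cyc_edges)

lemma cycles_vertex_pairs:
  assumes "3 \<le> k" "C \<in> cycles n k"
  shows "C \<subseteq> vertex_pairs n"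
proof -
  obtain vs where "C = cyc_edges vs" "length vs = k" "distinct vs" "set vs \<subseteq> {1..n}"
    using assms(2) by (auto simp: cycles_def cycle_lists_def)
  then show ?thesis using cyc_edges_vertex_pairs[of vs n] assms(1) by simp
qed

lemma sum_UN_le:
  fixes f :: "'a \<Rightarrow> real"
  assumes "finite S" "\<And>s. s \<in> S \<Longrightarrow> finite (A s)" "\<And>x. 0 \<le> f x"
  shows "sum f (\<Union>s\<in>S. A s) \<le> (\<Sum>s\<in>S. sum f (A s))"
  using assms(1,2)
proof (induction S rule: finite_induct)
  case (insert s S)
  have "sum f (A s \<union> (\<Union>s\<in>S. A s)) + sum f (A s \<inter> (\<Union>s\<in>S. A s)) = sum f (A s) + sum f (\<Union>s\<in>S. A s)"
    using insert by (intro sum.union_inter) auto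
  moreover have "0 \<le> sum f (A s \<inter> (\<Union>s\<in>S. A s))" by (intro sum_nonneg assms(3))
  moreover have "sum f (\<Union>s\<in>S. A s) \<le> (\<Sum>s\<in>S. sum f (A s))" using insert by simp
  ultimately show ?case using insert.hyps by simp
qed simp

text \<open>Group the pairs by the vertex set of their union, which has at most \<open>2 * L\<close>
  elements. By \<open>overlapping_cycles\<close> the union has more edges than vertices, and
  \<open>v\<close> vertices carry at most \<open>(2 ^ 2 ^ v) ^ 2\<close> pairs.\<close>

lemma overlap_sum_le:
  fixes n :: nat and q :: real
  assumes q: "0 \<le> q" "q \<le> 1" and K: "finite K" "\<And>k. k \<in> K \<Longrightarrow> 3 \<le> k \<and> k \<le> L"
  defines "F \<equiv> short_cycles n K"
  shows "(\<Sum>C\<in>F. \<Sum>D\<in>{D \<in> F. D \<noteq> C \<and> C \<inter> D \<noteq> {}}. q ^ card (C \<union> D)) \<le> dense_bound (2 * L) n q"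
proof -
  let ?S = "{V. V \<subseteq> {1..n} \<and> card V \<le> 2 * L}"
  let ?P = "\<lambda>V. Pow (Pow V) \<times> Pow (Pow V)"
  have finF: "finite F" using K by (simp add: F_def short_cycles_def)
  have finV: "finite V" if "V \<in> ?S" for V using that finite_subset by blast
  define X where "X = (SIGMA C:F. {D \<in> F. D \<noteq> C \<and> C \<inter> D \<noteq> {}})"
  have over: "\<Union>(C \<union> D) \<in> ?S \<and> card (\<Union>(C \<union> D)) < card (C \<union> D) \<and> (C, D) \<in> ?P (\<Union>(C \<union> D))" if "(C, D) \<in> X" for C D
  proof -
    have CD: "C \<in> F" "D \<in> F" "D \<noteq> C" "C \<inter> D \<noteq> {}" using that by (auto simp: X_def)
    obtain k vs where vs: "k \<in> K" "vs \<in> cycle_lists n k" "C = cyc_edges vs"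
      using CD(1) by (auto simp: F_def short_cycles_def cycles_def)
    obtain l ws where ws: "l \<in> K" "ws \<in> cycle_lists n l" "D = cyc_edges ws"
      using CD(2) by (auto simp: F_def short_cycles_def cycles_def)
    have v: "distinct vs" "3 \<le> length vs" "length vs \<le> L" "set vs \<subseteq> {1..n}"
      using vs K(2)[OF vs(1)] by (auto simp: cycle_lists_def)
    have w: "distinct ws" "3 \<le> length ws" "length ws \<le> L" "set ws \<subseteq> {1..n}"
      using ws K(2)[OF ws(1)] by (auto simp: cycle_lists_def)
    have U: "\<Union>(C \<union> D) = set vs \<union> set ws" by (simp add: vs ws Union_cyc_edges)
    have "card (set vs \<union> set ws) \<le> length vs + length ws"
      using card_Un_le[of "set vs" "set ws"] card_length[of vs] card_length[of ws] by linarith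
    then have "card (set vs \<union> set ws) \<le> 2 * L" using v w by linarith
    moreover have "card (set vs \<union> set ws) < card (C \<union> D)"
      unfolding vs(3) ws(3) using CD unfolding vs(3) ws(3) by (intro overlapping_cycles v w)
    moreover have "C \<subseteq> Pow (\<Union>(C \<union> D))" "D \<subseteq> Pow (\<Union>(C \<union> D))" by auto
    ultimately show ?thesis using v(4) w(4) unfolding U by simp
  qed
  have inX: "X \<subseteq> (\<Union>V\<in>?S. {(C, D) \<in> ?P V. card V < card (C \<union> D)})"
  proof
    fix x assume x: "x \<in> X"
    obtain C D where "x = (C, D)" by (cases x)
    then show "x \<in> (\<Union>V\<in>?S. {(C, D) \<in> ?P V. card V < card (C \<union> D)})"
      using over[of C D] x by (intro UN_I[of "\<Union>(C \<union> D)"]) auto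
  qed
  have finP: "finite {(C, D) \<in> ?P V. card V < card (C \<union> D)}" if "V \<in> ?S" for V
    by (rule finite_subset[of _ "?P V"]) (use finV[OF that] in auto)
  have "(\<Sum>C\<in>F. \<Sum>D\<in>{D \<in> F. D \<noteq> C \<and> C \<inter> D \<noteq> {}}. q ^ card (C \<union> D)) = (\<Sum>(C, D)\<in>X. q ^ card (C \<union> D))"
    unfolding X_def using finF by (intro sum.Sigma) auto
  also have "\<dots> \<le> (\<Sum>(C, D)\<in>(\<Union>V\<in>?S. {(C, D) \<in> ?P V. card V < card (C \<union> D)}). q ^ card (C \<union> D))"
    using finP q by (intro sum_mono2 inX) auto
  also have "\<dots> \<le> (\<Sum>V\<in>?S. \<Sum>(C, D)\<in>{(C, D) \<in> ?P V. card V < card (C \<union> D)}. q ^ card (C \<union> D))"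
    using q finP by (intro sum_UN_le) auto
  also have "\<dots> \<le> (\<Sum>V\<in>?S. (2 ^ 2 ^ card V) ^ 2 * q ^ Suc (card V))"
  proof (rule sum_mono)
    fix V assume V: "V \<in> ?S"
    have "(\<Sum>(C, D)\<in>{(C, D) \<in> ?P V. card V < card (C \<union> D)}. q ^ card (C \<union> D))
        \<le> (\<Sum>x\<in>{(C, D) \<in> ?P V. card V < card (C \<union> D)}. q ^ Suc (card V))"
      using q by (intro sum_mono) (auto intro!: power_decreasing simp del: power_Suc)
    also have "\<dots> \<le> real (card (?P V)) * q ^ Suc (card V)"
    proof -
      have "card {(C, D) \<in> ?P V. card V < card (C \<union> D)} \<le> card (?P V)"
        using finV[OF V] by (intro card_mono) auto
      then show ?thesis using q by (simp add: mult_right_mono del: power_Suc)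
    qed
    also have "real (card (?P V)) = (2 ^ 2 ^ card V) ^ 2"
      using card_Pow_Pow[OF finV[OF V]] by (simp add: card_cartesian_product power2_eq_square)
    finally show "(\<Sum>(C, D)\<in>{(C, D) \<in> ?P V. card V < card (C \<union> D)}. q ^ card (C \<union> D))
        \<le> (2 ^ 2 ^ card V) ^ 2 * q ^ Suc (card V)" .
  qed
  also have "\<dots> \<le> (\<Sum>v\<le>2 * L. real n ^ v * ((2 ^ 2 ^ v) ^ 2 * q ^ Suc v))"
    by (rule sum_subsets_bound) (use q in simp)
  finally show ?thesis by (simp add: dense_bound_def)
qed

lemma prod_short_cycles:
  fixes q :: real
  assumes K: "finite K" "\<And>k. k \<in> K \<Longrightarrow> 3 \<le> k"
  shows "(\<Prod>C\<in>short_cycles n K. 1 - q ^ card C) = (\<Prod>k\<in>K. (1 - q ^ k) ^ card (cycles n k))"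
proof -
  have "(\<Prod>C\<in>short_cycles n K. 1 - q ^ card C) = (\<Prod>k\<in>K. \<Prod>C\<in>cycles n k. 1 - q ^ card C)"
    unfolding short_cycles_def
  proof (rule prod.UNION_disjoint)
    show "\<forall>i\<in>K. \<forall>j\<in>K. i \<noteq> j \<longrightarrow> cycles n i \<inter> cycles n j = {}" using K(2) cycles_card by blast
  qed (use K in auto)
  also have "\<dots> = (\<Prod>k\<in>K. (1 - q ^ k) ^ card (cycles n k))"
  proof (rule prod.cong)
    fix k assume "k \<in> K"
    then have "(\<Prod>C\<in>cycles n k. 1 - q ^ card C) = (\<Prod>C\<in>cycles n k. 1 - q ^ k)"
      using K(2) cycles_card by (intro prod.cong) auto
    then show "(\<Prod>C\<in>cycles n k. 1 - q ^ card C) = (1 - q ^ k) ^ card (cycles n k)" by simp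
  qed simp
  finally show ?thesis .
qed

definition no_induced :: "nat \<Rightarrow> nat set \<Rightarrow> nat set set \<Rightarrow> bool" where
  "no_induced n K G \<longleftrightarrow> (\<forall>vs. length vs \<in> K \<longrightarrow> \<not> induced_cycle n G vs)"

text \<open>If every short cycle meets \<open>G\<close>, none is induced; conversely, a short cycle
  that avoids \<open>G\<close> without being induced has a chord. The error term for
  \<open>L\<close> vertices accounts for chords, the one for \<open>2 * L\<close> vertices for the
  overlapping pairs in \<open>pr_avoid_family\<close>.\<close>

lemma pr_no_induced_approx:
  assumes p: "0 \<le> p" "p \<le> 1" and K: "finite K" "\<And>k. k \<in> K \<Longrightarrow> 4 \<le> k \<and> k \<le> L"
  shows "\<bar>pr n p (no_induced n K) - (\<Prod>k\<in>K. (1 - (1 - p) ^ k) ^ card (cycles n k))\<bar>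
    \<le> dense_bound L n (1 - p) + dense_bound (2 * L) n (1 - p)"
proof -
  let ?F = "short_cycles n K"
  let ?av = "\<lambda>G. \<forall>C\<in>?F. C \<inter> G \<noteq> {}"
  have K3: "3 \<le> k \<and> k \<le> L" if "k \<in> K" for k using K(2)[OF that] by simp
  have finF: "finite ?F" using K by (simp add: short_cycles_def)
  have FV: "C \<subseteq> vertex_pairs n" if C: "C \<in> ?F" for C
  proof -
    obtain k where "k \<in> K" "C \<in> cycles n k" using C unfolding short_cycles_def by blast
    then show ?thesis using K3 cycles_vertex_pairs[of k C n] by blast
  qed
  have "\<bar>pr n p ?av - (\<Prod>C\<in>?F. 1 - (1 - p) ^ card C)\<bar> \<le> dense_bound (2 * L) n (1 - p)"
    by (rule order_trans[OF pr_avoid_family[OF p finF FV] overlap_sum_le]) (use p K K3 in auto)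
  then have 1: "\<bar>pr n p ?av - (\<Prod>k\<in>K. (1 - (1 - p) ^ k) ^ card (cycles n k))\<bar> \<le> dense_bound (2 * L) n (1 - p)"
    using prod_short_cycles[OF K(1), where q = "1 - p" and n = n] K3 by simp
  have 2: "pr n p ?av \<le> pr n p (no_induced n K)"
  proof (rule pr_mono)
    fix G assume av: "?av G"
    show "no_induced n K G"
      unfolding no_induced_def
    proof (intro allI impI notI)
      fix vs assume vs: "length vs \<in> K" "induced_cycle n G vs"
      then have "cyc_edges vs \<inter> G = {}" using K3 by (intro induced_cycle_cyc_edges) auto
      moreover have "cyc_edges vs \<in> ?F"
        unfolding short_cycles_def
      proof (rule UN_I[OF vs(1)])
        show "cyc_edges vs \<in> cycles n (length vs)"
          unfolding cycles_def by (rule imageI) (use vs(2) in \<open>simp add: cycle_lists_def induced_cycle_def\<close>)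
      qed
      ultimately show False using av by blast
    qed
  qed
  have "pr n p (no_induced n K) \<le> pr n p (\<lambda>G. ?av G \<or> dense n L G)"
  proof (rule pr_mono)
    fix G assume ni: "no_induced n K G"
    show "?av G \<or> dense n L G"
    proof (cases "dense n L G")
      case nd: False
      have "C \<inter> G \<noteq> {}" if CF: "C \<in> ?F" for C
      proof
        assume C: "C \<inter> G = {}"
        obtain k where k: "k \<in> K" "C \<in> cycles n k" using CF unfolding short_cycles_def by blast
        then obtain vs where vs: "vs \<in> cycle_lists n k" "C = cyc_edges vs" by (auto simp: cycles_def)
        have "\<not> induced_cycle n G vs" using ni vs k(1) by (auto simp: no_induced_def cycle_lists_def)
        then have "dense n L G" using non_induced_cycle_dense[OF vs(1), of L G] K3[OF k(1)] C vs(2) by simp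
        then show False using nd by simp
      qed
      then show ?thesis by blast
    qed simp
  qed
  also have "\<dots> \<le> pr n p ?av + dense_bound L n (1 - p)"
    using pr_disj_le[of n p ?av "dense n L"] pr_dense_le[OF p, of n L] by linarith
  finally show ?thesis using 1 2 by linarith
qed

section \<open>Few edges, adjacent edges and long cycles\<close>

lemma pr_few_edges:
  fixes n :: nat and p :: real
  assumes p: "0 \<le> p" "p \<le> 1"
  defines "N \<equiv> card (vertex_pairs n)"
  shows "pr n p (\<lambda>G. card G \<le> 1) = (1 - p) ^ N + real N * p * (1 - p) ^ (N - 1)"
proof -
  let ?V = "vertex_pairs n"
  have 0: "pr n p (\<lambda>G. ?V \<inter> G = {}) = (1 - p) ^ N"
    unfolding N_def by (rule pr_avoid[OF p]) simp
  have one: "pr n p (\<lambda>G. (?V - {e}) \<inter> G = {} \<and> e \<in> G) = p * (1 - p) ^ (N - 1)" if e: "e \<in> ?V" for e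
  proof -
    have "pr n p (\<lambda>G. (?V - {e}) \<inter> G = {}) = (1 - p) ^ (N - 1)"
      using e by (subst pr_avoid[OF p]) (auto simp: N_def)
    moreover have "pr n p (\<lambda>G. (?V - {e}) \<inter> G = {} \<and> \<not> e \<in> G) = (1 - p) ^ N"
      unfolding 0[symmetric] by (rule pr_cong) (use e in auto)
    moreover have "N = Suc (N - 1)" using e card_gt_0_iff[of ?V] unfolding N_def by auto
    then have "(1 - p) ^ N = (1 - p) * (1 - p) ^ (N - 1)" by (metis power_Suc)
    ultimately show ?thesis
      using pr_split[of n p "\<lambda>G. (?V - {e}) \<inter> G = {}" "\<lambda>G. e \<in> G"] by (simp add: algebra_simps)
  qed
  have "pr n p (\<lambda>G. card G \<le> 1) = pr n p (\<lambda>G. card G \<le> 1 \<and> ?V \<inter> G = {}) + pr n p (\<lambda>G. card G \<le> 1 \<and> \<not> ?V \<inter> G = {})"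
    by (rule pr_split)
  also have "pr n p (\<lambda>G. card G \<le> 1 \<and> ?V \<inter> G = {}) = (1 - p) ^ N"
    unfolding 0[symmetric]
  proof (rule pr_cong)
    fix G assume "G \<subseteq> ?V"
    then have "?V \<inter> G = G" by blast
    then show "(card G \<le> 1 \<and> ?V \<inter> G = {}) = (?V \<inter> G = {})" by auto
  qed
  also have "pr n p (\<lambda>G. card G \<le> 1 \<and> \<not> ?V \<inter> G = {}) = pr n p (\<lambda>G. \<exists>e\<in>?V. (?V - {e}) \<inter> G = {} \<and> e \<in> G)"
  proof (rule pr_cong)
    fix G assume G: "G \<subseteq> ?V"
    then have fin: "finite G" using finite_subset finite_vertex_pairs by blast
    show "(card G \<le> 1 \<and> \<not> ?V \<inter> G = {}) = (\<exists>e\<in>?V. (?V - {e}) \<inter> G = {} \<and> e \<in> G)"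
    proof
      assume *: "card G \<le> 1 \<and> \<not> ?V \<inter> G = {}"
      then obtain e where e: "e \<in> ?V" "e \<in> G" by blast
      then have "f = e" if "f \<in> G" for f using * that card_le_Suc0_iff_eq[OF fin] by auto
      then show "\<exists>e\<in>?V. (?V - {e}) \<inter> G = {} \<and> e \<in> G" using e by blast
    next
      assume "\<exists>e\<in>?V. (?V - {e}) \<inter> G = {} \<and> e \<in> G"
      then obtain e where e: "e \<in> ?V" "(?V - {e}) \<inter> G = {}" "e \<in> G" by blast
      then have "G = {e}" using G by blast
      then show "card G \<le> 1 \<and> \<not> ?V \<inter> G = {}" using e by auto
    qed
  qed
  also have "\<dots> = (\<Sum>e\<in>?V. pr n p (\<lambda>G. (?V - {e}) \<inter> G = {} \<and> e \<in> G))"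
  proof -
    have "{G. \<exists>e\<in>?V. (?V - {e}) \<inter> G = {} \<and> e \<in> G} = (\<Union>e\<in>?V. {G. (?V - {e}) \<inter> G = {} \<and> e \<in> G})" by auto
    moreover have "disjoint_family_on (\<lambda>e. {G. (?V - {e}) \<inter> G = {} \<and> e \<in> G}) ?V"
      unfolding disjoint_family_on_def by blast
    ultimately show ?thesis unfolding pr_def
      using measure_pmf.finite_measure_finite_Union[of ?V "\<lambda>e. {G. (?V - {e}) \<inter> G = {} \<and> e \<in> G}" "erdos_renyi n p"] by simp
  qed
  also have "\<dots> = real N * p * (1 - p) ^ (N - 1)" using one by (simp add: N_def)
  finally show ?thesis .
qed

text \<open>Union bound over the common vertex \<open>a\<close> and the other ends \<open>b\<close>
  and \<open>c\<close> of the two edges.\<close>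

lemma pr_adjacent_edges:
  assumes p: "0 \<le> p" "p \<le> 1"
  shows "pr n p (\<lambda>G. \<exists>e\<in>G. \<exists>f\<in>G. e \<noteq> f \<and> e \<inter> f \<noteq> {}) \<le> real n ^ 3 * p ^ 2"
proof -
  let ?T = "{1..n} \<times> {1..n} \<times> {1..n}"
  \<comment> \<open>The last conjunct makes triples with \<open>a = b\<close> or
    \<open>a = c\<close> impossible, as a singleton is no vertex pair.\<close>
  let ?R = "\<lambda>(a, b, c) G. {a, b} \<in> G \<and> {a, c} \<in> G \<and> b \<noteq> c \<and> G \<subseteq> vertex_pairs n"
  have two: "pr n p (?R x) \<le> p ^ 2" if x: "x \<in> ?T" for x
  proof -
    obtain a b c where abc: "x = (a, b, c)" by (cases x)
    show ?thesis
    proof (cases "{a, b} \<in> vertex_pairs n \<and> {a, c} \<in> vertex_pairs n \<and> b \<noteq> c")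
      case True
      then have ef: "{a, b} \<in> vertex_pairs n" "{a, c} \<in> vertex_pairs n" "{a, b} \<noteq> {a, c}"
        by (auto simp: doubleton_eq_iff)
      let ?e = "{a, b}" and ?f = "{a, c}"
      have ne: "pr n p (\<lambda>G. ?e \<notin> G) = 1 - p" "pr n p (\<lambda>G. ?f \<notin> G) = 1 - p"
        using pr_avoid[OF p, of "{?e}" n] pr_avoid[OF p, of "{?f}" n] ef by simp_all
      have nef: "pr n p (\<lambda>G. ?e \<notin> G \<and> ?f \<notin> G) = (1 - p) ^ 2"
        using pr_avoid[OF p, of "{?e, ?f}" n] ef by (simp add: power2_eq_square)
      have "1 = pr n p (\<lambda>G. ?e \<in> G) + pr n p (\<lambda>G. ?e \<notin> G)"
        using pr_split[of n p "\<lambda>_. True" "\<lambda>G. ?e \<in> G"] by (simp add: pr_True)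
      moreover have "pr n p (\<lambda>G. ?e \<in> G) = pr n p (\<lambda>G. ?e \<in> G \<and> ?f \<in> G) + pr n p (\<lambda>G. ?e \<in> G \<and> ?f \<notin> G)"
        by (rule pr_split)
      moreover have "pr n p (\<lambda>G. ?f \<notin> G) = pr n p (\<lambda>G. ?f \<notin> G \<and> ?e \<in> G) + pr n p (\<lambda>G. ?f \<notin> G \<and> ?e \<notin> G)"
        by (rule pr_split)
      ultimately have "pr n p (\<lambda>G. ?e \<in> G \<and> ?f \<in> G) = p ^ 2"
        using ne nef by (simp add: conj_commute power2_eq_square algebra_simps)
      moreover have "pr n p (?R x) \<le> pr n p (\<lambda>G. ?e \<in> G \<and> ?f \<in> G)"
        by (rule pr_mono) (simp add: abc)
      ultimately show ?thesis by simp
    next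
      case False
      have "pr n p (?R x) \<le> pr n p (\<lambda>_. False)" by (rule pr_mono) (use False abc in auto)
      also have "\<dots> = 0" by (simp add: pr_def)
      finally show ?thesis by (rule order_trans) simp
    qed
  qed
  have "pr n p (\<lambda>G. \<exists>e\<in>G. \<exists>f\<in>G. e \<noteq> f \<and> e \<inter> f \<noteq> {}) \<le> pr n p (\<lambda>G. \<exists>x\<in>?T. ?R x G)"
  proof (rule pr_mono)
    fix G assume G: "G \<subseteq> vertex_pairs n" and "\<exists>e\<in>G. \<exists>f\<in>G. e \<noteq> f \<and> e \<inter> f \<noteq> {}"
    then obtain e f a where ef: "e \<in> G" "f \<in> G" "e \<noteq> f" "a \<in> e" "a \<in> f" by blast
    have other: "\<exists>b\<in>{1..n}. e = {a, b}" if "e \<in> G" "a \<in> e" for e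
    proof -
      have "card e = 2" "e \<subseteq> {1..n}" using that G by (auto simp: vertex_pairs_def)
      then obtain x y where "e = {x, y}" by (auto simp: card_2_iff)
      then show ?thesis using that(2) \<open>e \<subseteq> {1..n}\<close> by (auto simp: insert_commute)
    qed
    obtain b c where bc: "b \<in> {1..n}" "e = {a, b}" "c \<in> {1..n}" "f = {a, c}" using other ef by metis
    have "a \<in> {1..n}" using ef(1,4) G unfolding vertex_pairs_def by blast
    then show "\<exists>x\<in>?T. ?R x G" using bc ef G by (intro bexI[of _ "(a, b, c)"]) auto
  qed
  also have "\<dots> \<le> (\<Sum>x\<in>?T. pr n p (?R x))" by (rule pr_bex_le) simp
  also have "\<dots> \<le> (\<Sum>x\<in>?T. p ^ 2)" by (rule sum_mono) (rule two)
  also have "\<dots> = real n ^ 3 * p ^ 2" by (simp add: power3_eq_cube mult.assoc)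
  finally show ?thesis .
qed

text \<open>Union bound over the at most \<open>n ^ k\<close> lists of each length, for all cycles
  of the complement and not only induced ones.\<close>

lemma pr_long_cycle:
  assumes p: "0 \<le> p" "p \<le> 1" and L: "2 \<le> L"
  shows "pr n p (\<lambda>G. \<exists>vs. distinct vs \<and> set vs \<subseteq> {1..n} \<and> L < length vs \<and> cyc_edges vs \<inter> G = {})
    \<le> (\<Sum>k\<in>{L<..n}. (real n * (1 - p)) ^ k)"
proof -
  have "pr n p (\<lambda>G. \<exists>vs. distinct vs \<and> set vs \<subseteq> {1..n} \<and> L < length vs \<and> cyc_edges vs \<inter> G = {})
      \<le> pr n p (\<lambda>G. \<exists>k\<in>{L<..n}. \<exists>vs\<in>cycle_lists n k. cyc_edges vs \<inter> G = {})"
  proof (rule pr_mono)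
    fix G assume "\<exists>vs. distinct vs \<and> set vs \<subseteq> {1..n} \<and> L < length vs \<and> cyc_edges vs \<inter> G = {}"
    then obtain vs where vs: "distinct vs" "set vs \<subseteq> {1..n}" "L < length vs" "cyc_edges vs \<inter> G = {}" by blast
    have "length vs \<le> n" using card_mono[of "{1..n}" "set vs"] vs by (simp add: distinct_card)
    then show "\<exists>k\<in>{L<..n}. \<exists>vs\<in>cycle_lists n k. cyc_edges vs \<inter> G = {}"
      using vs by (intro bexI[of _ "length vs"] bexI[of _ vs]) (auto simp: cycle_lists_def)
  qed
  also have "\<dots> \<le> (\<Sum>k\<in>{L<..n}. pr n p (\<lambda>G. \<exists>vs\<in>cycle_lists n k. cyc_edges vs \<inter> G = {}))"
    by (rule pr_bex_le) simp
  also have "\<dots> \<le> (\<Sum>k\<in>{L<..n}. (real n * (1 - p)) ^ k)"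
  proof (rule sum_mono)
    fix k assume k: "k \<in> {L<..n}"
    then have k3: "3 \<le> k" using L by auto
    have "pr n p (\<lambda>G. \<exists>vs\<in>cycle_lists n k. cyc_edges vs \<inter> G = {}) \<le> (\<Sum>vs\<in>cycle_lists n k. pr n p (\<lambda>G. cyc_edges vs \<inter> G = {}))"
      by (rule pr_bex_le) simp
    also have "\<dots> = (\<Sum>vs\<in>cycle_lists n k. (1 - p) ^ k)"
    proof (rule sum.cong)
      fix vs assume vs: "vs \<in> cycle_lists n k"
      then have "cyc_edges vs \<in> cycles n k" by (simp add: cycles_def)
      then show "pr n p (\<lambda>G. cyc_edges vs \<inter> G = {}) = (1 - p) ^ k"
        using pr_avoid[OF p, of "cyc_edges vs" n] cycles_card[OF k3] cycles_vertex_pairs[OF k3] by simp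
    qed simp
    also have "\<dots> \<le> real n ^ k * (1 - p) ^ k"
    proof -
      have "card (cycle_lists n k) \<le> card {xs. set xs \<subseteq> {1..n} \<and> length xs = k}"
        by (intro card_mono finite_lists_length_eq) (auto simp: cycle_lists_def)
      also have "\<dots> = n ^ k" by (simp add: card_lists_length_eq)
      finally have "real (card (cycle_lists n k)) \<le> real n ^ k" by (metis of_nat_le_iff of_nat_power)
      then show ?thesis using p by (simp add: mult_right_mono)
    qed
    finally show "pr n p (\<lambda>G. \<exists>vs\<in>cycle_lists n k. cyc_edges vs \<inter> G = {}) \<le> (real n * (1 - p)) ^ k"
      by (simp add: power_mult_distrib)
  qed
  finally show ?thesis .
qed

section \<open>Limits\<close>

text \<open>Apply \<open>1 + y \<le> exp y\<close> to \<open>y = x / (1 - x)\<close>, for which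
  \<open>1 + y = 1 / (1 - x)\<close>.\<close>

lemma power_one_minus_lower:
  fixes x :: real
  assumes "0 \<le> x" "x < 1"
  shows "exp (- (real N * (x / (1 - x)))) \<le> (1 - x) ^ N"
proof -
  have "1 + x / (1 - x) \<le> exp (x / (1 - x))" by (rule exp_ge_add_one_self)
  moreover have "1 + x / (1 - x) = 1 / (1 - x)" using assms by (simp add: field_simps)
  ultimately have "1 / (1 - x) \<le> exp (x / (1 - x))" by simp
  then have "exp (- (x / (1 - x))) \<le> 1 - x" using assms by (simp add: exp_minus field_simps)
  then have "exp (- (x / (1 - x))) ^ N \<le> (1 - x) ^ N" by (intro power_mono) auto
  then show ?thesis by (simp add: exp_of_nat_mult[symmetric])
qed

lemma power_one_minus_upper:
  fixes x :: real
  assumes "x \<le> 1"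
  shows "(1 - x) ^ N \<le> exp (- (real N * x))"
proof -
  have "1 - x \<le> exp (- x)" using exp_ge_add_one_self[of "- x"] by simp
  then have "(1 - x) ^ N \<le> exp (- x) ^ N" using assms by (intro power_mono) auto
  then show ?thesis by (simp add: exp_of_nat_mult[symmetric])
qed

text \<open>The Poisson limit for the probability of no success. The exponents of the upper and
  lower bounds differ by the factor \<open>1 - x n\<close>, which tends to 1.\<close>

lemma tendsto_power_exp:
  fixes x :: "nat \<Rightarrow> real" and N :: "nat \<Rightarrow> nat"
  assumes x: "\<And>n. 0 \<le> x n" "x \<longlonglongrightarrow> 0" and N: "(\<lambda>n. real (N n) * x n) \<longlonglongrightarrow> m"
  shows "(\<lambda>n. (1 - x n) ^ N n) \<longlonglongrightarrow> exp (- m)"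
proof (rule tendsto_sandwich)
  have lt: "\<forall>\<^sub>F n in sequentially. x n < 1" using order_tendstoD(2)[OF x(2), of 1] by simp
  show "\<forall>\<^sub>F n in sequentially. exp (- (real (N n) * (x n / (1 - x n)))) \<le> (1 - x n) ^ N n"
    using lt by eventually_elim (rule power_one_minus_lower[OF x(1)])
  show "\<forall>\<^sub>F n in sequentially. (1 - x n) ^ N n \<le> exp (- (real (N n) * x n))"
    using lt by eventually_elim (rule power_one_minus_upper, simp)
  have "(\<lambda>n. exp (- ((real (N n) * x n) / (1 - x n)))) \<longlonglongrightarrow> exp (- (m / (1 - 0)))"
    by (intro tendsto_intros N x) simp
  then show "(\<lambda>n. exp (- (real (N n) * (x n / (1 - x n))))) \<longlonglongrightarrow> exp (- m)" by simp
  show "(\<lambda>n. exp (- (real (N n) * x n))) \<longlonglongrightarrow> exp (- m)" by (intro tendsto_intros N)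
qed

section \<open>Limits when \<open>q\<close> tends to 0 and \<open>n * q\<close> tends to
  \<open>c\<close>\<close>

context
  fixes q :: "nat \<Rightarrow> real" and c :: real
  assumes q0: "\<And>n. 0 \<le> q n" and q1: "\<And>n. q n \<le> 1"
    and qlim: "q \<longlonglongrightarrow> 0" and nq: "(\<lambda>n. real n * q n) \<longlonglongrightarrow> c"
begin

text \<open>The summand for \<open>v\<close> is a constant times \<open>(n * q) ^ v * q\<close>, a
  convergent factor times one that tends to 0.\<close>

lemma dense_bound_tendsto: "(\<lambda>n. dense_bound M n (q n)) \<longlonglongrightarrow> 0"
proof -
  have "(\<lambda>n. \<Sum>v\<le>M. (2 ^ 2 ^ v) ^ 2 * ((real n * q n) ^ v * q n)) \<longlonglongrightarrow> (\<Sum>v\<le>M. (2 ^ 2 ^ v) ^ 2 * (c ^ v * 0))"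
    by (intro tendsto_intros nq qlim)
  moreover have "dense_bound M n (q n) = (\<Sum>v\<le>M. (2 ^ 2 ^ v) ^ 2 * ((real n * q n) ^ v * q n))" for n
    unfolding dense_bound_def by (rule sum.cong) (simp_all add: power_mult_distrib mult_ac)
  ultimately show ?thesis by simp
qed

lemma card_cycle_lists_bounds:
  assumes "k \<le> n"
  shows "real (n - k) ^ k \<le> real (card (cycle_lists n k))" "real (card (cycle_lists n k)) \<le> real n ^ k"
proof -
  have eq: "card (cycle_lists n k) = \<Prod>{n - k + 1 .. n}"
    using card_lists_distinct_length_eq[of "{1..n}" k] assms by (simp add: cycle_lists_def)
  have cd: "card {n - k + 1 .. n} = k" using assms by simp
  have "(\<Prod>i\<in>{n - k + 1 .. n}. n - k) \<le> \<Prod>{n - k + 1 .. n}" by (rule prod_mono) auto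
  then have "(n - k) ^ k \<le> card (cycle_lists n k)" using cd eq by simp
  then show "real (n - k) ^ k \<le> real (card (cycle_lists n k))" by (metis of_nat_le_iff of_nat_power)
  have "\<Prod>{n - k + 1 .. n} \<le> (\<Prod>i\<in>{n - k + 1 .. n}. n)" by (rule prod_mono) auto
  then have "card (cycle_lists n k) \<le> n ^ k" using cd eq by simp
  then show "real (card (cycle_lists n k)) \<le> real n ^ k" by (metis of_nat_le_iff of_nat_power)
qed

text \<open>The number of lists lies between \<open>(n - k) ^ k\<close> and \<open>n ^ k\<close>,
  and each cycle is listed \<open>2 * k\<close> times.\<close>

lemma expected_cycles_tendsto:
  assumes k: "3 \<le> k"
  shows "(\<lambda>n. real (card (cycles n k)) * q n ^ k) \<longlonglongrightarrow> c ^ k / (2 * real k)"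
proof -
  have "(\<lambda>n. real (card (cycle_lists n k)) * q n ^ k) \<longlonglongrightarrow> c ^ k"
  proof (rule tendsto_sandwich)
    have ev: "\<forall>\<^sub>F n in sequentially. k \<le> n" by (rule eventually_ge_at_top)
    show "\<forall>\<^sub>F n in sequentially. (real n * q n - real k * q n) ^ k \<le> real (card (cycle_lists n k)) * q n ^ k"
      using ev
    proof eventually_elim
      case (elim n)
      have "(real n * q n - real k * q n) ^ k = real (n - k) ^ k * q n ^ k"
        using elim by (simp add: of_nat_diff power_mult_distrib[symmetric] algebra_simps)
      then show ?case using card_cycle_lists_bounds(1)[OF elim] q0[of n] by (simp add: mult_right_mono)
    qed
    show "\<forall>\<^sub>F n in sequentially. real (card (cycle_lists n k)) * q n ^ k \<le> (real n * q n) ^ k"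
      using ev
    proof eventually_elim
      case (elim n)
      then show ?case using card_cycle_lists_bounds(2)[OF elim] q0[of n]
        by (simp add: power_mult_distrib mult_right_mono)
    qed
    have "(\<lambda>n. (real n * q n - real k * q n) ^ k) \<longlonglongrightarrow> (c - real k * 0) ^ k"
      by (intro tendsto_intros nq qlim)
    then show "(\<lambda>n. (real n * q n - real k * q n) ^ k) \<longlonglongrightarrow> c ^ k" by simp
    show "(\<lambda>n. (real n * q n) ^ k) \<longlonglongrightarrow> c ^ k" by (intro tendsto_intros nq)
  qed
  then have "(\<lambda>n. real (card (cycle_lists n k)) * q n ^ k / (2 * real k)) \<longlonglongrightarrow> c ^ k / (2 * real k)"
    using k by (intro tendsto_divide tendsto_const) auto
  moreover have "real (card (cycle_lists n k)) * q n ^ k / (2 * real k) = real (card (cycles n k)) * q n ^ k" for n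
    using card_cycles[OF k, of n] k by (simp add: field_simps) (metis of_nat_mult of_nat_numeral mult.assoc)
  ultimately show ?thesis by simp
qed

lemma no_induced_tendsto:
  assumes K: "finite K" "\<And>k. k \<in> K \<Longrightarrow> 4 \<le> k \<and> k \<le> L"
  shows "(\<lambda>n. pr n (1 - q n) (no_induced n K)) \<longlonglongrightarrow> exp (- (\<Sum>k\<in>K. c ^ k / (2 * real k)))"
proof -
  define P where "P n = (\<Prod>k\<in>K. (1 - q n ^ k) ^ card (cycles n k))" for n
  have "P \<longlonglongrightarrow> (\<Prod>k\<in>K. exp (- (c ^ k / (2 * real k))))"
    unfolding P_def[abs_def]
  proof (rule tendsto_prod)
    fix k assume k: "k \<in> K"
    show "(\<lambda>n. (1 - q n ^ k) ^ card (cycles n k)) \<longlonglongrightarrow> exp (- (c ^ k / (2 * real k)))"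
    proof (rule tendsto_power_exp)
      have "(\<lambda>n. q n ^ k) \<longlonglongrightarrow> 0 ^ k" by (intro tendsto_intros qlim)
      then show "(\<lambda>n. q n ^ k) \<longlonglongrightarrow> 0" using K(2)[OF k] by (simp add: power_0_left)
      show "(\<lambda>n. real (card (cycles n k)) * q n ^ k) \<longlonglongrightarrow> c ^ k / (2 * real k)"
        by (rule expected_cycles_tendsto) (use K(2)[OF k] in simp)
    qed (simp add: q0)
  qed
  then have Plim: "P \<longlonglongrightarrow> exp (- (\<Sum>k\<in>K. c ^ k / (2 * real k)))"
    using K(1) by (simp add: exp_sum[symmetric] sum_negf)
  have "(\<lambda>n. dense_bound L n (q n) + dense_bound (2 * L) n (q n)) \<longlonglongrightarrow> 0 + 0"
    by (intro tendsto_add dense_bound_tendsto)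
  then have B: "(\<lambda>n. dense_bound L n (q n) + dense_bound (2 * L) n (q n)) \<longlonglongrightarrow> 0" by simp
  have "(\<lambda>n. pr n (1 - q n) (no_induced n K) - P n) \<longlonglongrightarrow> 0"
  proof (rule Lim_null_comparison[OF _ B])
    show "\<forall>\<^sub>F n in sequentially. norm (pr n (1 - q n) (no_induced n K) - P n)
        \<le> dense_bound L n (q n) + dense_bound (2 * L) n (q n)"
    proof (rule always_eventually, rule allI)
      fix n
      show "norm (pr n (1 - q n) (no_induced n K) - P n) \<le> dense_bound L n (q n) + dense_bound (2 * L) n (q n)"
        using pr_no_induced_approx[of "1 - q n" K L n] K q0[of n] q1[of n] by (simp add: P_def)
    qed
  qed
  from tendsto_add[OF this Plim] show ?thesis by simp
qed

text \<open>The absence of induced 4-cycles characterizes linear presentation for every graph, so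
  this is the case \<open>K = {4}\<close>, with the constant \<open>2 * 4\<close>.\<close>

lemma linear_presentation_tendsto:
  "(\<lambda>n. pr n (1 - q n) (\<lambda>G. has_linear_presentation n (edge_ideal n G :: 'k::field mpoly set)))
    \<longlonglongrightarrow> exp (- (c ^ 4 / 8))"
proof -
  have "pr n (1 - q n) (\<lambda>G. has_linear_presentation n (edge_ideal n G :: 'k mpoly set)) = pr n (1 - q n) (no_induced n {4})" for n
  proof (rule pr_cong)
    fix G assume G: "G \<subseteq> vertex_pairs n"
    show "has_linear_presentation n (edge_ideal n G :: 'k mpoly set) \<longleftrightarrow> no_induced n {4} G"
      using no_induced_4_cycle_imp_linear_presentation[OF G, where 'k = 'k] linear_presentation_imp_no_induced_4_cycle[OF G, where 'k = 'k]
      unfolding no_induced_def by blast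
  qed
  then show ?thesis using no_induced_tendsto[of "{4}" 4] by simp
qed

lemma linear_resolution_upper:
  "pr n (1 - q n) (\<lambda>G. has_linear_resolution n (edge_ideal n G :: 'k::field mpoly set)) \<le> pr n (1 - q n) (no_induced n {4..L})"
proof (rule pr_mono)
  fix G assume "G \<subseteq> vertex_pairs n" "has_linear_resolution n (edge_ideal n G :: 'k mpoly set)"
  then show "no_induced n {4..L} G"
    unfolding no_induced_def using linear_resolution_imp_no_induced_cycle by auto
qed

text \<open>Outside \<open>dense\<close>, every cycle of the complement of length between 4 and
  \<open>L\<close> is induced and thus excluded. If the longer ones are absent as well, no cycle of
  length at least 4 remains and simplicial vertices exist in every subset.\<close>

lemma linear_resolution_lower:
  assumes L: "4 \<le> L"
  shows "pr n (1 - q n) (no_induced n {4..L}) - dense_bound L n (q n) - (\<Sum>k\<in>{L<..n}. (real n * q n) ^ k)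
    \<le> pr n (1 - q n) (\<lambda>G. has_linear_resolution n (edge_ideal n G :: 'k::field mpoly set))"
proof -
  let ?p = "1 - q n"
  have p: "0 \<le> ?p" "?p \<le> 1" using q0 q1 by auto
  let ?LR = "\<lambda>G. has_linear_resolution n (edge_ideal n G :: 'k mpoly set)"
  let ?C = "\<lambda>G. \<exists>vs. distinct vs \<and> set vs \<subseteq> {1..n} \<and> L < length vs \<and> cyc_edges vs \<inter> G = {}"
  have "pr n ?p (no_induced n {4..L}) \<le> pr n ?p (\<lambda>G. ?LR G \<or> (dense n L G \<or> ?C G))"
  proof (rule pr_mono)
    fix G assume G: "G \<subseteq> vertex_pairs n" and ni: "no_induced n {4..L} G"
    show "?LR G \<or> (dense n L G \<or> ?C G)"
    proof (cases "dense n L G \<or> ?C G")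
      case False
      have "cyc_edges vs \<inter> G \<noteq> {}" if vs: "distinct vs" "set vs \<subseteq> {1..n}" "4 \<le> length vs" for vs
      proof
        assume av: "cyc_edges vs \<inter> G = {}"
        then have len: "length vs \<le> L" using False vs by (meson not_le)
        then have "\<not> induced_cycle n G vs" using ni vs by (auto simp: no_induced_def)
        then have "dense n L G"
          using vs len av by (intro non_induced_cycle_dense[of vs n "length vs"]) (auto simp: cycle_lists_def)
        then show False using False by blast
      qed
      then have "?LR G"
        by (intro cochordal_imp_linear_resolution[OF G] no_long_cycle_simplicial)
      then show ?thesis ..
    qed simp
  qed
  also have "\<dots> \<le> pr n ?p ?LR + pr n ?p (\<lambda>G. dense n L G \<or> ?C G)" by (rule pr_disj_le)
  also have "pr n ?p (\<lambda>G. dense n L G \<or> ?C G) \<le> pr n ?p (dense n L) + pr n ?p ?C" by (rule pr_disj_le)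
  also have "pr n ?p (dense n L) \<le> dense_bound L n (q n)" using pr_dense_le[OF p, of n L] by simp
  also have "pr n ?p ?C \<le> (\<Sum>k\<in>{L<..n}. (real n * q n) ^ k)" using pr_long_cycle[OF p, of L n] L by simp
  finally show ?thesis by simp
qed

text \<open>Truncating the lengths at \<open>L\<close> gives upper bounds for every
  \<open>c\<close>. The lower bound relies on long cycles being rare, which the union bound yields
  for \<open>c < 1\<close>; in the other case \<open>A = 0\<close> and nonnegativity of
  probabilities is enough.\<close>

lemma linear_resolution_tendsto:
  fixes A :: real
  assumes A: "(\<lambda>L. exp (- (\<Sum>k\<in>{4..L}. c ^ k / (2 * real k)))) \<longlonglongrightarrow> A"
    and c: "0 \<le> c" "c < 1 \<or> A = 0"
  shows "(\<lambda>n. pr n (1 - q n) (\<lambda>G. has_linear_resolution n (edge_ideal n G :: 'k::field mpoly set))) \<longlonglongrightarrow> A"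
proof -
  define f where "f L = exp (- (\<Sum>k\<in>{4..L}. c ^ k / (2 * real k)))" for L
  define a where "a n = pr n (1 - q n) (\<lambda>G. has_linear_resolution n (edge_ideal n G :: 'k mpoly set))" for n
  have ni: "(\<lambda>n. pr n (1 - q n) (no_induced n {4..L})) \<longlonglongrightarrow> f L" for L
    unfolding f_def by (rule no_induced_tendsto[of _ L]) auto
  have fA: "f \<longlonglongrightarrow> A" using A by (simp add: f_def[abs_def])
  have "a \<longlonglongrightarrow> A"
  proof (rule order_tendstoI)
    fix y assume y: "A < y"
    then have "\<forall>\<^sub>F L in sequentially. f L < y" by (rule order_tendstoD(2)[OF fA])
    then obtain L where L: "f L < y" by (auto simp: eventually_sequentially)
    show "\<forall>\<^sub>F n in sequentially. a n < y"
      using order_tendstoD(2)[OF ni[of L] L]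
    proof eventually_elim
      case (elim n)
      then show ?case using linear_resolution_upper[of n L, where 'k = 'k] unfolding a_def by linarith
    qed
  next
    fix y assume y: "y < A"
    show "\<forall>\<^sub>F n in sequentially. y < a n"
    proof (cases "c < 1")
      case False
      then have "y < 0" using y c by simp
      then have "y < a n" for n using pr_nonneg[of n "1 - q n"] unfolding a_def by (rule less_le_trans)
      then show ?thesis by simp
    next
      case True
      \<comment> \<open>Strictly between \<open>c\<close> and 1, so that \<open>n * q\<close> is
        eventually below \<open>rho\<close>. The sum over long cycles is then at most a geometric
        tail, which is small for large \<open>L\<close> uniformly in \<open>n\<close>.\<close>
      define rho where "rho = (c + 1) / 2"
      have rho: "c < rho" "rho < 1" "0 \<le> rho" using True c by (auto simp: rho_def)
      have "(\<lambda>L. f L - rho ^ Suc L / (1 - rho)) \<longlonglongrightarrow> A - 0 / (1 - rho)"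
        using rho by (intro tendsto_intros fA LIMSEQ_Suc[OF LIMSEQ_power_zero]) auto
      then have "\<forall>\<^sub>F L in sequentially. y < f L - rho ^ Suc L / (1 - rho)"
        using y by (intro order_tendstoD(1)) auto
      then have "\<forall>\<^sub>F L in sequentially. y < f L - rho ^ Suc L / (1 - rho) \<and> 4 \<le> L"
        using eventually_ge_at_top[of 4] by (rule eventually_conj)
      then obtain L where L: "y < f L - rho ^ Suc L / (1 - rho)" "4 \<le> L" by (auto simp: eventually_sequentially)
      have "(\<lambda>n. pr n (1 - q n) (no_induced n {4..L}) - dense_bound L n (q n)) \<longlonglongrightarrow> f L - 0"
        by (intro tendsto_diff ni dense_bound_tendsto)
      then have "\<forall>\<^sub>F n in sequentially. y + rho ^ Suc L / (1 - rho) < pr n (1 - q n) (no_induced n {4..L}) - dense_bound L n (q n)"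
        by (rule order_tendstoD(1)) (use L(1) in simp)
      moreover have "\<forall>\<^sub>F n in sequentially. real n * q n < rho" by (rule order_tendstoD(2)[OF nq rho(1)])
      ultimately show ?thesis
      proof eventually_elim
        case (elim n)
        have "(\<Sum>k\<in>{L<..n}. (real n * q n) ^ k) \<le> (\<Sum>k\<in>{L<..n}. rho ^ k)"
          using elim(2) q0[of n] by (intro sum_mono power_mono) auto
        also have "\<dots> \<le> rho ^ Suc L / (1 - rho)"
        proof -
          have "(\<Sum>k\<in>{L<..n}. rho ^ k) \<le> suminf (\<lambda>k. rho ^ (k + Suc L))"
          proof -
            have sm: "summable (\<lambda>k. rho ^ (k + Suc L))" using rho by (intro summable_ignore_initial_segment summable_geometric) auto
            have "(\<Sum>k\<in>{L<..n}. rho ^ k) = (\<Sum>k<n - L. rho ^ (k + Suc L))"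
              by (rule sum.reindex_bij_witness[of _ "\<lambda>k. k + Suc L" "\<lambda>k. k - Suc L"]) auto
            also have "\<dots> \<le> suminf (\<lambda>k. rho ^ (k + Suc L))"
              using rho by (intro sum_le_suminf[OF sm]) auto
            finally show ?thesis .
          qed
          also have "suminf (\<lambda>k. rho ^ (k + Suc L)) = suminf (\<lambda>k. rho ^ k * rho ^ Suc L)" by (simp only: power_add)
          also have "\<dots> = suminf (\<lambda>k. rho ^ k) * rho ^ Suc L"
            using rho by (intro suminf_mult2[symmetric] summable_geometric) auto
          also have "suminf (\<lambda>k. rho ^ k) = 1 / (1 - rho)" using rho by (intro suminf_geometric) auto
          finally show ?thesis by simp
        qed
        finally show ?case
          using elim(1) linear_resolution_lower[OF L(2), of n, where 'k = 'k] unfolding a_def by linarith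
      qed
    qed
  qed
  then show ?thesis by (simp add: a_def[abs_def])
qed

end

text \<open>Divergence of nonnegative terms means unbounded partial sums, so the exponentials tend
  to 0, the value of \<open>exp_neg\<close> at infinity.\<close>

lemma exp_neg_suminf_tendsto:
  fixes a :: "nat \<Rightarrow> real"
  assumes a: "\<And>k. 0 \<le> a k"
  shows "(\<lambda>L. exp (- (\<Sum>k<L. a k))) \<longlonglongrightarrow> exp_neg (suminf (\<lambda>k. ennreal (a k)))"
    and "\<not> summable a \<Longrightarrow> exp_neg (suminf (\<lambda>k. ennreal (a k))) = 0"
proof -
  show *: "exp_neg (suminf (\<lambda>k. ennreal (a k))) = 0" if "\<not> summable a"
  proof -
    have "(suminf (\<lambda>k. ennreal (a k))) = top_class.top"
      using summable_suminf_not_top[of a, OF a] that by blast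
    then show ?thesis by (simp add: exp_neg_def infinity_ennreal_def)
  qed
  show "(\<lambda>L. exp (- (\<Sum>k<L. a k))) \<longlonglongrightarrow> exp_neg (suminf (\<lambda>k. ennreal (a k)))"
  proof (cases "summable a")
    case True
    have "(\<lambda>L. exp (- (\<Sum>k<L. a k))) \<longlonglongrightarrow> exp (- suminf a)"
      by (intro tendsto_intros summable_LIMSEQ True)
    moreover have "(suminf (\<lambda>k. ennreal (a k))) = ennreal (suminf a)" by (rule suminf_ennreal2[OF a True])
    ultimately show ?thesis using suminf_nonneg[OF True a] by (simp add: exp_neg_def infinity_ennreal_def)
  next
    case False
    have "filterlim (\<lambda>L. \<Sum>k<L. a k) at_top sequentially"
    proof (rule ccontr)
      assume nt: "\<not> ?thesis"
      have mono: "incseq (\<lambda>L. \<Sum>k<L. a k)" using a by (intro incseq_SucI) simp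
      obtain B where B: "\<And>L. (\<Sum>k<L. a k) \<le> B"
      proof -
        obtain B where "\<not> (\<forall>\<^sub>F L in sequentially. B \<le> (\<Sum>k<L. a k))" using nt unfolding filterlim_at_top by blast
        then have "\<exists>L\<ge>N. (\<Sum>k<L. a k) < B" for N by (auto simp: eventually_sequentially not_le)
        then have "(\<Sum>k<N. a k) \<le> B" for N using incseqD[OF mono] by (meson le_less_trans less_imp_le)
        then show thesis by (rule that)
      qed
      have "summable a" by (rule summableI_nonneg_bounded[OF a B])
      then show False using False by simp
    qed
    then have "(\<lambda>L. exp (- (\<Sum>k<L. a k))) \<longlonglongrightarrow> 0"
      by (intro filterlim_compose[OF exp_at_bot] filterlim_uminus_at_top[THEN iffD1]) simp
    then show ?thesis using *[OF False] by simp
  qed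
qed

text \<open>Two edges with a common vertex have probability at most \<open>n ^ 3 * p ^ 2\<close>,
  which tends to 0. Otherwise two edges already give an induced 4-cycle of the complement. So both
  probabilities lie between that of \<open>card G \<le> 1\<close> and the same value plus this
  error.\<close>

lemma sparse_tendsto:
  fixes p :: "nat \<Rightarrow> real"
  assumes p: "\<And>n. 0 \<le> p n \<and> p n \<le> 1" and p0: "p \<longlonglongrightarrow> 0" and s: "(\<lambda>n. real n ^ 2 * p n) \<longlonglongrightarrow> s"
  shows "(\<lambda>n. pr n (p n) (\<lambda>G. has_linear_resolution n (edge_ideal n G :: 'k::field mpoly set))) \<longlonglongrightarrow> exp (- s / 2) * (1 + s / 2)"
    and "(\<lambda>n. pr n (p n) (\<lambda>G. has_linear_presentation n (edge_ideal n G :: 'k mpoly set))) \<longlonglongrightarrow> exp (- s / 2) * (1 + s / 2)"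
proof -
  define N where "N n = card (vertex_pairs n)" for n
  define few where "few n = pr n (p n) (\<lambda>G. card G \<le> 1)" for n
  define err where "err n = real n ^ 3 * p n ^ 2" for n
  let ?LR = "\<lambda>n. pr n (p n) (\<lambda>G. has_linear_resolution n (edge_ideal n G :: 'k mpoly set))"
  let ?LP = "\<lambda>n. pr n (p n) (\<lambda>G. has_linear_presentation n (edge_ideal n G :: 'k mpoly set))"
  have inv0: "(\<lambda>n. 1 / real n) \<longlonglongrightarrow> 0" by (rule lim_1_over_n)
  have np: "(\<lambda>n. real n * p n) \<longlonglongrightarrow> 0"
  proof -
    have "(\<lambda>n. (real n ^ 2 * p n) * (1 / real n)) \<longlonglongrightarrow> s * 0" by (intro tendsto_mult s inv0)
    moreover have "(real n ^ 2 * p n) * (1 / real n) = real n * p n" for n by (simp add: power2_eq_square)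
    ultimately show ?thesis by simp
  qed
  have Neq: "real (N n) = real n * (real n - 1) / 2" for n
  proof -
    have "N n = n choose 2" using n_subsets[of "{1..n}" 2] by (simp add: N_def vertex_pairs_def)
    then show ?thesis by (cases n) (simp_all add: choose_two real_of_nat_div algebra_simps)
  qed
  have Np: "(\<lambda>n. real (N n) * p n) \<longlonglongrightarrow> s / 2"
  proof -
    have "(\<lambda>n. (real n ^ 2 * p n - real n * p n) / 2) \<longlonglongrightarrow> (s - 0) / 2" by (intro tendsto_intros s np) simp
    moreover have "(real n ^ 2 * p n - real n * p n) / 2 = real (N n) * p n" for n
      unfolding Neq by (simp add: power2_eq_square algebra_simps)
    ultimately show ?thesis by simp
  qed
  have e1: "(\<lambda>n. (1 - p n) ^ N n) \<longlonglongrightarrow> exp (- (s / 2))"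
    by (rule tendsto_power_exp[OF _ p0 Np]) (use p in simp)
  \<comment> \<open>The subtraction is truncated at \<open>N n = 0\<close>; the sandwich covers that
    case without a distinction.\<close>
  have "(\<lambda>n. real (N n - 1) * p n) \<longlonglongrightarrow> s / 2"
  proof (rule tendsto_sandwich[OF _ _ _ Np])
    have "(\<lambda>n. real (N n) * p n - p n) \<longlonglongrightarrow> s / 2 - 0" by (intro tendsto_diff Np p0)
    then show "(\<lambda>n. real (N n) * p n - p n) \<longlonglongrightarrow> s / 2" by simp
    have "real (N n) * p n - p n \<le> real (N n - 1) * p n" for n
    proof -
      have "(real (N n) - 1) * p n \<le> real (N n - 1) * p n" using p[of n] by (intro mult_right_mono) linarith+
      then show ?thesis by (simp add: algebra_simps)
    qed
    then show "\<forall>\<^sub>F n in sequentially. real (N n) * p n - p n \<le> real (N n - 1) * p n" by simp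
    have "real (N n - 1) * p n \<le> real (N n) * p n" for n using p[of n] by (intro mult_right_mono) auto
    then show "\<forall>\<^sub>F n in sequentially. real (N n - 1) * p n \<le> real (N n) * p n" by simp
  qed
  then have e2: "(\<lambda>n. (1 - p n) ^ (N n - 1)) \<longlonglongrightarrow> exp (- (s / 2))"
    by (intro tendsto_power_exp[OF _ p0]) (use p in simp_all)
  have few_lim: "few \<longlonglongrightarrow> exp (- s / 2) * (1 + s / 2)"
  proof -
    have "(\<lambda>n. (1 - p n) ^ N n + real (N n) * p n * (1 - p n) ^ (N n - 1)) \<longlonglongrightarrow> exp (- (s / 2)) + s / 2 * exp (- (s / 2))"
      by (intro tendsto_intros e1 e2 Np)
    moreover have "few = (\<lambda>n. (1 - p n) ^ N n + real (N n) * p n * (1 - p n) ^ (N n - 1))"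
      unfolding few_def N_def using p by (intro ext pr_few_edges) auto
    ultimately have "few \<longlonglongrightarrow> exp (- (s / 2)) + s / 2 * exp (- (s / 2))" by (simp only:)
    then show ?thesis by (simp add: algebra_simps)
  qed
  have err_lim: "err \<longlonglongrightarrow> 0"
  proof -
    have "(\<lambda>n. (real n ^ 2 * p n) * (real n * p n)) \<longlonglongrightarrow> s * 0" by (intro tendsto_mult s np)
    moreover have "(real n ^ 2 * p n) * (real n * p n) = err n" for n
      by (simp add: err_def power2_eq_square power3_eq_cube)
    ultimately show ?thesis by simp
  qed
  have low: "few n \<le> ?LR n" for n
    unfolding few_def
  proof (rule pr_mono)
    fix G assume G: "G \<subseteq> vertex_pairs n" "card G \<le> 1"
    have "finite G" using G(1) finite_subset finite_vertex_pairs by blast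
    then show "has_linear_resolution n (edge_ideal n G :: 'k mpoly set)"
      by (intro cochordal_imp_linear_resolution[OF G(1)] few_edges_simplicial G(2))
  qed
  have mid: "?LR n \<le> ?LP n" for n
    by (rule pr_mono) (rule has_linear_resolution_imp_presentation)
  have up: "?LP n \<le> few n + err n" for n
  proof -
    let ?A = "\<lambda>G. \<exists>e\<in>G. \<exists>f\<in>G. e \<noteq> f \<and> e \<inter> f \<noteq> {}"
    have "?LP n \<le> pr n (p n) (\<lambda>G. card G \<le> 1 \<or> ?A G)"
    proof (rule pr_mono)
      fix G assume G: "G \<subseteq> vertex_pairs n" and LP: "has_linear_presentation n (edge_ideal n G :: 'k mpoly set)"
      show "card G \<le> 1 \<or> ?A G"
      proof (rule ccontr)
        assume neg: "\<not> ?thesis"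
        have fin: "finite G" using G finite_subset finite_vertex_pairs by blast
        then obtain e f where ef: "e \<in> G" "f \<in> G" "e \<noteq> f" using neg card_le_Suc0_iff_eq[OF fin] by auto
        obtain vs where "length vs = 4" "induced_cycle n G vs"
          by (rule matching_induced_4_cycle[OF G ef]) (use neg in blast)+
        then show False using linear_presentation_imp_no_induced_4_cycle[OF G LP] by blast
      qed
    qed
    also have "\<dots> \<le> few n + pr n (p n) ?A" unfolding few_def by (rule pr_disj_le)
    also have "pr n (p n) ?A \<le> err n" unfolding err_def using p[of n] by (intro pr_adjacent_edges) auto
    finally show ?thesis by simp
  qed
  have up_lim: "(\<lambda>n. few n + err n) \<longlonglongrightarrow> exp (- s / 2) * (1 + s / 2)"
    using tendsto_add[OF few_lim err_lim] by simp
  show "?LR \<longlonglongrightarrow> exp (- s / 2) * (1 + s / 2)"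
    by (rule tendsto_sandwich[OF _ _ few_lim up_lim]) (use low order_trans[OF mid up] in auto)
  show "?LP \<longlonglongrightarrow> exp (- s / 2) * (1 + s / 2)"
    by (rule tendsto_sandwich[OF _ _ few_lim up_lim]) (use up order_trans[OF low mid] in auto)
qed

theorem theorem1p2:
  fixes p :: "nat \<Rightarrow> real" and lam :: real
  assumes "\<And>n. 0 \<le> p n \<and> p n \<le> 1"
    and "lam > 0"
    and "(\<lambda>n. (real n * (1 - p n)) ^ 4 * (p n) ^ 2) \<longlonglongrightarrow> lam"
  shows
    "(p \<longlonglongrightarrow> 0 \<longrightarrow>
       (\<lambda>n. measure_pmf.prob (erdos_renyi n (p n))
          {G. has_linear_resolution n (edge_ideal n G :: 'k::field mpoly set)})
         \<longlonglongrightarrow> exp (- sqrt lam / 2) * (1 + sqrt lam / 2) \<and>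
       (\<lambda>n. measure_pmf.prob (erdos_renyi n (p n))
          {G. has_linear_presentation n (edge_ideal n G :: 'k mpoly set)})
         \<longlonglongrightarrow> exp (- sqrt lam / 2) * (1 + sqrt lam / 2)) \<and>
     (p \<longlonglongrightarrow> 1 \<longrightarrow>
       (\<lambda>n. measure_pmf.prob (erdos_renyi n (p n))
          {G. has_linear_presentation n (edge_ideal n G :: 'k mpoly set)})
         \<longlonglongrightarrow> exp (- lam / 8) \<and>
       (\<lambda>n. measure_pmf.prob (erdos_renyi n (p n))
          {G. has_linear_resolution n (edge_ideal n G :: 'k mpoly set)})
         \<longlonglongrightarrow> exp_neg (suminf (\<lambda>k. if 4 \<le> k
              then ennreal (lam powr (real k / 4) / (2 * real k)) else 0)))"
proof (intro conjI impI)
  \<comment> \<open>The square root of the expression in the hypothesis is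
    \<open>n ^ 2 * p * (1 - p) ^ 2\<close>, and its last factor tends to 1.\<close>
  have sq: "(\<lambda>n. real n ^ 2 * p n) \<longlonglongrightarrow> sqrt lam" if p0: "p \<longlonglongrightarrow> 0"
  proof -
    have "(\<lambda>n. sqrt ((real n * (1 - p n)) ^ 4 * (p n) ^ 2) / (1 - p n) ^ 2) \<longlonglongrightarrow> sqrt lam / (1 - 0) ^ 2"
      by (intro tendsto_intros assms(3) p0) simp
    then have 1: "(\<lambda>n. sqrt ((real n * (1 - p n)) ^ 4 * (p n) ^ 2) / (1 - p n) ^ 2) \<longlonglongrightarrow> sqrt lam" by simp
    have "\<forall>\<^sub>F n in sequentially. p n < 1" using order_tendstoD(2)[OF p0, of 1] by simp
    then have "\<forall>\<^sub>F n in sequentially. sqrt ((real n * (1 - p n)) ^ 4 * (p n) ^ 2) / (1 - p n) ^ 2 = real n ^ 2 * p n"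
    proof eventually_elim
      case (elim n)
      have "(real n * (1 - p n)) ^ 4 * (p n) ^ 2 = ((real n ^ 2 * p n) * (1 - p n) ^ 2) ^ 2"
        by (simp add: power_mult_distrib power_mult[symmetric])
      then have "sqrt ((real n * (1 - p n)) ^ 4 * (p n) ^ 2) = (real n ^ 2 * p n) * (1 - p n) ^ 2"
        using assms(1)[of n] by (simp add: real_sqrt_abs)
      then show ?case using elim by simp
    qed
    with 1 show ?thesis by (rule Lim_transform_eventually)
  qed
  show "(\<lambda>n. measure_pmf.prob (erdos_renyi n (p n))
          {G. has_linear_resolution n (edge_ideal n G :: 'k mpoly set)})
         \<longlonglongrightarrow> exp (- sqrt lam / 2) * (1 + sqrt lam / 2)" if "p \<longlonglongrightarrow> 0"
    using sparse_tendsto(1)[OF assms(1) that sq[OF that]] unfolding pr_def .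
  show "(\<lambda>n. measure_pmf.prob (erdos_renyi n (p n))
          {G. has_linear_presentation n (edge_ideal n G :: 'k mpoly set)})
         \<longlonglongrightarrow> exp (- sqrt lam / 2) * (1 + sqrt lam / 2)" if "p \<longlonglongrightarrow> 0"
    using sparse_tendsto(2)[OF assms(1) that sq[OF that]] unfolding pr_def .
next
  assume p1: "p \<longlonglongrightarrow> 1"
  define q where "q n = 1 - p n" for n
  \<comment> \<open>The limit of \<open>n * q\<close>: after division by \<open>p ^ 2\<close>, which
    tends to 1, the hypothesis is the fourth power of \<open>n * q\<close>.\<close>
  define c where "c = lam powr (1 / 4)"
  have q: "0 \<le> q n" "q n \<le> 1" for n using assms(1)[of n] by (auto simp: q_def)
  have c0: "0 < c" using assms(2) by (simp add: c_def)
  have ck: "c ^ k = lam powr (real k / 4)" for k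
    using assms(2) by (simp add: c_def powr_realpow[symmetric] powr_powr)
  have qlim: "q \<longlonglongrightarrow> 0"
    using tendsto_diff[OF tendsto_const[of 1] p1] by (simp add: q_def[abs_def])
  have nq: "(\<lambda>n. real n * q n) \<longlonglongrightarrow> c"
  proof -
    have "(\<lambda>n. root 4 ((real n * (1 - p n)) ^ 4 * (p n) ^ 2 / (p n) ^ 2)) \<longlonglongrightarrow> root 4 (lam / 1 ^ 2)"
      by (intro tendsto_intros assms(3) p1) simp
    moreover have "root 4 (lam / 1 ^ 2) = c"
      using assms(2) by (simp add: c_def root_powr_inverse)
    ultimately have 1: "(\<lambda>n. root 4 ((real n * (1 - p n)) ^ 4 * (p n) ^ 2 / (p n) ^ 2)) \<longlonglongrightarrow> c" by simp
    have "\<forall>\<^sub>F n in sequentially. 0 < p n" using order_tendstoD(1)[OF p1, of 0] by simp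
    then have "\<forall>\<^sub>F n in sequentially. root 4 ((real n * (1 - p n)) ^ 4 * (p n) ^ 2 / (p n) ^ 2) = real n * q n"
    proof eventually_elim
      case (elim n)
      have "root 4 ((real n * (1 - p n)) ^ 4) = real n * (1 - p n)"
        using assms(1)[of n] by (intro real_root_power_cancel) auto
      then show ?case using elim by (simp add: q_def)
    qed
    with 1 show ?thesis by (rule Lim_transform_eventually)
  qed
  have pq: "1 - q n = p n" for n by (simp add: q_def)
  show "(\<lambda>n. measure_pmf.prob (erdos_renyi n (p n))
          {G. has_linear_presentation n (edge_ideal n G :: 'k mpoly set)})
         \<longlonglongrightarrow> exp (- lam / 8)"
    using linear_presentation_tendsto[OF q qlim nq, where 'k = 'k] ck[of 4] assms(2) unfolding pq pr_def by simp
  define a where "a k = (if 4 \<le> k then c ^ k / (2 * real k) else 0)" for k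
  have a0: "0 \<le> a k" for k using c0 by (simp add: a_def)
  have ea: "(\<lambda>k. if 4 \<le> k then ennreal (lam powr (real k / 4) / (2 * real k)) else 0) = (\<lambda>k. ennreal (a k))"
    by (rule ext) (simp add: a_def ck)
  have sum_a: "(\<Sum>k<Suc L. a k) = (\<Sum>k\<in>{4..L}. c ^ k / (2 * real k))" for L
    unfolding a_def by (subst sum.inter_filter[symmetric]) (auto intro!: sum.cong)
  have lim: "(\<lambda>L. exp (- (\<Sum>k\<in>{4..L}. c ^ k / (2 * real k)))) \<longlonglongrightarrow> exp_neg (suminf (\<lambda>k. ennreal (a k)))"
    using LIMSEQ_Suc[OF exp_neg_suminf_tendsto(1)[of a, OF a0]] unfolding sum_a .
  \<comment> \<open>For \<open>c \<ge> 1\<close> the terms are at least \<open>1 / (2 * k)\<close>,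
    so the series diverges with the harmonic series and the limit is 0.\<close>
  have "c < 1 \<or> exp_neg (suminf (\<lambda>k. ennreal (a k))) = 0"
  proof (cases "c < 1")
    case False
    have "\<not> summable a"
    proof
      assume "summable a"
      then have s: "summable (\<lambda>k. 2 * a (k + 4))" by (intro summable_mult summable_ignore_initial_segment)
      have "summable (\<lambda>k. inverse (real (k + 4)))"
      proof (rule summable_comparison_test'[OF s])
        fix k :: nat
        have "1 \<le> c ^ (k + 4)" using False by (intro one_le_power) simp
        then have "1 / real (k + 4) \<le> c ^ (k + 4) / real (k + 4)" by (intro divide_right_mono) auto
        then show "norm (inverse (real (k + 4))) \<le> 2 * a (k + 4)" by (simp add: a_def inverse_eq_divide del: of_nat_add)
      qed
      then have "summable (\<lambda>k. inverse (real k))" by (subst (asm) summable_iff_shift[of "\<lambda>k. inverse (real k)"])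
      then show False using not_summable_harmonic[where 'a = real] by simp
    qed
    then show ?thesis using exp_neg_suminf_tendsto(2)[of a, OF a0] by simp
  qed simp
  then show "(\<lambda>n. measure_pmf.prob (erdos_renyi n (p n))
          {G. has_linear_resolution n (edge_ideal n G :: 'k mpoly set)})
         \<longlonglongrightarrow> exp_neg (suminf (\<lambda>k. if 4 \<le> k
              then ennreal (lam powr (real k / 4) / (2 * real k)) else 0))"
    using linear_resolution_tendsto[OF q qlim nq lim, where 'k = 'k] c0 unfolding pq pr_def ea by simp
qed

end
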